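(* Let $i:N\to\mathcal{N}$ be the morphism of $\mathcal{J}$-assemblies from the natural numbers object $N$ to the nonstandard $\mathcal{J}$-assembly $\mathcal{N}$ (both defined in the context). The map $i$ is an elementary embedding. For every formula $\varphi(v_1,\ldots,v_n)$ of the language of arithmetic and all natural numbers $a_1,\ldots,a_n$, the following four assertions are equivalent: (i) $\varphi(a_1,\ldots,a_n)$ is true in the classical model $\mathbb{N}$; (ii) $\varphi(a_1,\ldots,a_n)$ has a $\mathcal{J}$-realizer in the sense of the $\mathcal{J}$-assembly $N$; (iii) $\varphi(i(a_1),\ldots,i(a_n))$ has a $\mathcal{J}$-realizer in the sense of the $\mathcal{J}$-assembly $\mathcal{N}$; (iv) $\varphi(i(a_1),\ldots,i(a_n))$ is true in the classical model $\mathcal{N}$. Moreover, the equivalence (ii)$\Leftrightarrow$(iii) is effective in realizers: for each formula $\varphi(v_1,\ldots,v_n)$ there are partial recursive functions that transform every $\mathcal{J}$-realizer of $\varphi(a_1,\ldots,a_n)$ (in the sense of $N$) into a $\mathcal{J}$-realizer of $\varphi(i(a_1),\ldots,i(a_n))$ (in the sense of $\mathcal{N}$), and conversely, for all $a_1,\ldots,a_n$. Furthermore, if $\alpha_1,\ldots,\alpha_n:\mathbb{N}\to\mathbb{N}$ are arithmetical functions, then the following are equivalent: (i') $\varphi([\alpha_1],\ldots,[\alpha_n])$ is true in the classical model $\mathcal{N}$; (ii') $\varphi([\alpha_1],\ldots,[\alpha_n])$ has a $\mathcal{J}$-realizer (in the sense of $\mathcal{N}$); (iii') $\varphi(\alpha_1(\psi(k)),\ldots,\alpha_n(\psi(k)))$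 is true in $\mathbb{N}$ for all but finitely many $k$.
   Context: Notation. Fix a recursive coding $\langle a_0,\ldots,a_{n-1}\rangle$ of finite sequences of natural numbers, with recursive length function and recursive projections $(\cdot)_i$. $\phi_e$ is the partial recursive function with index $e$. For $A,B\subseteq\mathbb{N}$: $A\to B$ is the set of indices $e$ such that for every $a\in A$, $\phi_e(a)$ is defined and $\phi_e(a)\in B$; $A\wedge B=\{\langle a,b\rangle\mid a\in A,b\in B\}$ (similarly $A_1\wedge\cdots\wedge A_n$ consists of coded $n$-tuples; for $n=1$ it is $A_1$, and for $n=0$ it imposes no condition); ${\uparrow}n=\{m\mid n\le m\}$. Pitts' local operator. $\mathcal{F}A=\bigcup_{n}({\uparrow}n\to A)$ and $\mathcal{J}A=\bigcap\{B\subseteq\mathbb{N}\mid\{0\}\wedge A\subseteq B\text{ and }\{1\}\wedge\mathcal{F}B\subseteq B\}$, for $A\subseteq\mathbb{N}$. An index $e$ ($\mathcal{J}$-)represents $f:\mathbb{N}\to\mathbb{N}$ if $\phi_e$ is total and $\phi_e(n)\in\mathcal{J}\{f(n)\}$ for all $n$; $f$ is $\mathcal{J}$-representable if such $e$ exists. $\mathcal{J}$-assemblies. A $\mathcal{J}$-assembly is a pair $(X,E)$ with $X$ a set and $E$ assigning to each $x\in X$ a nonempty $E(x)\subseteq\mathbb{N}$. A morphism $(X,E)\to(Y,F)$ is a function $f:X\to Y$ such that $\bigcap_{x\in X}(E(x)\to\mathcal{J}F(f(x)))$ is nonempty; its elements are said to track $f$. The product of $(X,E)$ and $(Y,F)$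 is $(X\times Y,G)$ with $G(x,y)=E(x)\wedge F(y)$. The natural numbers object is $N=(\mathbb{N},\{\cdot\})$, i.e. $E(n)=\{n\}$. A subobject of $(X,E)$ is given by $R:X\to\mathcal{P}(\mathbb{N})$ such that $\bigcap_{x\in X}(R(x)\to\mathcal{J}E(x))$ is nonempty. $\mathcal{J}$-realizability. Let $(X,E)$ be a $\mathcal{J}$-assembly that is a structure for a first-order language: $n$-ary function symbols $f$ are interpreted as morphisms $[f]:(X,E)^n\to(X,E)$ and $n$-ary relation symbols $R$ by subobjects $[R]:X^n\to\mathcal{P}(\mathbb{N})$ of $(X,E)^n$. For a formula and $\vec{x}=(x_1,\ldots,x_n)$ in $X$, "$e$ $\mathcal{J}$-realizes" is defined by: - $e$ realizes $(t=s)(\vec x)$ iff $e\in\mathcal{J}E(x_1)\wedge\cdots\wedge\mathcal{J}E(x_n)$ and $[t](\vec x)=[s](\vec x)$; - $e$ realizes $R(\vec x)$ iff $e\in[R](\vec x)$; - $e$ realizes $(\phi\wedge\chi)(\vec x)$ iff $(e)_0$ realizes $\phi(\vec x)$ and $(e)_1$ realizes $\chi(\vec x)$; - $e$ realizes $(\phi\vee\chi)(\vec x)$ iff either $(e)_0=0$ and $(e)_1$ realizes $\phi(\vec x)$, or $(e)_0\ne0$ and $(e)_1$ realizes $\chi(\vec x)$; - $e$ realizes $(\phi\to\chi)(\vec x)$ iff $(e)_0\in\mathcal{J}E(x_1)\wedge\cdots\wedge\mathcal{J}E(x_n)$ and for every $m$ realizing $\phi(\vec x)$, $\phi_{(e)_1}(m)$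 is defined and lies in $\mathcal{J}\{k\mid k\text{ realizes }\chi(\vec x)\}$; - $e$ realizes $\exists x\,\phi(\vec x)$ iff for some $a\in X$, $(e)_0\in\mathcal{J}E(a)$ and $(e)_1$ realizes $\phi(a,\vec x)$; - $e$ realizes $\forall x\,\phi(\vec x)$ iff $(e)_0\in\mathcal{J}E(x_1)\wedge\cdots\wedge\mathcal{J}E(x_n)$ and for all $y\in X$ and $k\in E(y)$, $\phi_{(e)_1}(k)$ is defined and lies in $\mathcal{J}\{m\mid m\text{ realizes }\phi(y,\vec x)\}$. Negation is $\neg\phi:=(\phi\to\bot)$, where $\bot$ has no realizers. The assembly $N$ is a structure for the language of arithmetic in the standard way. The nonstandard model. Let $\alpha_0,\alpha_1,\ldots$ be an enumeration of all arithmetical functions $\mathbb{N}\to\mathbb{N}$ (functions with arithmetically definable graph). Put $A_0=\mathbb{N}$. Suppose $A_k$ is infinite and for all $i,j\le k$ one of $\alpha_i<\alpha_j$, $\alpha_i=\alpha_j$, $\alpha_i>\alpha_j$ holds throughout $A_k$; let $\beta_1<\cdots<\beta_l$ be the ordered list of the distinct restrictions of $\alpha_0,\ldots,\alpha_k$ to $A_k$. Let $A_{k+1}$ be the first infinite set in the list $\{x\in A_k\mid\alpha_{k+1}(x)<\beta_1(x)\}$, $\{x\in A_k\mid\alpha_{k+1}(x)=\beta_1(x)\}$, $\{x\in A_k\mid\beta_1(x)<\alpha_{k+1}(x)<\beta_2(x)\}$, $\ldots$, $\{x\in A_k\mid\beta_l(x)<\alpha_{k+1}(x)\}$. Let $\psi(0)=0$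 and let $\psi(k+1)$ be the least element of $A_{k+1}$ that is $>\psi(k)$. The enumeration is chosen so that the whole construction is recursive in a truth function for arithmetic (which is hyperarithmetical), so that $\psi$ is $\mathcal{J}$-representable. Arithmetical functions $\alpha,\beta$ are equivalent if $\alpha(\psi(n))=\beta(\psi(n))$ for all large enough $n$; $[\alpha]$ denotes the class of $\alpha$ and $\mathcal{N}$ the set of classes. Arithmetical functions extend to $\mathcal{N}$ by $\beta([\alpha])=[\beta\alpha]$ (similarly in several arguments, by $\beta([\alpha_1],\ldots,[\alpha_m])=[n\mapsto\beta(\alpha_1(n),\ldots,\alpha_m(n))]$), so $\mathcal{N}$ is a classical structure for the language of arithmetic. $\mathcal{N}$ is made a $\mathcal{J}$-assembly by $E([\alpha])=\{e\mid\text{for some }\beta\in[\alpha],\ e\text{ represents }\beta\psi\}$, where $\beta\psi$ is the composite $n\mapsto\beta(\psi(n))$; the operations above are morphisms, so this assembly is also a structure for the language of arithmetic. The morphism $i:N\to\mathcal{N}$ sends $n$ to the class of the constant function with value $n$. That $i$ is an elementary embedding of $\mathcal{J}$-assemblies means that for all arithmetical formulas $\varphi$ and all $a_1,\ldots,a_n\in\mathbb{N}$, $\varphi(a_1,\ldots,a_n)$ has a $\mathcal{J}$-realizer in the sense of $N$ iff $\varphi(i(a_1),\ldots,i(a_n))$ has one in the sense of $\mathcal{N}$. *)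

theory Defs
  imports "HOL-Library.Nat_Bijection" "HOL-Library.FuncSet"
begin

section \<open>Partial recursive functions\<close>

text \<open>Finite sequences of natural numbers are coded by the bijection \<open>list_encode\<close> of
  \<open>HOL-Library.Nat_Bijection\<close>; projections outside the length of the sequence are \<open>0\<close>.\<close>

definition proj :: "nat \<Rightarrow> nat \<Rightarrow> nat" where
  "proj e i = (if i < length (list_decode e) then list_decode e ! i else 0)"

text \<open>Kleene's \<open>\<mu>\<close>-recursive functions, relative to an auxiliary partial function \<open>orc\<close>. The recursion variable
  and the search variable come first; in the step function of a primitive recursion the
  recursion variable is followed by the previous value.\<close>

datatype recf =
    RZero
  | RSucc
  | RProj nat
  | ROracle
  | RComp recf "recf list"
  | RPrec recf recf
  | RMu recf

inductive computes :: "(nat \<rightharpoonup> nat) \<Rightarrow> recf \<Rightarrow> nat list \<Rightarrow> nat \<Rightarrow> bool"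
  for orc :: "nat \<rightharpoonup> nat" where
  zero: "computes orc RZero xs 0"
| succ: "computes orc RSucc (x # xs) (Suc x)"
| proj: "i < length xs \<Longrightarrow> computes orc (RProj i) xs (xs ! i)"
| orc: "orc x = Some y \<Longrightarrow> computes orc ROracle (x # xs) y"
| comp: "length ys = length gs \<Longrightarrow> (\<And>i. i < length gs \<Longrightarrow> computes orc (gs ! i) xs (ys ! i)) \<Longrightarrow>
    computes orc f ys z \<Longrightarrow> computes orc (RComp f gs) xs z"
| prec_0: "computes orc f xs z \<Longrightarrow> computes orc (RPrec f g) (0 # xs) z"
| prec_Suc: "computes orc (RPrec f g) (n # xs) y \<Longrightarrow> computes orc g (n # y # xs) z \<Longrightarrow>
    computes orc (RPrec f g) (Suc n # xs) z"
| mu: "computes orc f (n # xs) 0 \<Longrightarrow> (\<And>m. m < n \<Longrightarrow> \<exists>y. computes orc f (m # xs) (Suc y)) \<Longrightarrow>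
    computes orc (RMu f) xs n"

primrec recf_code :: "recf \<Rightarrow> nat" where
  "recf_code RZero = list_encode [0]"
| "recf_code RSucc = list_encode [1]"
| "recf_code (RProj i) = list_encode [2, i]"
| "recf_code ROracle = list_encode [3]"
| "recf_code (RComp f gs) = list_encode (4 # recf_code f # map recf_code gs)"
| "recf_code (RPrec f g) = list_encode [5, recf_code f, recf_code g]"
| "recf_code (RMu f) = list_encode [6, recf_code f]"

text \<open>\<open>phi e a b\<close> says that \<open>\<phi>\<^sub>e(a)\<close> is defined with value \<open>b\<close>. Here \<open>orc\<close> is nowhere
  defined, and numbers that code no program are indices of the nowhere defined function.\<close>

definition phi :: "nat \<Rightarrow> nat \<Rightarrow> nat \<Rightarrow> bool" where
  "phi e a b \<longleftrightarrow> (\<exists>f. recf_code f = e \<and> computes Map.empty f [a] b)"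

definition recursive_in :: "(nat \<Rightarrow> nat) \<Rightarrow> nat \<Rightarrow> (nat list \<Rightarrow> nat) \<Rightarrow> bool" where
  "recursive_in g n h \<longleftrightarrow>
    (\<exists>f. \<forall>xs. length xs = n \<longrightarrow> computes (\<lambda>x. Some (g x)) f xs (h xs))"

lemma computes_unique: "computes orc f xs y \<Longrightarrow> computes orc f xs z \<Longrightarrow> y = z"
proof (induction arbitrary: z rule: computes.induct)
  case (zero xs)
  then show ?case by (cases rule: computes.cases) auto
next
  case (succ x xs)
  then show ?case by (cases rule: computes.cases) auto
next
  case (proj i xs)
  from proj.prems show ?case by (cases rule: computes.cases) auto
next
  case (orc x y xs)
  from orc.prems orc.hyps show ?case by (cases rule: computes.cases) auto
next
  case (comp ys gs xs f w)
  from comp.prems obtain zs where zs: "length zs = length gs"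
      "\<And>i. i < length gs \<Longrightarrow> computes orc (gs ! i) xs (zs ! i)" "computes orc f zs z"
    by (cases rule: computes.cases) auto
  have "ys = zs"
    using comp.hyps(1) comp.IH(1) zs by (intro nth_equalityI) auto
  then show ?case using comp.IH(2) zs(3) by simp
next
  case (prec_0 f xs w g)
  from prec_0.prems prec_0.IH show ?case by (cases rule: computes.cases) auto
next
  case (prec_Suc f g n xs y w)
  from prec_Suc.prems obtain y' where "computes orc (RPrec f g) (n # xs) y'"
      "computes orc g (n # y' # xs) z"
    by (cases rule: computes.cases) auto
  then show ?case using prec_Suc.IH by metis
next
  case (mu f n xs)
  from mu.prems have z: "computes orc f (z # xs) 0"
      "\<And>m. m < z \<Longrightarrow> \<exists>y. computes orc f (m # xs) (Suc y)"
    by (cases rule: computes.cases; auto)+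
  show ?case
  proof (cases n z rule: linorder_cases)
    case less
    then show ?thesis using z(2) mu.IH(1) by (metis nat.distinct(1))
  next
    case greater
    then show ?thesis using z(1) mu.IH(2) by (metis nat.distinct(1))
  qed
qed

lemma recf_code_inject: "recf_code f = recf_code g \<Longrightarrow> f = g"
proof (induction f arbitrary: g)
  case (RComp f gs)
  then obtain f' gs' where g: "g = RComp f' gs'" by (cases g) auto
  have "map recf_code gs = map recf_code gs'" using RComp.prems g by (simp add: list_encode_eq)
  then have "gs = gs'"
    using RComp.IH(2) by (metis (no_types, lifting) length_map map_eq_imp_length_eq nth_equalityI nth_map nth_mem)
  then show ?case using RComp.IH(1) RComp.prems g by auto
next
  case (RPrec f1 f2)
  then show ?case by (cases g) auto
next
  case (RMu f)
  then show ?case by (cases g) auto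
qed (case_tac g; simp)+

lemma phi_unique: "phi e a b \<Longrightarrow> phi e a c \<Longrightarrow> b = c"
  unfolding phi_def using computes_unique recf_code_inject by metis


section \<open>Pitts' local operator\<close>

definition arrow :: "nat set \<Rightarrow> nat set \<Rightarrow> nat set" where
  "arrow A B = {e. \<forall>a\<in>A. \<exists>b\<in>B. phi e a b}"

definition wedge :: "nat set \<Rightarrow> nat set \<Rightarrow> nat set" where
  "wedge A B = {list_encode [a, b] | a b. a \<in> A \<and> b \<in> B}"

fun wedges :: "nat set list \<Rightarrow> nat set" where
  "wedges [] = UNIV"
| "wedges [A] = A"
| "wedges As = {list_encode xs | xs. list_all2 (\<in>) xs As}"

definition F_op :: "nat set \<Rightarrow> nat set" where
  "F_op A = (\<Union>n. arrow {n..} A)"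

definition J_op :: "nat set \<Rightarrow> nat set" where
  "J_op A = \<Inter>{B. wedge {0} A \<subseteq> B \<and> wedge {1} (F_op B) \<subseteq> B}"

definition represents :: "nat \<Rightarrow> (nat \<Rightarrow> nat) \<Rightarrow> bool" where
  "represents e f \<longleftrightarrow> (\<forall>n. \<exists>b\<in>J_op {f n}. phi e n b)"


section \<open>Assemblies\<close>

type_synonym 'a assembly = "'a set \<times> ('a \<Rightarrow> nat set)"

definition is_assembly :: "'a assembly \<Rightarrow> bool" where
  "is_assembly P \<longleftrightarrow> (case P of (X, E) \<Rightarrow> \<forall>x\<in>X. E x \<noteq> {})"

definition is_morphism :: "'a assembly \<Rightarrow> 'b assembly \<Rightarrow> ('a \<Rightarrow> 'b) \<Rightarrow> bool" where
  "is_morphism P Q f \<longleftrightarrow> (case P of (X, E) \<Rightarrow> case Q of (Y, G) \<Rightarrow>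
    f \<in> X \<rightarrow> Y \<and> (\<exists>e. \<forall>x\<in>X. e \<in> arrow (E x) (J_op (G (f x)))))"

definition prod_assembly :: "'a assembly \<Rightarrow> 'b assembly \<Rightarrow> ('a \<times> 'b) assembly" where
  "prod_assembly P Q = (case P of (X, E) \<Rightarrow> case Q of (Y, G) \<Rightarrow>
    (X \<times> Y, \<lambda>(x, y). wedge (E x) (G y)))"


section \<open>The language of arithmetic\<close>

text \<open>De Bruijn indices: in a context \<open>xs\<close> the variable \<open>TVar i\<close> denotes \<open>xs ! i\<close>, and a
  quantifier puts its variable in front of the context. A formula \<open>\<phi>\<close> with \<open>fm_in n \<phi>\<close> is a
  formula \<open>\<phi>(v\<^sub>1, \<dots>, v\<^sub>n)\<close>.\<close>

datatype tm = TVar nat | TZero | TSucc tm | TAdd tm tm | TMul tm tm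

datatype fm =
    FBot
  | FEq tm tm
  | FAnd fm fm
  | FOr fm fm
  | FImp fm fm
  | FEx fm
  | FAll fm

primrec tm_in :: "nat \<Rightarrow> tm \<Rightarrow> bool" where
  "tm_in n (TVar i) \<longleftrightarrow> i < n"
| "tm_in n TZero \<longleftrightarrow> True"
| "tm_in n (TSucc t) \<longleftrightarrow> tm_in n t"
| "tm_in n (TAdd t s) \<longleftrightarrow> tm_in n t \<and> tm_in n s"
| "tm_in n (TMul t s) \<longleftrightarrow> tm_in n t \<and> tm_in n s"

primrec fm_in :: "nat \<Rightarrow> fm \<Rightarrow> bool" where
  "fm_in n FBot \<longleftrightarrow> True"
| "fm_in n (FEq t s) \<longleftrightarrow> tm_in n t \<and> tm_in n s"
| "fm_in n (FAnd \<phi> \<chi>) \<longleftrightarrow> fm_in n \<phi> \<and> fm_in n \<chi>"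
| "fm_in n (FOr \<phi> \<chi>) \<longleftrightarrow> fm_in n \<phi> \<and> fm_in n \<chi>"
| "fm_in n (FImp \<phi> \<chi>) \<longleftrightarrow> fm_in n \<phi> \<and> fm_in n \<chi>"
| "fm_in n (FEx \<phi>) \<longleftrightarrow> fm_in (Suc n) \<phi>"
| "fm_in n (FAll \<phi>) \<longleftrightarrow> fm_in (Suc n) \<phi>"

record 'a arith_structure =
  dom :: "'a set"
  zer :: 'a
  suc :: "'a \<Rightarrow> 'a"
  add :: "'a \<Rightarrow> 'a \<Rightarrow> 'a"
  mul :: "'a \<Rightarrow> 'a \<Rightarrow> 'a"

record 'a arith_assembly = "'a arith_structure" +
  eset :: "'a \<Rightarrow> nat set"

primrec tm_val :: "('a, 'b) arith_structure_scheme \<Rightarrow> 'a list \<Rightarrow> tm \<Rightarrow> 'a" where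
  "tm_val M xs (TVar i) = xs ! i"
| "tm_val M xs TZero = zer M"
| "tm_val M xs (TSucc t) = suc M (tm_val M xs t)"
| "tm_val M xs (TAdd t s) = add M (tm_val M xs t) (tm_val M xs s)"
| "tm_val M xs (TMul t s) = mul M (tm_val M xs t) (tm_val M xs s)"

primrec sat :: "('a, 'b) arith_structure_scheme \<Rightarrow> fm \<Rightarrow> 'a list \<Rightarrow> bool" where
  "sat M FBot xs \<longleftrightarrow> False"
| "sat M (FEq t s) xs \<longleftrightarrow> tm_val M xs t = tm_val M xs s"
| "sat M (FAnd \<phi> \<chi>) xs \<longleftrightarrow> sat M \<phi> xs \<and> sat M \<chi> xs"
| "sat M (FOr \<phi> \<chi>) xs \<longleftrightarrow> sat M \<phi> xs \<or> sat M \<chi> xs"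
| "sat M (FImp \<phi> \<chi>) xs \<longleftrightarrow> (sat M \<phi> xs \<longrightarrow> sat M \<chi> xs)"
| "sat M (FEx \<phi>) xs \<longleftrightarrow> (\<exists>a\<in>dom M. sat M \<phi> (a # xs))"
| "sat M (FAll \<phi>) xs \<longleftrightarrow> (\<forall>a\<in>dom M. sat M \<phi> (a # xs))"

definition assembly_of :: "'a arith_assembly \<Rightarrow> 'a assembly" where
  "assembly_of M = (dom M, eset M)"

definition is_arith_assembly :: "'a arith_assembly \<Rightarrow> bool" where
  "is_arith_assembly M \<longleftrightarrow> is_assembly (assembly_of M) \<and>
    zer M \<in> dom M \<and>
    is_morphism (assembly_of M) (assembly_of M) (suc M) \<and>
    is_morphism (prod_assembly (assembly_of M) (assembly_of M)) (assembly_of M)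
      (\<lambda>(x, y). add M x y) \<and>
    is_morphism (prod_assembly (assembly_of M) (assembly_of M)) (assembly_of M)
      (\<lambda>(x, y). mul M x y)"


section \<open>J-realizers\<close>

definition ctx :: "'a arith_assembly \<Rightarrow> 'a list \<Rightarrow> nat set" where
  "ctx M xs = wedges (map (\<lambda>x. J_op (eset M x)) xs)"

text \<open>\<open>rz_set M \<phi> xs\<close> is the set of numbers that J-realize \<open>\<phi>(xs)\<close> in the sense of \<open>M\<close>. The
  language of arithmetic has no relation symbols, so equations are the only atomic formulas
  besides \<open>\<bottom>\<close>.\<close>

primrec rz_set :: "'a arith_assembly \<Rightarrow> fm \<Rightarrow> 'a list \<Rightarrow> nat set" where
  "rz_set M FBot xs = {}"
| "rz_set M (FEq t s) xs = {e. e \<in> ctx M xs \<and> tm_val M xs t = tm_val M xs s}"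
| "rz_set M (FAnd \<phi> \<chi>) xs =
    {e. proj e 0 \<in> rz_set M \<phi> xs \<and> proj e 1 \<in> rz_set M \<chi> xs}"
| "rz_set M (FOr \<phi> \<chi>) xs =
    {e. proj e 0 = 0 \<and> proj e 1 \<in> rz_set M \<phi> xs \<or>
        proj e 0 \<noteq> 0 \<and> proj e 1 \<in> rz_set M \<chi> xs}"
| "rz_set M (FImp \<phi> \<chi>) xs =
    {e. proj e 0 \<in> ctx M xs \<and>
        proj e 1 \<in> arrow (rz_set M \<phi> xs) (J_op (rz_set M \<chi> xs))}"
| "rz_set M (FEx \<phi>) xs =
    {e. \<exists>a\<in>dom M. proj e 0 \<in> J_op (eset M a) \<and> proj e 1 \<in> rz_set M \<phi> (a # xs)}"
| "rz_set M (FAll \<phi>) xs =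
    {e. proj e 0 \<in> ctx M xs \<and>
        (\<forall>y\<in>dom M. proj e 1 \<in> arrow (eset M y) (J_op (rz_set M \<phi> (y # xs))))}"

definition elementary_embedding ::
    "'a arith_assembly \<Rightarrow> 'b arith_assembly \<Rightarrow> ('a \<Rightarrow> 'b) \<Rightarrow> bool" where
  "elementary_embedding M M' f \<longleftrightarrow>
    (\<forall>n \<phi> xs. fm_in n \<phi> \<and> length xs = n \<and> set xs \<subseteq> dom M \<longrightarrow>
      (rz_set M \<phi> xs \<noteq> {} \<longleftrightarrow> rz_set M' \<phi> (map f xs) \<noteq> {}))"


section \<open>The natural numbers and arithmetical truth\<close>

definition std_nat :: "nat arith_assembly" where
  "std_nat = \<lparr>dom = UNIV, zer = 0, suc = Suc, add = (+), mul = (*), eset = \<lambda>n. {n}\<rparr>"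

definition arithmetical :: "(nat \<Rightarrow> nat) \<Rightarrow> bool" where
  "arithmetical f \<longleftrightarrow> (\<exists>\<phi>. fm_in 2 \<phi> \<and> (\<forall>x y. f x = y \<longleftrightarrow> sat std_nat \<phi> [x, y]))"

primrec tm_code :: "tm \<Rightarrow> nat" where
  "tm_code (TVar i) = list_encode [0, i]"
| "tm_code TZero = list_encode [1]"
| "tm_code (TSucc t) = list_encode [2, tm_code t]"
| "tm_code (TAdd t s) = list_encode [3, tm_code t, tm_code s]"
| "tm_code (TMul t s) = list_encode [4, tm_code t, tm_code s]"

primrec fm_code :: "fm \<Rightarrow> nat" where
  "fm_code FBot = list_encode [0]"
| "fm_code (FEq t s) = list_encode [1, tm_code t, tm_code s]"
| "fm_code (FAnd \<phi> \<chi>) = list_encode [2, fm_code \<phi>, fm_code \<chi>]"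
| "fm_code (FOr \<phi> \<chi>) = list_encode [3, fm_code \<phi>, fm_code \<chi>]"
| "fm_code (FImp \<phi> \<chi>) = list_encode [4, fm_code \<phi>, fm_code \<chi>]"
| "fm_code (FEx \<phi>) = list_encode [5, fm_code \<phi>]"
| "fm_code (FAll \<phi>) = list_encode [6, fm_code \<phi>]"

definition truth :: "nat \<Rightarrow> nat" where
  "truth c = (if \<exists>\<phi>. fm_in 0 \<phi> \<and> fm_code \<phi> = c \<and> sat std_nat \<phi> [] then 1 else 0)"


section \<open>The sequence \<open>\<psi>\<close>\<close>

definition ordered_restrictions ::
    "(nat \<Rightarrow> nat \<Rightarrow> nat) \<Rightarrow> nat \<Rightarrow> nat set \<Rightarrow> (nat \<Rightarrow> nat) list" where
  "ordered_restrictions \<alpha> k A =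
    (THE \<beta>s. sorted_wrt (\<lambda>f g. \<forall>x\<in>A. f x < g x) \<beta>s \<and>
      set \<beta>s = (\<lambda>i. restrict (\<alpha> i) A) ` {..k})"

text \<open>On \<open>A\<close>, with \<open>\<beta>\<^sub>1 < \<dots> < \<beta>\<^sub>l\<close>, this is the list \<open>{\<gamma> < \<beta>\<^sub>1}\<close>, \<open>{\<gamma> = \<beta>\<^sub>1}\<close>,
  \<open>{\<beta>\<^sub>1 < \<gamma> < \<beta>\<^sub>2}\<close>, \dots, \<open>{\<beta>\<^sub>l < \<gamma>}\<close> of subsets of \<open>A\<close>: the first argument of the
  recursive call is the part of \<open>A\<close> on which \<open>\<gamma>\<close> exceeds all earlier \<open>\<beta>\<^sub>i\<close>.\<close>

primrec cells :: "nat set \<Rightarrow> (nat \<Rightarrow> nat) \<Rightarrow> (nat \<Rightarrow> nat) list \<Rightarrow> nat set list" where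
  "cells A \<gamma> [] = [A]"
| "cells A \<gamma> (\<beta> # \<beta>s) =
    {x \<in> A. \<gamma> x < \<beta> x} # {x \<in> A. \<gamma> x = \<beta> x} # cells {x \<in> A. \<beta> x < \<gamma> x} \<gamma> \<beta>s"

primrec A_seq :: "(nat \<Rightarrow> nat \<Rightarrow> nat) \<Rightarrow> nat \<Rightarrow> nat set" where
  "A_seq \<alpha> 0 = UNIV"
| "A_seq \<alpha> (Suc k) =
    the (find infinite (cells (A_seq \<alpha> k) (\<alpha> (Suc k)) (ordered_restrictions \<alpha> k (A_seq \<alpha> k))))"

primrec psi :: "(nat \<Rightarrow> nat \<Rightarrow> nat) \<Rightarrow> nat \<Rightarrow> nat" where
  "psi \<alpha> 0 = 0"
| "psi \<alpha> (Suc k) = (LEAST x. x \<in> A_seq \<alpha> (Suc k) \<and> psi \<alpha> k < x)"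

text \<open>The enumeration, the sets \<open>A\<^sub>k\<close> and the sequence \<open>\<psi>\<close> are recursive in \<open>g\<close>, uniformly
  in \<open>k\<close>.\<close>

definition construction_recursive_in :: "(nat \<Rightarrow> nat) \<Rightarrow> (nat \<Rightarrow> nat \<Rightarrow> nat) \<Rightarrow> bool" where
  "construction_recursive_in g \<alpha> \<longleftrightarrow>
    recursive_in g 2 (\<lambda>xs. \<alpha> (xs ! 0) (xs ! 1)) \<and>
    recursive_in g 2 (\<lambda>xs. if xs ! 1 \<in> A_seq \<alpha> (xs ! 0) then 1 else 0) \<and>
    recursive_in g 1 (\<lambda>xs. psi \<alpha> (xs ! 0))"


section \<open>The nonstandard model\<close>

definition cls :: "(nat \<Rightarrow> nat) \<Rightarrow> (nat \<Rightarrow> nat) \<Rightarrow> (nat \<Rightarrow> nat) set" where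
  "cls \<psi> \<alpha> = {\<beta>. arithmetical \<beta> \<and> (\<forall>\<^sub>F n in sequentially. \<alpha> (\<psi> n) = \<beta> (\<psi> n))}"

text \<open>The operation \<open>\<beta>([\<alpha>\<^sub>1], \<dots>, [\<alpha>\<^sub>m]) = [n \<mapsto> \<beta>(\<alpha>\<^sub>1(n), \<dots>, \<alpha>\<^sub>m(n))]\<close>; all members of the
  union are equal when the arguments are classes.\<close>

definition cls_op ::
    "(nat \<Rightarrow> nat) \<Rightarrow> (nat list \<Rightarrow> nat) \<Rightarrow> (nat \<Rightarrow> nat) set list \<Rightarrow> (nat \<Rightarrow> nat) set" where
  "cls_op \<psi> \<beta> cs = \<Union>{cls \<psi> (\<lambda>n. \<beta> (map (\<lambda>\<alpha>. \<alpha> n) \<alpha>s)) | \<alpha>s. list_all2 (\<in>) \<alpha>s cs}"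

definition nonstd :: "(nat \<Rightarrow> nat) \<Rightarrow> (nat \<Rightarrow> nat) set arith_assembly" where
  "nonstd \<psi> =
    \<lparr>dom = cls \<psi> ` {\<alpha>. arithmetical \<alpha>},
     zer = cls_op \<psi> (\<lambda>_. 0) [],
     suc = (\<lambda>a. cls_op \<psi> (\<lambda>xs. Suc (xs ! 0)) [a]),
     add = (\<lambda>a b. cls_op \<psi> (\<lambda>xs. xs ! 0 + xs ! 1) [a, b]),
     mul = (\<lambda>a b. cls_op \<psi> (\<lambda>xs. xs ! 0 * xs ! 1) [a, b]),
     eset = (\<lambda>c. {e. \<exists>\<beta>\<in>c. represents e (\<beta> \<circ> \<psi>)})\<rparr>"

definition incl :: "(nat \<Rightarrow> nat) \<Rightarrow> nat \<Rightarrow> (nat \<Rightarrow> nat) set" where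
  "incl \<psi> n = cls \<psi> (\<lambda>_. n)"

end

theory Submission
  imports Defs
begin

text \<open>
  The local operator \<open>J\<close> adds to recursion the limits of eventually constant sequences: an
  element of \<open>J {a}\<close> may name a recursive sequence of which all but finitely many terms lie in
  \<open>J {a}\<close>. A quantifier over \<open>\<nat>\<close> is such a limit, since the truth value of \<open>\<exists>x \<le> k. \<phi>(x)\<close> is
  eventually constant in \<open>k\<close>. So arithmetical truth is representable
  (\<open>fm_program\<close>, \<open>truth_representable\<close>), and with it every function that is recursive in it
  (\<open>representable_recursive_in\<close>), in particular \<open>\<psi>\<close>.

  On the classical side, the shrinking sets \<open>A\<^sub>k\<close> decide every arithmetical property along \<open>\<psi>\<close>
  (\<open>decisive_psi\<close>), and least witnesses are arithmetical functions; this gives the theorem of Los,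
  that truth in \<open>\<N>\<close> is truth in \<open>\<nat>\<close> at almost all \<open>\<psi>(k)\<close>. Elementarity of the embedding,
  in the classical sense, is the case of constant functions.

  Both structures therefore have, for every formula, a program that decides it up to \<open>J\<close> and a
  program that finds witnesses up to \<open>J\<close>, given realizers of the parameters (\<open>tractable\<close>). In
  \<open>\<N>\<close> the truth value is the limit of the truth values at \<open>\<psi>(k)\<close>, and the sequence of least
  witnesses at \<open>\<psi>(k)\<close> is a realizer of a witness. In every structure with such programs
  realizability coincides with truth (\<open>realizable_iff_sat\<close>): a true implication is realized by
  ignoring the argument and finding a realizer of the conclusion by means of these programs.

  Transforming realizers between \<open>\<nat>\<close> and \<open>\<N>\<close> asks for more, because the transformed realizer
  has to be produced outright and not only up to \<open>J\<close>. The obstacle is disjunction, which a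
  realizer has to settle. But a realizer of \<open>\<phi>\<close> shows how it has settled the disjunctions of
  \<open>\<phi>\<close> that are not below an implication or a universal quantifier, and \<open>\<phi>\<close> with these choices made is
  again a formula, a resolution of \<open>\<phi>\<close>. A true resolution can be realized outright from
  realizers of the parameters, and by elementarity it is true in one structure if it is true in
  the other. So a realizer is transformed by reading off its resolution and its parameters, moving
  the parameters, and realizing the same resolution on the other side
  (\<open>realizer_transformation\<close>).

  The programs are written in a lambda calculus on indices. It rests on a universal program
  (\<open>universal_program\<close>) and on closures, which store an environment in an index.
\<close>


text \<open>Coded lists are handled through operations on lists and not as iterated pairs.\<close>

declare list_encode.simps(2) [simp del]

section \<open>Total recursive functions\<close>

text \<open>Recursive functions are presented as functions of the whole argument list \<open>xs\<close>. The rules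
  collected in \<open>rec\<close> then follow the syntax of a term in \<open>xs ! 0\<close>, \<open>xs ! 1\<close>, \<open>\<dots>\<close>, so that
  recursiveness of an explicit function is proved by \<open>intro rec\<close>.\<close>

definition recfun :: "nat \<Rightarrow> (nat list \<Rightarrow> nat) \<Rightarrow> bool" where
  "recfun n h \<longleftrightarrow> (\<exists>f. \<forall>xs. length xs = n \<longrightarrow> computes Map.empty f xs (h xs))"

abbreviation recpred :: "nat \<Rightarrow> (nat list \<Rightarrow> bool) \<Rightarrow> bool" where
  "recpred n P \<equiv> recfun n (\<lambda>xs. of_bool (P xs))"

named_theorems rec

lemma recfun_cong: "recfun n h \<Longrightarrow> (\<And>xs. length xs = n \<Longrightarrow> h xs = h' xs) \<Longrightarrow> recfun n h'"
  unfolding recfun_def by metis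

lemma recfun_comp:
  assumes "recfun (length gs) h" "\<And>g. g \<in> set gs \<Longrightarrow> recfun n g"
  shows "recfun n (\<lambda>xs. h (map (\<lambda>g. g xs) gs))"
proof -
  obtain f where f: "\<And>xs. length xs = length gs \<Longrightarrow> computes Map.empty f xs (h xs)"
    using assms(1) unfolding recfun_def by blast
  obtain p where p: "\<And>g xs. g \<in> set gs \<Longrightarrow> length xs = n \<Longrightarrow> computes Map.empty (p g) xs (g xs)"
    using assms(2) unfolding recfun_def by metis
  have "computes Map.empty (RComp f (map p gs)) xs (h (map (\<lambda>g. g xs) gs))" if "length xs = n" for xs
    using f p that by (intro computes.comp[where ys = "map (\<lambda>g. g xs) gs"]) auto
  then show ?thesis unfolding recfun_def by blast
qed

lemma recfun_nth [rec]: "i < n \<Longrightarrow> recfun n (\<lambda>xs. xs ! i)"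
  unfolding recfun_def by (metis computes.proj)

text \<open>Recursion, search and bounded quantifiers put a variable in front of \<open>xs\<close>; in their bodies the
  old variables are those of the tail.\<close>

lemma recfun_tl [rec]: "Suc i < n \<Longrightarrow> recfun n (\<lambda>xs. tl xs ! i)"
  by (rule recfun_cong[OF recfun_nth[of "Suc i"]]) (auto simp: nth_tl)

lemma recfun_tl_tl [rec]: "Suc (Suc i) < n \<Longrightarrow> recfun n (\<lambda>xs. tl (tl xs) ! i)"
  by (rule recfun_cong[OF recfun_nth[of "Suc (Suc i)"]]) (auto simp: nth_tl)

lemma recfun_tl_tl_tl [rec]: "Suc (Suc (Suc i)) < n \<Longrightarrow> recfun n (\<lambda>xs. tl (tl (tl xs)) ! i)"
  by (rule recfun_cong[OF recfun_nth[of "Suc (Suc (Suc i))"]]) (auto simp: nth_tl)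

lemma recfun_comp1: "recfun 1 (\<lambda>xs. f (xs ! 0)) \<Longrightarrow> recfun n g \<Longrightarrow> recfun n (\<lambda>xs. f (g xs))"
  using recfun_comp[of "[g]" "\<lambda>xs. f (xs ! 0)" n] by simp

lemma recfun_comp2: "recfun 2 (\<lambda>xs. f (xs ! 0) (xs ! 1)) \<Longrightarrow> recfun n g \<Longrightarrow> recfun n h \<Longrightarrow>
    recfun n (\<lambda>xs. f (g xs) (h xs))"
  using recfun_comp[of "[g, h]" "\<lambda>xs. f (xs ! 0) (xs ! 1)" n] by (fastforce simp: numeral_2_eq_2)

lemma recfun_comp4: "recfun 4 (\<lambda>xs. f (xs ! 0) (xs ! 1) (xs ! 2) (xs ! 3)) \<Longrightarrow>
    recfun n g \<Longrightarrow> recfun n h \<Longrightarrow> recfun n k \<Longrightarrow> recfun n l \<Longrightarrow>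
    recfun n (\<lambda>xs. f (g xs) (h xs) (k xs) (l xs))"
  using recfun_comp[of "[g, h, k, l]" "\<lambda>xs. f (xs ! 0) (xs ! 1) (xs ! 2) (xs ! 3)" n]
  by (fastforce simp: eval_nat_numeral)

lemma recfun_Suc [rec]: "recfun n g \<Longrightarrow> recfun n (\<lambda>xs. Suc (g xs))"
proof (rule recfun_comp1[of Suc])
  have "computes Map.empty RSucc xs (Suc (xs ! 0))" if "length xs = 1" for xs
    using computes.succ that by (cases xs) auto
  then show "recfun 1 (\<lambda>xs. Suc (xs ! 0))" unfolding recfun_def by blast
qed

lemma recfun_const [rec]: "recfun n (\<lambda>_. c)"
proof (induction c)
  case 0
  show ?case unfolding recfun_def by (metis computes.zero)
qed (rule recfun_Suc)

lemma recfun_rec [rec]: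
  assumes "recfun n b" "recfun (Suc (Suc n)) (\<lambda>ys. s (ys ! 0) (ys ! 1) (tl (tl ys)))" "recfun n k"
  shows "recfun n (\<lambda>xs. rec_nat (b xs) (\<lambda>m r. s m r xs) (k xs))"
proof -
  obtain fb where fb: "\<And>xs. length xs = n \<Longrightarrow> computes Map.empty fb xs (b xs)"
    using assms(1) unfolding recfun_def by blast
  obtain fs where fs: "\<And>ys. length ys = Suc (Suc n) \<Longrightarrow>
      computes Map.empty fs ys (s (ys ! 0) (ys ! 1) (tl (tl ys)))"
    using assms(2) unfolding recfun_def by blast
  have *: "computes Map.empty (RPrec fb fs) (j # xs) (rec_nat (b xs) (\<lambda>m r. s m r xs) j)"
    if "length xs = n" for xs j
  proof (induction j)
    case (Suc j)
    have "computes Map.empty fs (j # rec_nat (b xs) (\<lambda>m r. s m r xs) j # xs)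
        (s j (rec_nat (b xs) (\<lambda>m r. s m r xs) j) xs)"
      using fs[of "j # rec_nat (b xs) (\<lambda>m r. s m r xs) j # xs"] that by simp
    then show ?case using Suc by (auto intro: computes.prec_Suc)
  qed (use fb that in \<open>auto intro: computes.prec_0\<close>)
  have "recfun (Suc n) (\<lambda>ys. rec_nat (b (tl ys)) (\<lambda>m r. s m r (tl ys)) (ys ! 0))"
    unfolding recfun_def
  proof (intro exI allI impI)
    fix ys :: "nat list" assume "length ys = Suc n"
    then show "computes Map.empty (RPrec fb fs) ys (rec_nat (b (tl ys)) (\<lambda>m r. s m r (tl ys)) (ys ! 0))"
      using * by (cases ys) auto
  qed
  then have "recfun n (\<lambda>xs. (\<lambda>ys. rec_nat (b (tl ys)) (\<lambda>m r. s m r (tl ys)) (ys ! 0))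
      (map (\<lambda>g. g xs) (k # map (\<lambda>i xs. xs ! i) [0..<n])))"
    by (intro recfun_comp) (auto intro: assms recfun_nth)
  then show ?thesis
    by (rule recfun_cong) (auto simp: comp_def map_nth)
qed

lemma recfun_add [rec]:
  assumes "recfun n g" "recfun n h" shows "recfun n (\<lambda>xs. g xs + h xs)"
proof (rule recfun_comp2[of "(+)", OF _ assms])
  have *: "rec_nat a (\<lambda>_. Suc) c = a + c" for a c by (induction c) auto
  have "recfun 2 (\<lambda>xs. rec_nat (xs ! 0) (\<lambda>_ r. Suc r) (xs ! 1))"
    by (intro rec) auto
  then show "recfun 2 (\<lambda>xs. xs ! 0 + xs ! 1)" unfolding * .
qed

lemma recfun_mult [rec]:
  assumes "recfun n g" "recfun n h" shows "recfun n (\<lambda>xs. g xs * h xs)"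
proof (rule recfun_comp2[of "(*)", OF _ assms])
  have *: "rec_nat 0 (\<lambda>_ r. a + r) c = a * c" for a c :: nat by (induction c) auto
  have "recfun 2 (\<lambda>xs. rec_nat 0 (\<lambda>_ r. xs ! 0 + r) (xs ! 1))"
    by (intro rec) auto
  then show "recfun 2 (\<lambda>xs. xs ! 0 * xs ! 1)" unfolding * .
qed

lemma recfun_pred: "recfun n g \<Longrightarrow> recfun n (\<lambda>xs. g xs - 1)"
proof (rule recfun_comp1[of "\<lambda>x. x - 1"])
  have *: "rec_nat 0 (\<lambda>m _. m) c = c - 1" for c :: nat by (cases c) auto
  have "recfun 1 (\<lambda>xs. rec_nat 0 (\<lambda>m _. m) (xs ! 0))"
    by (intro rec) auto
  then show "recfun 1 (\<lambda>xs. xs ! 0 - 1)" unfolding * .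
qed

lemma recfun_diff [rec]:
  assumes "recfun n g" "recfun n h" shows "recfun n (\<lambda>xs. g xs - h xs)"
proof (rule recfun_comp2[of "(-)", OF _ assms])
  have *: "rec_nat a (\<lambda>_ r. r - 1) c = a - c" for a c :: nat by (induction c) auto
  have "recfun 2 (\<lambda>xs. rec_nat (xs ! 0) (\<lambda>_ r. r - 1) (xs ! 1))"
    by (intro rec recfun_pred) auto
  then show "recfun 2 (\<lambda>xs. xs ! 0 - xs ! 1)" unfolding * .
qed

lemma recpred_le [rec]:
  assumes "recfun n g" "recfun n h" shows "recpred n (\<lambda>xs. g xs \<le> h xs)"
  by (rule recfun_cong[of _ "\<lambda>xs. 1 - (g xs - h xs)"]) (intro rec assms, simp)

lemma recpred_conj [rec]:
  assumes "recpred n P" "recpred n Q" shows "recpred n (\<lambda>xs. P xs \<and> Q xs)"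
  by (rule recfun_cong[of _ "\<lambda>xs. of_bool (P xs) * of_bool (Q xs)"]) (intro rec assms, simp)

lemma recpred_not [rec]:
  assumes "recpred n P" shows "recpred n (\<lambda>xs. \<not> P xs)"
  by (rule recfun_cong[of _ "\<lambda>xs. 1 - of_bool (P xs)"]) (intro rec assms, simp)

lemma recpred_disj [rec]:
  assumes "recpred n P" "recpred n Q" shows "recpred n (\<lambda>xs. P xs \<or> Q xs)"
  by (rule recfun_cong[of _ "\<lambda>xs. of_bool (\<not> (\<not> P xs \<and> \<not> Q xs))"]) (intro rec assms, simp)

lemma recpred_imp [rec]:
  assumes "recpred n P" "recpred n Q" shows "recpred n (\<lambda>xs. P xs \<longrightarrow> Q xs)"
  by (rule recfun_cong[of _ "\<lambda>xs. of_bool (\<not> P xs \<or> Q xs)"]) (intro rec assms, simp)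

lemma recpred_less [rec]:
  assumes "recfun n g" "recfun n h" shows "recpred n (\<lambda>xs. g xs < h xs)"
  by (rule recfun_cong[of _ "\<lambda>xs. of_bool (Suc (g xs) \<le> h xs)"]) (intro rec assms, simp)

lemma recpred_eq [rec]:
  assumes "recfun n g" "recfun n h" shows "recpred n (\<lambda>xs. g xs = h xs)"
  by (rule recfun_cong[of _ "\<lambda>xs. of_bool (g xs \<le> h xs \<and> h xs \<le> g xs)"])
     (intro rec assms, auto)

lemma recfun_if [rec]:
  assumes "recpred n P" "recfun n g" "recfun n h"
  shows "recfun n (\<lambda>xs. if P xs then g xs else h xs)"
  by (rule recfun_cong[of _ "\<lambda>xs. of_bool (P xs) * g xs + (1 - of_bool (P xs)) * h xs"])
     (intro rec assms, simp)

lemma recpred_ball [rec]: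
  assumes "recpred (Suc n) (\<lambda>ys. P (ys ! 0) (tl ys))" "recfun n k"
  shows "recpred n (\<lambda>xs. \<forall>i < k xs. P i xs)"
proof -
  obtain p where p: "\<And>ys. length ys = Suc n \<Longrightarrow> computes Map.empty p ys (of_bool (P (ys ! 0) (tl ys)))"
    using assms(1) unfolding recfun_def by blast
  have "recfun (Suc (Suc n)) (\<lambda>zs. of_bool (P (zs ! 0) (tl (tl zs))))"
    unfolding recfun_def
  proof (intro exI allI impI)
    fix zs :: "nat list" assume zs: "length zs = Suc (Suc n)"
    then obtain a b xs where [simp]: "zs = a # b # xs" by (cases zs; cases "tl zs") auto
    have "computes Map.empty (RProj i) zs ((a # xs) ! i')"
      if "i = (case i' of 0 \<Rightarrow> 0 | Suc j \<Rightarrow> Suc (Suc j))" "i' < Suc n" for i i'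
      using that zs computes.proj[of i zs] by (cases i') auto
    then show "computes Map.empty (RComp p (map (\<lambda>i. RProj (case i of 0 \<Rightarrow> 0 | Suc j \<Rightarrow> Suc (Suc j))) [0..<Suc n]))
        zs (of_bool (P (zs ! 0) (tl (tl zs))))"
      using zs p[of "a # xs"] by (intro computes.comp[where ys = "a # xs"]) (auto simp del: upt_Suc)
  qed
  then have "recfun n (\<lambda>xs. rec_nat 1 (\<lambda>m r. of_bool (P m xs) * r) (k xs))"
    using assms(2) by (intro rec) auto
  moreover have "rec_nat 1 (\<lambda>m r. of_bool (P m xs) * r) j = (of_bool (\<forall>i<j. P i xs) :: nat)" for xs j
    by (induction j) (auto simp: less_Suc_eq)
  ultimately show ?thesis by simp
qed

lemma recpred_bex [rec]:
  assumes "recpred (Suc n) (\<lambda>ys. P (ys ! 0) (tl ys))" "recfun n k"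
  shows "recpred n (\<lambda>xs. \<exists>i < k xs. P i xs)"
  by (rule recfun_cong[of _ "\<lambda>xs. of_bool (\<not> (\<forall>i < k xs. \<not> P i xs))"])
     (intro recpred_not recpred_ball assms, simp)

lemma recfun_Least [rec]:
  assumes "recpred (Suc n) (\<lambda>ys. P (ys ! 0) (tl ys))" "\<And>xs. length xs = n \<Longrightarrow> \<exists>i. P i xs"
  shows "recfun n (\<lambda>xs. LEAST i. P i xs)"
proof -
  obtain p where p: "\<And>ys. length ys = Suc n \<Longrightarrow> computes Map.empty p ys (of_bool (\<not> P (ys ! 0) (tl ys)))"
    using recpred_not[OF assms(1)] unfolding recfun_def by blast
  have "computes Map.empty (RMu p) xs (LEAST i. P i xs)" if l: "length xs = n" for xs
  proof (rule computes.mu)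
    have "P (LEAST i. P i xs) xs" using assms(2)[OF l] by (metis LeastI)
    then show "computes Map.empty p ((LEAST i. P i xs) # xs) 0"
      using p[of "(LEAST i. P i xs) # xs"] l by simp
    fix m assume "m < (LEAST i. P i xs)"
    then have "\<not> P m xs" by (rule not_less_Least)
    then show "\<exists>y. computes Map.empty p (m # xs) (Suc y)"
      using p[of "m # xs"] l by auto
  qed
  then show ?thesis unfolding recfun_def by blast
qed


section \<open>Coded lists\<close>

lemma recfun_prod_encode [rec]:
  assumes "recfun n g" "recfun n h" shows "recfun n (\<lambda>xs. prod_encode (g xs, h xs))"
proof -
  have *: "rec_nat 0 (\<lambda>m r. r + Suc m) c = triangle c" for c by (induction c) auto
  have "recfun n (\<lambda>xs. rec_nat 0 (\<lambda>m r. r + Suc m) (g xs + h xs) + g xs)"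
    using assms by (intro rec) auto
  then show ?thesis unfolding * prod_encode_def by simp
qed

text \<open>The components of a coded pair are bounded by its code, so each of them is found by searching
  for one component and bounding the other.\<close>

lemma recfun_fst_prod_decode:
  assumes "recfun n g" shows "recfun n (\<lambda>xs. fst (prod_decode (g xs)))"
proof (rule recfun_comp1[of "\<lambda>x. fst (prod_decode x)", OF _ assms])
  have "recfun 1 (\<lambda>xs. LEAST a. \<exists>b < Suc (xs ! 0). prod_encode (a, b) = xs ! 0)"
  proof (intro rec)
    fix xs :: "nat list"
    show "\<exists>i. \<exists>b<Suc (xs ! 0). prod_encode (i, b) = xs ! 0"
      by (metis le_imp_less_Suc le_prod_encode_2 prod_decode_inverse surj_pair)
  qed auto
  moreover have "(LEAST a. \<exists>b < Suc c. prod_encode (a, b) = c) = fst (prod_decode c)" for c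
  proof (rule Least_equality)
    show "\<exists>b < Suc c. prod_encode (fst (prod_decode c), b) = c"
      by (metis le_imp_less_Suc le_prod_encode_2 prod_decode_inverse prod.collapse)
  qed auto
  ultimately show "recfun 1 (\<lambda>xs. fst (prod_decode (xs ! 0)))" by simp
qed

lemma recfun_snd_prod_decode:
  assumes "recfun n g" shows "recfun n (\<lambda>xs. snd (prod_decode (g xs)))"
proof (rule recfun_comp1[of "\<lambda>x. snd (prod_decode x)", OF _ assms])
  have "recfun 1 (\<lambda>xs. LEAST b. \<exists>a < Suc (xs ! 0). prod_encode (a, b) = xs ! 0)"
  proof (intro rec)
    fix xs :: "nat list"
    show "\<exists>i. \<exists>b<Suc (xs ! 0). prod_encode (b, i) = xs ! 0"
      by (metis le_imp_less_Suc le_prod_encode_1 prod_decode_inverse surj_pair)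
  qed auto
  moreover have "(LEAST b. \<exists>a < Suc c. prod_encode (a, b) = c) = snd (prod_decode c)" for c
  proof (rule Least_equality)
    show "\<exists>a < Suc c. prod_encode (a, snd (prod_decode c)) = c"
      by (metis le_imp_less_Suc le_prod_encode_1 prod_decode_inverse prod.collapse)
  qed auto
  ultimately show "recfun 1 (\<lambda>xs. snd (prod_decode (xs ! 0)))" by simp
qed

definition ccons :: "nat \<Rightarrow> nat \<Rightarrow> nat" where
  "ccons a c = list_encode (a # list_decode c)"

definition cdrop :: "nat \<Rightarrow> nat \<Rightarrow> nat" where
  "cdrop i c = list_encode (drop i (list_decode c))"

definition clen :: "nat \<Rightarrow> nat" where
  "clen c = length (list_decode c)"

lemma recfun_ccons [rec]: "recfun n g \<Longrightarrow> recfun n h \<Longrightarrow> recfun n (\<lambda>xs. ccons (g xs) (h xs))"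
  unfolding ccons_def by (auto simp: list_encode.simps(2) intro!: rec)

lemma recfun_cdrop [rec]:
  assumes "recfun n g" "recfun n h" shows "recfun n (\<lambda>xs. cdrop (g xs) (h xs))"
proof -
  have tl: "list_encode (tl (list_decode c)) = snd (prod_decode (c - 1))" for c
  proof (cases c)
    case 0
    then show ?thesis by (simp add: prod_decode_def prod_decode_aux.simps)
  next
    case (Suc n)
    then show ?thesis by (cases "prod_decode n") simp
  qed
  have "rec_nat c (\<lambda>_ r. snd (prod_decode (r - 1))) i = cdrop i c" for i c
  proof (induction i)
    case (Suc i)
    then show ?case
      using tl[of "list_encode (drop i (list_decode c))"] by (simp add: cdrop_def drop_Suc tl_drop)
  qed (simp add: cdrop_def)
  moreover have "recfun n (\<lambda>xs. rec_nat (h xs) (\<lambda>_ r. snd (prod_decode (r - 1))) (g xs))"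
    using assms by (intro rec recfun_snd_prod_decode) auto
  ultimately show ?thesis by simp
qed

lemma recfun_proj [rec]:
  assumes "recfun n g" "recfun n h" shows "recfun n (\<lambda>xs. proj (g xs) (h xs))"
proof -
  have "(if cdrop i c = 0 then 0 else fst (prod_decode (cdrop i c - 1))) = proj c i" for c i
  proof (cases "i < length (list_decode c)")
    case True
    then show ?thesis by (simp add: cdrop_def proj_def list_encode.simps(2) flip: Cons_nth_drop_Suc)
  qed (simp add: cdrop_def proj_def)
  moreover have "recfun n (\<lambda>xs. if cdrop (h xs) (g xs) = 0 then 0
      else fst (prod_decode (cdrop (h xs) (g xs) - 1)))"
    using assms by (intro rec recfun_fst_prod_decode) auto
  ultimately show ?thesis by simp
qed

lemma recfun_clen [rec]:
  assumes "recfun n g" shows "recfun n (\<lambda>xs. clen (g xs))"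
proof (rule recfun_comp1[of clen, OF _ assms])
  have *: "cdrop i c = 0 \<longleftrightarrow> clen c \<le> i" for i c
    unfolding cdrop_def clen_def by (metis drop_eq_Nil list_encode.simps(1) list_encode_inverse list_decode.simps(1))
  have "recfun 1 (\<lambda>xs. LEAST i. cdrop i (xs ! 0) = 0)"
    by (intro rec) (auto simp: *)
  moreover have "(LEAST i. clen c \<le> i) = clen c" for c
    by (rule Least_equality) auto
  ultimately show "recfun 1 (\<lambda>xs. clen (xs ! 0))" by (simp add: *)
qed

lemma recfun_list_encode: "(\<And>g. g \<in> set gs \<Longrightarrow> recfun n g) \<Longrightarrow>
    recfun n (\<lambda>xs. list_encode (map (\<lambda>g. g xs) gs))"
  by (induction gs) (auto simp: list_encode.simps(2) intro!: rec)

lemma recfun_encode_env: "recfun n list_encode"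
proof (rule recfun_cong)
  show "recfun n (\<lambda>xs. list_encode (map (\<lambda>g. g xs) (map (\<lambda>i xs. xs ! i) [0..<n])))"
    by (rule recfun_list_encode) (auto intro: recfun_nth)
  have "map (\<lambda>g. g xs) (map (\<lambda>i xs. xs ! i) [0..<n]) = xs" if "length xs = n" for xs :: "nat list"
    using that by (intro nth_equalityI) auto
  then show "list_encode (map (\<lambda>g. g xs) (map (\<lambda>i xs. xs ! i) [0..<n])) = list_encode xs"
    if "length xs = n" for xs :: "nat list" using that by simp
qed

lemma recfun_list_encode1 [rec]: "recfun n g \<Longrightarrow> recfun n (\<lambda>xs. list_encode [g xs])"
  using recfun_list_encode[of "[g]" n] by simp

lemma recfun_list_encode2 [rec]: "recfun n g \<Longrightarrow> recfun n h \<Longrightarrow> recfun n (\<lambda>xs. list_encode [g xs, h xs])"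
  using recfun_list_encode[of "[g, h]" n] by fastforce

lemma recfun_list_encode3 [rec]: "recfun n g \<Longrightarrow> recfun n h \<Longrightarrow> recfun n k \<Longrightarrow>
    recfun n (\<lambda>xs. list_encode [g xs, h xs, k xs])"
  using recfun_list_encode[of "[g, h, k]" n] by fastforce

lemma list_encode_Cons_neq_0 [simp]: "list_encode (x # xs) \<noteq> 0"
  by (simp add: list_encode.simps(2))

lemma proj_list_encode [simp]: "proj (list_encode xs) i = (if i < length xs then xs ! i else 0)"
  by (simp add: proj_def)

lemma ccons_list_encode [simp]: "ccons a (list_encode xs) = list_encode (a # xs)"
  by (simp add: ccons_def del: list_encode.simps)

lemma cdrop_list_encode [simp]: "cdrop i (list_encode xs) = list_encode (drop i xs)"
  by (simp add: cdrop_def)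

lemma clen_list_encode [simp]: "clen (list_encode xs) = length xs"
  by (simp add: clen_def)


section \<open>A universal program\<close>

text \<open>
  A computation is certified by a list of judgements, each of which follows from later ones by a
  rule of \<open>computes\<close>. To be a certificate is a recursive property of the coded list, as only
  quantifiers bounded by its length and by its entries occur. A universal program searches for a
  certificate.
\<close>

abbreviation jdg :: "nat \<Rightarrow> nat \<Rightarrow> nat \<Rightarrow> nat" where
  "jdg F X y \<equiv> list_encode [F, X, y]"

text \<open>One disjunct for each rule of \<open>computes\<close>, with the premises of the rule taken from \<open>S\<close>. Codes
  are inspected by projections only, so the condition makes sense for arbitrary numbers.\<close>

definition justified :: "nat set \<Rightarrow> nat \<Rightarrow> nat \<Rightarrow> nat \<Rightarrow> bool" where
  "justified S F X y \<longleftrightarrow>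
    F = list_encode [0] \<and> y = 0 \<or>
    F = list_encode [1] \<and> X \<noteq> 0 \<and> y = Suc (proj X 0) \<or>
    proj F 0 = 2 \<and> proj F 1 < clen X \<and> y = proj X (proj F 1) \<or>
    proj F 0 = 4 \<and> (\<exists>z\<in>S. proj z 0 = proj F 1 \<and> proj z 2 = y \<and> clen (proj z 1) + 2 = clen F \<and>
      (\<forall>i < clen (proj z 1). jdg (proj F (i + 2)) X (proj (proj z 1) i) \<in> S)) \<or>
    proj F 0 = 5 \<and> X \<noteq> 0 \<and> proj X 0 = 0 \<and> jdg (proj F 1) (cdrop 1 X) y \<in> S \<or>
    proj F 0 = 5 \<and> X \<noteq> 0 \<and> proj X 0 \<noteq> 0 \<and> (\<exists>z\<in>S. proj z 0 = F \<and>
      proj z 1 = ccons (proj X 0 - 1) (cdrop 1 X) \<and>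
      jdg (proj F 2) (ccons (proj X 0 - 1) (ccons (proj z 2) (cdrop 1 X))) y \<in> S) \<or>
    proj F 0 = 6 \<and> jdg (proj F 1) (ccons y X) 0 \<in> S \<and>
      (\<forall>m < y. \<exists>z\<in>S. proj z 0 = proj F 1 \<and> proj z 1 = ccons m X \<and> proj z 2 \<noteq> 0)"

lemma justified_mono: "justified S F X y \<Longrightarrow> S \<subseteq> S' \<Longrightarrow> justified S' F X y"
  unfolding justified_def by (elim disj_forward; blast)

lemma justified_RZero [simp]: "justified S (recf_code RZero) (list_encode xs) y \<longleftrightarrow> y = 0"
  by (simp add: justified_def list_encode_eq)

lemma justified_RSucc [simp]: "justified S (recf_code RSucc) (list_encode xs) y \<longleftrightarrow>
    xs \<noteq> [] \<and> y = Suc (hd xs)"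
  by (cases xs) (simp_all add: justified_def list_encode_eq)

lemma justified_RProj [simp]: "justified S (recf_code (RProj i)) (list_encode xs) y \<longleftrightarrow>
    i < length xs \<and> y = xs ! i"
  by (auto simp: justified_def list_encode_eq)

lemma justified_ROracle [simp]: "\<not> justified S (recf_code ROracle) (list_encode xs) y"
  by (simp add: justified_def list_encode_eq)

lemma justified_RComp [simp]: "justified S (recf_code (RComp f gs)) (list_encode xs) y \<longleftrightarrow>
    (\<exists>z\<in>S. proj z 0 = recf_code f \<and> proj z 2 = y \<and> clen (proj z 1) = length gs \<and>
      (\<forall>i < length gs. jdg (recf_code (gs ! i)) (list_encode xs) (proj (proj z 1) i) \<in> S))"
  by (simp add: justified_def list_encode_eq cong: conj_cong)

lemma justified_RPrec [simp]:
  "\<not> justified S (recf_code (RPrec f g)) (list_encode []) y"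
  "justified S (recf_code (RPrec f g)) (list_encode (0 # xs)) y \<longleftrightarrow>
    jdg (recf_code f) (list_encode xs) y \<in> S"
  "justified S (recf_code (RPrec f g)) (list_encode (Suc n # xs)) y \<longleftrightarrow>
    (\<exists>z\<in>S. proj z 0 = recf_code (RPrec f g) \<and> proj z 1 = list_encode (n # xs) \<and>
      jdg (recf_code g) (list_encode (n # proj z 2 # xs)) y \<in> S)"
  by (simp_all add: justified_def list_encode_eq)

lemma justified_RMu [simp]: "justified S (recf_code (RMu f)) (list_encode xs) y \<longleftrightarrow>
    jdg (recf_code f) (list_encode (y # xs)) 0 \<in> S \<and>
    (\<forall>m < y. \<exists>z\<in>S. proj z 0 = recf_code f \<and> proj z 1 = list_encode (m # xs) \<and> proj z 2 \<noteq> 0)"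
  by (simp add: justified_def list_encode_eq)

lemma bex_set_list_decode: "(\<exists>z \<in> set (list_decode L). P z) \<longleftrightarrow> (\<exists>j < clen L. P (proj L j))"
  by (auto simp: clen_def proj_def Bex_def in_set_conv_nth)

lemma mem_set_list_decode: "a \<in> set (list_decode L) \<longleftrightarrow> (\<exists>j < clen L. proj L j = a)"
  using bex_set_list_decode[of L "\<lambda>z. z = a"] by auto

lemma recpred_justified [rec]:
  assumes "recfun n g" "recfun n h" "recfun n k" "recfun n l"
  shows "recpred n (\<lambda>xs. justified (set (list_decode (g xs))) (h xs) (k xs) (l xs))"
proof (rule recfun_comp4[of "\<lambda>a b c d. of_bool (justified (set (list_decode a)) b c d)", OF _ assms])
  show "recpred 4 (\<lambda>xs. justified (set (list_decode (xs ! 0))) (xs ! 1) (xs ! 2) (xs ! 3))"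
    unfolding justified_def bex_set_list_decode mem_set_list_decode by (intro rec) simp_all
qed

primrec certificate :: "nat list \<Rightarrow> bool" where
  "certificate [] \<longleftrightarrow> True"
| "certificate (z # L) \<longleftrightarrow> justified (set L) (proj z 0) (proj z 1) (proj z 2) \<and> certificate L"

lemma certificate_iff: "certificate L \<longleftrightarrow> (\<forall>i < length L.
    justified (set (drop (Suc i) L)) (proj (L ! i) 0) (proj (L ! i) 1) (proj (L ! i) 2))"
proof (induction L)
  case (Cons z L)
  then show ?case using All_less_Suc2[of "length L"] by simp
qed simp

lemma recpred_certificate [rec]:
  assumes "recfun n g" shows "recpred n (\<lambda>xs. certificate (list_decode (g xs)))"
proof (rule recfun_comp1[of "\<lambda>x. of_bool (certificate (list_decode x))", OF _ assms])
  have *: "certificate (list_decode c) \<longleftrightarrow> (\<forall>i < clen c. justified (set (list_decode (cdrop (Suc i) c)))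
      (proj (proj c i) 0) (proj (proj c i) 1) (proj (proj c i) 2))" for c
    by (auto simp: certificate_iff clen_def cdrop_def proj_def[of c])
  show "recpred 1 (\<lambda>xs. certificate (list_decode (xs ! 0)))"
    unfolding * by (intro rec) simp_all
qed

lemma certificate_append: "certificate L1 \<Longrightarrow> certificate L2 \<Longrightarrow> certificate (L1 @ L2)"
  by (induction L1) (auto intro: justified_mono)

definition certified :: "recf \<Rightarrow> nat list \<Rightarrow> nat \<Rightarrow> nat list \<Rightarrow> bool" where
  "certified f xs y L \<longleftrightarrow> certificate L \<and> jdg (recf_code f) (list_encode xs) y \<in> set L"

text \<open>Justification is monotone in the set of available judgements, so certificates can be joined.\<close>

lemma certified_append:
  "certified f xs y L \<Longrightarrow> certificate L' \<Longrightarrow> certified f xs y (L @ L')"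
  "certified f xs y L \<Longrightarrow> certificate L' \<Longrightarrow> certified f xs y (L' @ L)"
  unfolding certified_def by (auto intro: certificate_append)

lemma certified_concat:
  fixes n :: nat
  assumes "\<And>i. i < n \<Longrightarrow> \<exists>L. certified (f i) (xs i) (y i) L"
  shows "\<exists>L. certificate L \<and> (\<forall>i<n. certified (f i) (xs i) (y i) L)"
  using assms
proof (induction n)
  case 0
  then show ?case by (auto intro: exI[of _ "[]"])
next
  case (Suc n)
  then obtain L L' where "certificate L" "\<forall>i<n. certified (f i) (xs i) (y i) L"
      "certified (f n) (xs n) (y n) L'" by (meson lessI less_SucI)
  then show ?case
    by (intro exI[of _ "L @ L'"])
       (auto simp: less_Suc_eq certified_append certified_def certificate_append)
qed

lemma certified_step:
  assumes "certificate L" "justified (set L) (recf_code f) (list_encode xs) y"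
  shows "\<exists>L. certified f xs y L"
  using assms unfolding certified_def
  by (intro exI[of _ "jdg (recf_code f) (list_encode xs) y # L"]) (simp del: recf_code.simps)

lemma computes_certified: "computes Map.empty f xs y \<Longrightarrow> \<exists>L. certified f xs y L"
proof (induction rule: computes.induct)
  case (comp ys gs xs f z)
  obtain L where L: "certificate L" "\<And>i. i < length gs \<Longrightarrow> certified (gs ! i) xs (ys ! i) L"
    using certified_concat[of "length gs" "\<lambda>i. gs ! i" "\<lambda>_. xs" "\<lambda>i. ys ! i", OF comp.IH(1)] by blast
  obtain L' where L': "certified f ys z L'" using comp.IH(2) by blast
  have "certificate (L @ L')" using L L' by (auto simp: certified_def certificate_append)
  then show ?case
    using L L' comp.hyps(1)
    by (rule_tac certified_step[of "L @ L'"])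
       (auto simp: certified_def simp del: recf_code.simps intro!: bexI[of _ "jdg (recf_code f) (list_encode ys) z"])
next
  case (prec_0 f xs z g)
  then obtain L where "certified f xs z L" by blast
  then show ?case by (rule_tac certified_step[of L]) (auto simp: certified_def simp del: recf_code.simps)
next
  case (prec_Suc f g n xs y z)
  then obtain L L' where L: "certified (RPrec f g) (n # xs) y L" "certified g (n # y # xs) z L'" by blast
  then have "certificate (L @ L')" by (auto simp: certified_def certificate_append)
  then show ?case
    using L by (rule_tac certified_step[of "L @ L'"])
       (auto simp: certified_def simp del: recf_code.simps
         intro!: bexI[of _ "jdg (recf_code (RPrec f g)) (list_encode (n # xs)) y"])
next
  case (mu f n xs)
  obtain L where L: "certified f (n # xs) 0 L" using mu.IH(1) by blast
  obtain v where v: "\<And>m. m < n \<Longrightarrow> \<exists>L. certified f (m # xs) (Suc (v m)) L"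
    using mu.IH(2) by metis
  obtain L' where L': "certificate L'" "\<And>m. m < n \<Longrightarrow> certified f (m # xs) (Suc (v m)) L'"
    using certified_concat[of n "\<lambda>_. f" "\<lambda>m. m # xs" "\<lambda>m. Suc (v m)", OF v] by blast
  have 1: "certificate (L @ L')" using L L' by (auto simp: certified_def certificate_append)
  have 2: "\<exists>z\<in>set (L @ L'). proj z 0 = recf_code f \<and> proj z 1 = list_encode (m # xs) \<and> proj z 2 \<noteq> 0"
    if "m < n" for m
    using L'(2)[OF that]
    by (intro bexI[of _ "jdg (recf_code f) (list_encode (m # xs)) (Suc (v m))"]) (auto simp: certified_def)
  show ?case
    using 2 L by (intro certified_step[OF 1]) (auto simp: certified_def simp del: recf_code.simps)
qed (rule certified_step[of "[]"]; simp del: recf_code.simps)+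

text \<open>A certificate may contain entries whose first component codes no program. They do no harm: the
  premises of a rule for an actual program are again about actual programs.\<close>

lemma justified_sound:
  assumes j: "justified S (recf_code f) (list_encode xs) y"
    and IH: "\<And>z g ys. z \<in> S \<Longrightarrow> proj z 0 = recf_code g \<Longrightarrow> proj z 1 = list_encode ys \<Longrightarrow>
      computes Map.empty g ys (proj z 2)"
  shows "computes Map.empty f xs y"
proof -
  have jdg: "computes Map.empty g ys v" if "jdg (recf_code g) (list_encode ys) v \<in> S" for g ys v
    using IH[OF that] by simp
  note recf_code.simps [simp del]
  show ?thesis
  proof (cases f)
    case (RComp g gs)
    then obtain z where z: "z \<in> S" "proj z 0 = recf_code g" "proj z 2 = y" "clen (proj z 1) = length gs"
        "\<And>i. i < length gs \<Longrightarrow> jdg (recf_code (gs ! i)) (list_encode xs) (proj (proj z 1) i) \<in> S"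
      using j by auto
    let ?ys = "list_decode (proj z 1)"
    have "computes Map.empty g ?ys y" using z IH[of z g ?ys] by simp
    moreover have "computes Map.empty (gs ! i) xs (?ys ! i)" if "i < length gs" for i
      using jdg[OF z(5)[OF that]] that z(4) by (simp add: proj_def clen_def)
    ultimately show ?thesis
      unfolding RComp using z(4) by (intro computes.comp[of ?ys]) (auto simp: clen_def)
  next
    case (RPrec g h)
    show ?thesis
    proof (cases xs)
      case (Cons x xs')
      show ?thesis
      proof (cases x)
        case 0
        then show ?thesis using j RPrec Cons jdg by (auto intro: computes.prec_0)
      next
        case (Suc n)
        then obtain z where z: "z \<in> S" "proj z 0 = recf_code (RPrec g h)" "proj z 1 = list_encode (n # xs')"
            "jdg (recf_code h) (list_encode (n # proj z 2 # xs')) y \<in> S"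
          using j RPrec Cons by auto
        then show ?thesis using jdg[OF z(4)] IH RPrec Cons Suc by (blast intro: computes.prec_Suc)
      qed
    next
      case Nil
      then show ?thesis using j RPrec justified_RPrec(1) by metis
    qed
  next
    case (RMu g)
    then have "\<exists>v. computes Map.empty g (m # xs) (Suc v)" if m: "m < y" for m
    proof -
      obtain z where "z \<in> S" "proj z 0 = recf_code g" "proj z 1 = list_encode (m # xs)" "proj z 2 \<noteq> 0"
        using j RMu m by auto
      then show ?thesis using IH[of z g "m # xs"] by (metis not0_implies_Suc)
    qed
    moreover have "computes Map.empty g (y # xs) 0" by (rule jdg) (use j RMu in simp)
    ultimately show ?thesis unfolding RMu by (auto intro: computes.mu)
  next
    case RZero
    then show ?thesis using j by (auto intro: computes.zero)
  next
    case RSucc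
    then have "xs \<noteq> []" "y = Suc (hd xs)" using j by simp_all
    then show ?thesis using RSucc by (cases xs) (auto intro: computes.succ)
  next
    case (RProj i)
    then show ?thesis using j by (auto intro: computes.proj)
  next
    case ROracle
    then show ?thesis using j by simp
  qed
qed

lemma certificate_sound:
  assumes "certificate L" "z \<in> set L" "proj z 0 = recf_code f" "proj z 1 = list_encode xs"
  shows "computes Map.empty f xs (proj z 2)"
  using assms
proof (induction L arbitrary: z f xs)
  case (Cons a L)
  show ?case
  proof (cases "z = a")
    case True
    show ?thesis
    proof (rule justified_sound)
      show "justified (set L) (recf_code f) (list_encode xs) (proj z 2)"
        using Cons.prems True by (simp del: recf_code.simps)
    qed (rule Cons.IH; use Cons.prems in simp)
  qed (use Cons in auto)
qed simp

text \<open>The certificate that is found first need not be the one known to exist, but its value is the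
  same because computations are deterministic.\<close>

lemma universal_program: "\<exists>u. \<forall>e a b. phi e a b \<longrightarrow> computes Map.empty u [e, a] b"
proof -
  define found where "found t e a \<longleftrightarrow> certificate (list_decode t) \<and> t \<noteq> 0 \<and> proj (proj t 0) 0 = e \<and>
    proj (proj t 0) 1 = list_encode [a]" for t e a
  have "recpred 3 (\<lambda>xs. \<not> found (xs ! 0) (xs ! 1) (xs ! 2))"
    unfolding found_def by (intro rec) simp_all
  then obtain p where p: "\<And>xs. length xs = 3 \<Longrightarrow>
      computes Map.empty p xs (of_bool (\<not> found (xs ! 0) (xs ! 1) (xs ! 2)))"
    unfolding recfun_def by blast
  have "recfun 1 (\<lambda>xs. proj (proj (xs ! 0) 0) 2)" by (intro rec) simp_all
  then obtain q where q: "\<And>xs. length xs = 1 \<Longrightarrow> computes Map.empty q xs (proj (proj (xs ! 0) 0) 2)"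
    unfolding recfun_def by blast
  have "computes Map.empty (RComp q [RMu p]) [e, a] b" if e: "phi e a b" for e a b
  proof -
    obtain f where f: "recf_code f = e" "computes Map.empty f [a] b" using e unfolding phi_def by blast
    obtain L where L: "certificate L" "jdg e (list_encode [a]) b \<in> set L"
      using computes_certified[OF f(2)] f(1) unfolding certified_def by blast
    obtain L1 L2 where L12: "L = L1 @ jdg e (list_encode [a]) b # L2" using L(2) by (meson split_list)
    have "certificate (jdg e (list_encode [a]) b # L2)"
      using L(1) unfolding L12 by (induction L1) auto
    then have ex: "\<exists>t. found t e a" unfolding found_def
      by (intro exI[of _ "list_encode (jdg e (list_encode [a]) b # L2)"]) simp
    define t where "t = (LEAST t. found t e a)"
    have t: "found t e a" unfolding t_def using ex by (rule LeastI_ex)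
    have mu: "computes Map.empty (RMu p) [e, a] t"
    proof (rule computes.mu)
      show "computes Map.empty p [t, e, a] 0" using p[of "[t, e, a]"] t by (simp add: numeral_2_eq_2)
      fix m assume "m < t"
      then have "\<not> found m e a" unfolding t_def by (rule not_less_Least)
      then show "\<exists>y. computes Map.empty p [m, e, a] (Suc y)"
        using p[of "[m, e, a]"] by (auto simp: numeral_2_eq_2)
    qed
    have "computes Map.empty f [a] (proj (proj t 0) 2)"
    proof (rule certificate_sound[of "list_decode t"])
      show "proj t 0 \<in> set (list_decode t)"
        using t by (cases t) (auto simp: found_def proj_def split: prod.split)
    qed (use t f in \<open>auto simp: found_def\<close>)
    then have "b = proj (proj t 0) 2" using f(2) computes_unique by blast
    then show ?thesis
      using q[of "[t]"] mu by (intro computes.comp[of "[t]"]) auto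
  qed
  then show ?thesis by blast
qed


section \<open>A lambda calculus of programs\<close>

text \<open>Programs are read as terms of a lambda calculus with de Bruijn indices: an argument list is an
  environment, \<open>RProj i\<close> a variable, and binders put their variable in front. Sets of numbers play
  the role of types, and \<open>ev f xs B\<close> is the judgement that in the environment \<open>xs\<close> the program
  \<open>f\<close> has a value of type \<open>B\<close>. The lemmas named \<open>ev_\<dots>\<close> are the typing rules. The number \<open>n\<close>
  carried by several constructs is the length of the environment.\<close>

definition ev :: "recf \<Rightarrow> nat list \<Rightarrow> nat set \<Rightarrow> bool" where
  "ev f xs B \<longleftrightarrow> (\<exists>y\<in>B. computes Map.empty f xs y)"

lemma ev_mono: "ev f xs A \<Longrightarrow> A \<subseteq> B \<Longrightarrow> ev f xs B"
  unfolding ev_def by blast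

lemma ev_var: "i < length xs \<Longrightarrow> xs ! i \<in> B \<Longrightarrow> ev (RProj i) xs B"
  unfolding ev_def using computes.proj by blast

definition pure :: "nat \<Rightarrow> (nat list \<Rightarrow> nat) \<Rightarrow> recf" where
  "pure n h = (SOME f. \<forall>xs. length xs = n \<longrightarrow> computes Map.empty f xs (h xs))"

lemma computes_pure: "recfun n h \<Longrightarrow> length xs = n \<Longrightarrow> computes Map.empty (pure n h) xs (h xs)"
  unfolding recfun_def pure_def by (rule someI2_ex) auto

lemma ev_pure: "recfun n h \<Longrightarrow> length xs = n \<Longrightarrow> h xs \<in> B \<Longrightarrow> ev (pure n h) xs B"
  unfolding ev_def using computes_pure by blast

lemma ev_comp:
  assumes "list_all2 (\<lambda>g y. computes Map.empty g xs y) gs ys" "ev f ys B"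
  shows "ev (RComp f gs) xs B"
proof -
  obtain y where "y \<in> B" "computes Map.empty f ys y" using assms(2) unfolding ev_def by blast
  then show ?thesis
    using assms(1) unfolding ev_def list_all2_conv_all_nth
    by (intro bexI[of _ y] computes.comp[of ys]) auto
qed

lemma ev_comp1:
  assumes "ev g xs A" "\<And>a. a \<in> A \<Longrightarrow> ev f [a] B"
  shows "ev (RComp f [g]) xs B"
proof -
  obtain a where "a \<in> A" "computes Map.empty g xs a" using assms(1) unfolding ev_def by blast
  then show ?thesis using assms(2) by (intro ev_comp[of xs _ "[a]"]) auto
qed

lemma ev_comp2:
  assumes "ev g xs A" "ev h xs A'" "\<And>a b. a \<in> A \<Longrightarrow> b \<in> A' \<Longrightarrow> ev f [a, b] B"
  shows "ev (RComp f [g, h]) xs B"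
proof -
  obtain a b where "a \<in> A" "computes Map.empty g xs a" "b \<in> A'" "computes Map.empty h xs b"
    using assms(1,2) unfolding ev_def by blast
  then show ?thesis using assms(3) by (intro ev_comp[of xs _ "[a, b]"]) auto
qed

definition letp :: "nat \<Rightarrow> recf \<Rightarrow> recf \<Rightarrow> recf" where
  "letp n g f = RComp f (g # map RProj [0..<n])"

lemma list_all2_vars: "list_all2 (\<lambda>g y. computes orc g xs y) (map RProj [0..<length xs]) xs"
  by (auto simp: list_all2_conv_all_nth intro: computes.proj)

lemma ev_let:
  assumes "length xs = n" "ev g xs A" "\<And>a. a \<in> A \<Longrightarrow> ev f (a # xs) B"
  shows "ev (letp n g f) xs B"
proof -
  obtain a where "a \<in> A" "computes Map.empty g xs a" using assms(2) unfolding ev_def by blast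
  then show ?thesis
    using assms(1,3) list_all2_vars[of Map.empty xs] unfolding letp_def by (intro ev_comp[of xs _ "a # xs"]) auto
qed

definition weaken :: "nat \<Rightarrow> recf \<Rightarrow> recf" where
  "weaken n f = RComp f (map (\<lambda>i. RProj (Suc i)) [0..<n])"

lemma ev_weaken: "length xs = n \<Longrightarrow> ev f xs B \<Longrightarrow> ev (weaken n f) (a # xs) B"
  unfolding weaken_def
proof (rule ev_comp)
  have "computes Map.empty (RProj (Suc i)) (a # xs) (xs ! i)" if "i < length xs" for i
    using computes.proj[of "Suc i" "a # xs"] that by simp
  then show "list_all2 (\<lambda>g. computes Map.empty g (a # xs)) (map (\<lambda>i. RProj (Suc i)) [0..<n]) xs"
    if "length xs = n" using that by (auto simp: list_all2_conv_all_nth)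
qed

subsection \<open>Application and abstraction\<close>

definition univ :: recf where
  "univ = (SOME u. \<forall>e a b. phi e a b \<longrightarrow> computes Map.empty u [e, a] b)"

lemma computes_univ: "phi e a b \<Longrightarrow> computes Map.empty univ [e, a] b"
  unfolding univ_def using someI_ex[OF universal_program] by blast

definition app :: "recf \<Rightarrow> recf \<Rightarrow> recf" where
  "app s t = RComp univ [s, t]"

lemma ev_univ: "e \<in> arrow A B \<Longrightarrow> a \<in> A \<Longrightarrow> ev univ [e, a] B"
  unfolding arrow_def ev_def using computes_univ by blast

lemma ev_app: "ev s xs (arrow A B) \<Longrightarrow> ev t xs A \<Longrightarrow> ev (app s t) xs B"
  unfolding app_def by (erule ev_comp2, assumption, rule ev_univ)

primrec constp :: "nat \<Rightarrow> recf" where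
  "constp 0 = RZero"
| "constp (Suc n) = RComp RSucc [constp n]"

lemma computes_constp: "computes Map.empty (constp n) xs n"
proof (induction n)
  case (Suc n)
  then show ?case using computes.succ by (auto intro!: computes.comp[of "[n]"])
qed (auto intro: computes.zero)

lemma ev_constp: "n \<in> B \<Longrightarrow> ev (constp n) xs B"
  unfolding ev_def using computes_constp by blast

lemma ev_zero: "0 \<in> B \<Longrightarrow> ev RZero xs B"
  unfolding ev_def using computes.zero by blast

text \<open>The environment is frozen in the index by means of constant programs. This is the s-m-n
  theorem, and \<open>recfun_closure\<close> says that the index is computed from the environment.\<close>

definition closure :: "recf \<Rightarrow> nat list \<Rightarrow> nat" where
  "closure f xs = recf_code (RComp f (RProj 0 # map constp xs))"

lemma phi_closure: "computes Map.empty f (a # xs) b \<Longrightarrow> phi (closure f xs) a b"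
  unfolding phi_def closure_def
proof (intro exI conjI)
  assume "computes Map.empty f (a # xs) b"
  moreover have "computes Map.empty ((RProj 0 # map constp xs) ! i) [a] ((a # xs) ! i)"
    if "i < Suc (length xs)" for i
    using that computes.proj[of 0 "[a]"] by (cases i) (auto intro: computes_constp)
  ultimately show "computes Map.empty (RComp f (RProj 0 # map constp xs)) [a] b"
    by (intro computes.comp[of "a # xs"]) auto
qed simp

lemma closure_arrow: "(\<And>a. a \<in> A \<Longrightarrow> ev f (a # xs) B) \<Longrightarrow> closure f xs \<in> arrow A B"
  unfolding arrow_def ev_def using phi_closure by blast

lemma recfun_closure: "recfun n (closure f)"
proof -
  have c: "recf_code (constp m) = rec_nat (recf_code RZero) (\<lambda>_ r. list_encode [4, recf_code RSucc, r]) m" for m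
    by (induction m) auto
  have 1: "recfun 1 (\<lambda>xs. recf_code (constp (xs ! 0)))"
    unfolding c by (intro rec) auto
  have "recfun n (\<lambda>xs. list_encode (map (\<lambda>g. g xs)
      ((\<lambda>_. 4) # (\<lambda>_. recf_code f) # (\<lambda>_. recf_code (RProj 0)) #
        map (\<lambda>i xs. recf_code (constp (xs ! i))) [0..<n])))"
    by (rule recfun_list_encode) (auto intro!: recfun_const recfun_comp1[OF 1] recfun_nth)
  then show ?thesis
  proof (rule recfun_cong)
    fix xs :: "nat list" assume "length xs = n"
    then have "map (\<lambda>i. recf_code (constp (xs ! i))) [0..<n] = map (recf_code \<circ> constp) xs"
      by (intro nth_equalityI) auto
    then show "list_encode (map (\<lambda>g. g xs) ((\<lambda>_. 4) # (\<lambda>_. recf_code f) # (\<lambda>_. recf_code (RProj 0)) #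
        map (\<lambda>i xs. recf_code (constp (xs ! i))) [0..<n])) = closure f xs"
      by (simp add: closure_def comp_def)
  qed
qed

definition lam :: "nat \<Rightarrow> recf \<Rightarrow> recf" where
  "lam n f = pure n (closure f)"

lemma computes_lam: "length xs = n \<Longrightarrow> computes Map.empty (lam n f) xs (closure f xs)"
  unfolding lam_def by (rule computes_pure[OF recfun_closure])

lemma ev_lam_closure: "length xs = n \<Longrightarrow> closure f xs \<in> B \<Longrightarrow> ev (lam n f) xs B"
  unfolding ev_def using computes_lam by blast

lemma ev_lam: "length xs = n \<Longrightarrow> (\<And>a. a \<in> A \<Longrightarrow> ev f (a # xs) B) \<Longrightarrow> ev (lam n f) xs (arrow A B)"
  unfolding ev_def[of "lam n f"] using computes_lam closure_arrow by blast

text \<open>Composition evaluates all arguments, whereas here the branch that is not chosen may diverge. The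
  conditional therefore selects between closures of the two branches and applies the selected one
  to a dummy argument.\<close>

definition ifp :: "nat \<Rightarrow> (nat list \<Rightarrow> bool) \<Rightarrow> recf \<Rightarrow> recf \<Rightarrow> recf" where
  "ifp n P s t = app (pure n (\<lambda>xs. if P xs then closure (weaken n s) xs else closure (weaken n t) xs)) RZero"

lemma ev_if:
  assumes "recpred n P" "length xs = n" "P xs \<Longrightarrow> ev s xs B" "\<not> P xs \<Longrightarrow> ev t xs B"
  shows "ev (ifp n P s t) xs B"
  unfolding ifp_def
proof (rule ev_app)
  show "ev (pure n (\<lambda>xs. if P xs then closure (weaken n s) xs else closure (weaken n t) xs)) xs (arrow UNIV B)"
    using assms by (intro ev_pure recfun_if recfun_closure) (auto intro!: closure_arrow ev_weaken)
  show "ev RZero xs UNIV" unfolding ev_def using computes.zero by blast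
qed

text \<open>Kleene's recursion theorem by self-application: \<open>w\<close> maps a number \<open>s\<close> to an index of
  \<open>\<lambda>x. f(x, s s)\<close>, and \<open>q = w w\<close>.\<close>

lemma recursion_theorem: "\<exists>q. \<forall>x B. ev f [x, q] B \<longrightarrow> q \<in> arrow {x} B"
proof -
  let ?f = "RComp f [RProj 0, app (RProj 1) (RProj 1)]"
  define w where "w = closure (lam 1 ?f) []"
  have w: "phi w w (closure ?f [w])"
    unfolding w_def by (intro phi_closure computes_lam) simp
  have "closure ?f [w] \<in> arrow {x} B" if x: "ev f [x, closure ?f [w]] B" for x B
  proof (rule closure_arrow)
    fix a assume "a \<in> {x}"
    then have [simp]: "a = x" by simp
    show "ev ?f [a, w] B"
    proof (rule ev_comp2)
      show "ev (RProj 0) [a, w] {x}" by (rule ev_var) auto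
      show "ev (app (RProj 1) (RProj 1)) [a, w] {closure ?f [w]}"
      proof (rule ev_app)
        show "ev (RProj 1) [a, w] (arrow {w} {closure ?f [w]})"
          using w by (intro ev_var) (auto simp: arrow_def)
        show "ev (RProj 1) [a, w] {w}" by (rule ev_var) auto
      qed
    qed (use x in simp)
  qed
  then show ?thesis by blast
qed

definition fixcode :: "recf \<Rightarrow> nat" where
  "fixcode f = (SOME q. \<forall>x B. ev f [x, q] B \<longrightarrow> q \<in> arrow {x} B)"

lemma fixcode: "(\<And>x. x \<in> A \<Longrightarrow> ev f [x, fixcode f] B) \<Longrightarrow> fixcode f \<in> arrow A B"
  unfolding fixcode_def using someI_ex[OF recursion_theorem[of f]] by (fastforce simp: arrow_def)

lemma ev_prec:
  assumes "ev f xs (P 0)" "\<And>m y. m < k \<Longrightarrow> y \<in> P m \<Longrightarrow> ev g (m # y # xs) (P (Suc m))"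
  shows "ev (RPrec f g) (k # xs) (P k)"
  using assms(2)
proof (induction k)
  case 0
  then show ?case using assms(1) unfolding ev_def by (auto intro: computes.prec_0)
next
  case (Suc k)
  have "ev (RPrec f g) (k # xs) (P k)" using Suc.prems by (intro Suc.IH) auto
  then obtain y where "y \<in> P k" "computes Map.empty (RPrec f g) (k # xs) y" unfolding ev_def by blast
  moreover obtain z where "z \<in> P (Suc k)" "computes Map.empty g (k # y # xs) z"
    using Suc.prems[of k y] calculation unfolding ev_def by blast
  ultimately show ?case unfolding ev_def by (auto intro: computes.prec_Suc)
qed


section \<open>The local operator as a monad\<close>

lemma arrow_mono: "A \<subseteq> B \<Longrightarrow> arrow C A \<subseteq> arrow C B"
  unfolding arrow_def by (intro subsetI CollectI ballI) (drule CollectD, drule (1) bspec, erule bexE, rule bexI, auto)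

lemma F_op_mono: "A \<subseteq> B \<Longrightarrow> F_op A \<subseteq> F_op B"
  unfolding F_op_def by (intro UN_mono arrow_mono) auto

lemma F_opI: "e \<in> arrow {n..} A \<Longrightarrow> e \<in> F_op A"
  unfolding F_op_def by blast

text \<open>\<open>J A\<close> is the least set that is closed under the two constructors of the next lemmas, the units
  \<open>\<langle>0, a\<rangle>\<close> and the limits \<open>\<langle>1, e\<rangle>\<close> of sequences that are eventually in \<open>J A\<close>.\<close>

lemma J_op_return: "a \<in> A \<Longrightarrow> list_encode [0, a] \<in> J_op A"
  unfolding J_op_def wedge_def by blast

lemma J_op_lim:
  assumes "e \<in> F_op (J_op A)" shows "list_encode [1, e] \<in> J_op A"
proof -
  have "list_encode [1, e] \<in> B" if B: "wedge {0} A \<subseteq> B" "wedge {1} (F_op B) \<subseteq> B" for B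
  proof -
    have "e \<in> F_op B" using assms F_op_mono[of "J_op A" B] that unfolding J_op_def by blast
    then show ?thesis using B(2) unfolding wedge_def by blast
  qed
  then show ?thesis unfolding J_op_def by blast
qed

lemma J_op_induct [consumes 1, case_names return lim]:
  assumes "x \<in> J_op A" "\<And>a. a \<in> A \<Longrightarrow> P (list_encode [0, a])"
    "\<And>e. e \<in> F_op {x. P x} \<Longrightarrow> P (list_encode [1, e])"
  shows "P x"
proof -
  have "wedge {0} A \<subseteq> {x. P x}" "wedge {1} (F_op {x. P x}) \<subseteq> {x. P x}"
    using assms(2,3) unfolding wedge_def by auto
  then show ?thesis using assms(1) unfolding J_op_def by blast
qed

lemma J_op_mono:
  assumes "A \<subseteq> B" shows "J_op A \<subseteq> J_op B"
proof
  fix x assume "x \<in> J_op A"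
  then show "x \<in> J_op B"
    by (induction rule: J_op_induct)
       (use assms in \<open>auto simp del: One_nat_def intro: J_op_return J_op_lim\<close>)
qed

text \<open>A limit has terms that entered \<open>J {}\<close> before it, and there is no unit to begin with.\<close>

lemma J_op_nonempty:
  assumes "x \<in> J_op A" shows "A \<noteq> {}"
  using assms by (induction rule: J_op_induct) (auto simp: F_op_def arrow_def)

text \<open>The extension of \<open>g \<in> A \<rightarrow> J B\<close> to \<open>J A\<close> is defined by recursion: a unit \<open>\<langle>0, a\<rangle>\<close> goes to
  \<open>g a\<close>, and a limit \<open>\<langle>1, e\<rangle>\<close> to the limit of the extension applied to the terms of \<open>e\<close>. The
  environment consists of the argument, \<open>g\<close>, and the index of the whole program.\<close>

definition bindlim :: recf where
  "bindlim = RComp (pure 1 (\<lambda>xs. list_encode [1, xs ! 0]))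
    [lam 3 (app (app (RProj 3) (RProj 2)) (app (pure 4 (\<lambda>xs. proj (xs ! 1) 1)) (RProj 0)))]"

definition bindbody :: recf where
  "bindbody = ifp 3 (\<lambda>xs. proj (xs ! 0) 0 = 0) (app (RProj 1) (pure 3 (\<lambda>xs. proj (xs ! 0) 1))) bindlim"

definition bindcode :: nat where
  "bindcode = fixcode (lam 2 bindbody)"

lemma bindcode: "bindcode \<in> arrow (arrow A (J_op B)) (arrow (J_op A) (J_op B))"
proof -
  have "closure bindbody [g, bindcode] \<in> arrow (J_op A) (J_op B)" if g: "g \<in> arrow A (J_op B)" for g
  proof -
    have self: "bindcode \<in> arrow {g} {closure bindbody [g, bindcode]}"
      unfolding bindcode_def by (intro fixcode ev_lam_closure) auto
    have "closure bindbody [g, bindcode] \<in> arrow {x} (J_op B)" if "x \<in> J_op A" for x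
      using that
    proof (induction rule: J_op_induct)
      case (return a)
      show ?case
      proof (rule closure_arrow, unfold bindbody_def, rule ev_if)
        fix x assume "x \<in> {list_encode [0, a]}"
        then have x: "x = list_encode [0, a]" by simp
        show "ev (app (RProj 1) (pure 3 (\<lambda>xs. proj (xs ! 0) 1))) [x, g, bindcode] (J_op B)"
        proof (rule ev_app)
          show "ev (RProj 1) [x, g, bindcode] (arrow A (J_op B))" using g by (intro ev_var) auto
          show "ev (pure 3 (\<lambda>xs. proj (xs ! 0) 1)) [x, g, bindcode] A"
            using return x by (intro ev_pure rec) auto
        qed
        show "ev bindlim [x, g, bindcode] (J_op B)" if "\<not> proj ([x, g, bindcode] ! 0) 0 = 0"
          using that x by simp
      qed (auto intro!: rec)
    next
      case (lim e)
      show ?case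
      proof (rule closure_arrow, unfold bindbody_def, rule ev_if)
        fix x assume "x \<in> {list_encode [1, e]}"
        then have x: "x = list_encode [1, e]" by simp
        show "ev (app (RProj 1) (pure 3 (\<lambda>xs. proj (xs ! 0) 1))) [x, g, bindcode] (J_op B)"
          if "proj ([x, g, bindcode] ! 0) 0 = 0"
          using that x by simp
        obtain n where n: "e \<in> arrow {n..} {x. closure bindbody [g, bindcode] \<in> arrow {x} (J_op B)}"
          using lim unfolding F_op_def by blast
        show "ev bindlim [x, g, bindcode] (J_op B)"
          unfolding bindlim_def
        proof (rule ev_comp1)
          show "ev (lam 3 (app (app (RProj 3) (RProj 2)) (app (pure 4 (\<lambda>xs. proj (xs ! 1) 1)) (RProj 0))))
              [x, g, bindcode] (arrow {n..} (J_op B))"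
          proof (rule ev_lam)
            fix k assume "k \<in> {n..}"
            then obtain y where y: "phi e k y" "closure bindbody [g, bindcode] \<in> arrow {y} (J_op B)"
              using n unfolding arrow_def by blast
            show "ev (app (app (RProj 3) (RProj 2)) (app (pure 4 (\<lambda>xs. proj (xs ! 1) 1)) (RProj 0)))
                [k, x, g, bindcode] (J_op B)"
            proof (rule ev_app)
              show "ev (app (RProj 3) (RProj 2)) [k, x, g, bindcode] (arrow {y} (J_op B))"
              proof (rule ev_app)
                have "bindcode \<in> arrow {g} (arrow {y} (J_op B))"
                  using self y(2) arrow_mono[of "{closure bindbody [g, bindcode]}" "arrow {y} (J_op B)"] by blast
                then show "ev (RProj 3) [k, x, g, bindcode] (arrow {g} (arrow {y} (J_op B)))"
                  by (intro ev_var) auto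
                show "ev (RProj 2) [k, x, g, bindcode] {g}" by (rule ev_var) auto
              qed
              show "ev (app (pure 4 (\<lambda>xs. proj (xs ! 1) 1)) (RProj 0)) [k, x, g, bindcode] {y}"
              proof (rule ev_app)
                show "ev (pure 4 (\<lambda>xs. proj (xs ! 1) 1)) [k, x, g, bindcode] (arrow {k} {y})"
                  using y(1) by (intro ev_pure rec) (auto simp: x arrow_def)
                show "ev (RProj 0) [k, x, g, bindcode] {k}" by (rule ev_var) auto
              qed
            qed
          qed simp
        qed (auto simp del: One_nat_def intro!: ev_pure rec J_op_lim F_opI)
      qed (auto intro!: rec)
    qed
    then show ?thesis unfolding arrow_def by blast
  qed
  then show ?thesis
    unfolding bindcode_def by (intro fixcode ev_lam_closure) auto
qed


definition rename :: "nat list \<Rightarrow> recf \<Rightarrow> recf" where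
  "rename js f = RComp f (map RProj js)"

lemma ev_rename: "(\<And>j. j \<in> set js \<Longrightarrow> j < length xs) \<Longrightarrow> ev f (map ((!) xs) js) B \<Longrightarrow> ev (rename js f) xs B"
  unfolding rename_def
  by (rule ev_comp[of _ _ "map ((!) xs) js"]) (auto simp: list_all2_conv_all_nth intro!: computes.proj)

lemma map_nth_drop: "length xs = k + n \<Longrightarrow> map ((!) xs) [k..<k + n] = drop k xs"
  by (intro nth_equalityI) auto

definition retp :: "recf \<Rightarrow> recf" where
  "retp s = RComp (pure 1 (\<lambda>xs. list_encode [0, xs ! 0])) [s]"

lemma ev_ret: "ev s xs A \<Longrightarrow> ev (retp s) xs (J_op A)"
  unfolding retp_def by (erule ev_comp1) (auto intro!: ev_pure rec J_op_return)

definition limp :: "nat \<Rightarrow> recf \<Rightarrow> recf" where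
  "limp n f = RComp (pure 1 (\<lambda>xs. list_encode [1, xs ! 0])) [lam n f]"

lemma ev_lim:
  assumes "length xs = n" "\<And>k. N \<le> k \<Longrightarrow> ev f (k # xs) (J_op B)"
  shows "ev (limp n f) xs (J_op B)"
  unfolding limp_def
proof (rule ev_comp1)
  show "ev (lam n f) xs (arrow {N..} (J_op B))" using assms by (intro ev_lam) auto
qed (auto simp del: One_nat_def intro!: ev_pure rec J_op_lim F_opI)

definition bindp :: "nat \<Rightarrow> recf \<Rightarrow> recf \<Rightarrow> recf" where
  "bindp n s f = app (app (constp bindcode) (lam n f)) s"

lemma ev_bind:
  assumes "length xs = n" "ev s xs (J_op A)" "\<And>a. a \<in> A \<Longrightarrow> ev f (a # xs) (J_op B)"
  shows "ev (bindp n s f) xs (J_op B)"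
  unfolding bindp_def
proof (rule ev_app)
  show "ev (app (constp bindcode) (lam n f)) xs (arrow (J_op A) (J_op B))"
  proof (rule ev_app)
    show "ev (lam n f) xs (arrow A (J_op B))" using assms by (intro ev_lam) auto
  qed (rule ev_constp[OF bindcode])
qed (rule assms)

text \<open>\<open>J\<close> commutes with finite products: the components are bound one after the other.\<close>

primrec seqp :: "nat \<Rightarrow> recf list \<Rightarrow> recf" where
  "seqp n [] = retp RZero"
| "seqp n (g # gs) = bindp n g (bindp (Suc n) (weaken n (seqp n gs))
    (retp (pure (Suc (Suc n)) (\<lambda>xs. ccons (xs ! 1) (xs ! 0)))))"

lemma ev_seq:
  assumes "length xs = n" "list_all2 (\<lambda>g A. ev g xs (J_op A)) gs As"
  shows "ev (seqp n gs) xs (J_op {list_encode ys | ys. list_all2 (\<in>) ys As})"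
  using assms(2)
proof (induction rule: list_all2_induct)
  case Nil
  show ?case by (auto intro!: ev_ret ev_zero)
next
  case (Cons g gs A As)
  show ?case unfolding seqp.simps
  proof (rule ev_bind[OF assms(1) Cons.hyps(1)], rule ev_bind)
    fix a b assume "a \<in> A" "b \<in> {list_encode ys |ys. list_all2 (\<in>) ys As}"
    then obtain ys where "b = list_encode ys" "list_all2 (\<in>) ys As" by blast
    then have "ccons a b = list_encode (a # ys)" "list_all2 (\<in>) (a # ys) (A # As)"
      using \<open>a \<in> A\<close> by auto
    then have "ccons a b \<in> {list_encode ys |ys. list_all2 (\<in>) ys (A # As)}" by blast
    then show "ev (retp (pure (Suc (Suc n)) (\<lambda>xs. ccons (xs ! 1) (xs ! 0)))) (b # a # xs)
       (J_op {list_encode ys |ys. list_all2 (\<in>) ys (A # As)})"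
      using assms(1) by (intro ev_ret ev_pure rec) auto
  qed (use assms(1) Cons.IH in \<open>auto intro: ev_weaken\<close>)
qed

definition bindall :: "nat \<Rightarrow> recf list \<Rightarrow> recf \<Rightarrow> recf" where
  "bindall n gs f = bindp n (seqp n gs)
    (RComp f (map (\<lambda>i. pure (Suc n) (\<lambda>xs. proj (xs ! 0) i)) [0..<length gs]))"

lemma ev_unpack:
  assumes "length xs = n" "length ys = m" "ev f ys B"
  shows "ev (RComp f (map (\<lambda>i. pure (Suc n) (\<lambda>xs. proj (xs ! 0) i)) [0..<m])) (list_encode ys # xs) B"
proof (rule ev_comp[OF _ assms(3)])
  have "computes Map.empty (pure (Suc n) (\<lambda>xs. proj (xs ! 0) i)) (list_encode ys # xs) (ys ! i)"
    if "i < m" for i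
  proof -
    have "recfun (Suc n) (\<lambda>xs. proj (xs ! 0) i)" by (intro rec) auto
    from computes_pure[OF this, of "list_encode ys # xs"] show ?thesis using that assms by simp
  qed
  then show "list_all2 (\<lambda>g. computes Map.empty g (list_encode ys # xs))
      (map (\<lambda>i. pure (Suc n) (\<lambda>xs. proj (xs ! 0) i)) [0..<m]) ys"
    using assms(2) by (auto simp: list_all2_conv_all_nth)
qed

lemma ev_bindall:
  assumes "length xs = n" "list_all2 (\<lambda>g A. ev g xs (J_op A)) gs As"
    "\<And>ys. list_all2 (\<in>) ys As \<Longrightarrow> ev f ys (J_op B)"
  shows "ev (bindall n gs f) xs (J_op B)"
  unfolding bindall_def
proof (rule ev_bind[OF assms(1) ev_seq[OF assms(1,2)]])
  fix c assume "c \<in> {list_encode ys |ys. list_all2 (\<in>) ys As}"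
  then obtain ys where "c = list_encode ys" "list_all2 (\<in>) ys As" by blast
  moreover from this assms(2) have "length ys = length gs" by (metis list_all2_lengthD)
  ultimately show "ev (RComp f (map (\<lambda>i. pure (Suc n) (\<lambda>xs. proj (xs ! 0) i)) [0..<length gs])) (c # xs) (J_op B)"
    using ev_unpack assms(1,3) by blast
qed

text \<open>Unbounded search is a limit of bounded searches. The search below \<open>k\<close> returns \<open>0\<close> if it fails
  and the successor of the first zero if it succeeds, so its result is eventually constant. Once a
  zero has been found \<open>f\<close> is not evaluated any more, since it need not be defined beyond.\<close>

definition mup :: "nat \<Rightarrow> recf \<Rightarrow> recf" where
  "mup n f = bindp n
    (limp n (RPrec (retp RZero) (bindp (n + 2) (RProj 1) (ifp (n + 3) (\<lambda>xs. xs ! 0 = 0)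
      (bindp (n + 3) (rename (1 # [3..<3 + n]) f)
        (retp (pure (n + 4) (\<lambda>xs. if xs ! 0 = 0 then Suc (xs ! 2) else 0))))
      (retp (RProj 0))))))
    (retp (pure (Suc n) (\<lambda>xs. xs ! 0 - 1)))"

lemma ev_mu:
  assumes n: "length xs = n" and k: "ev f (k # xs) (J_op {0})"
    and less: "\<And>m. m < k \<Longrightarrow> \<exists>v. ev f (m # xs) (J_op {Suc v})"
  shows "ev (mup n f) xs (J_op {k})"
  unfolding mup_def
proof (rule ev_bind[OF n], rule ev_lim[OF n])
  \<comment> \<open>The state after \<open>m\<close> steps; the loop below binds it in front of \<open>m\<close> and of the previous
    element of \<open>J\<close>.\<close>
  let ?st = "\<lambda>m. if m \<le> k then 0 else Suc k"
  fix K assume "Suc k \<le> K"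
  then have K: "{Suc k} = {?st K}" by auto
  let ?search = "bindp (n + 3) (rename (1 # [3..<3 + n]) f)
        (retp (pure (n + 4) (\<lambda>xs. if xs ! 0 = 0 then Suc (xs ! 2) else 0)))"
  have step: "ev ?search (s # m # y # xs) (J_op {?st (Suc m)})" if "m \<le> k" for s m y
  proof (rule ev_bind)
    show "ev (rename (1 # [3..<3 + n]) f) (s # m # y # xs) (J_op (if m = k then {0} else {v. 0 < v}))"
    proof (rule ev_rename)
      have "map ((!) (s # m # y # xs)) (1 # [3..<3 + n]) = m # xs"
        using n map_nth_drop[of "s # m # y # xs" 3 n] by (simp add: eval_nat_numeral del: upt_Suc)
      moreover have "ev f (m # xs) (J_op (if m = k then {0} else {v. 0 < v}))"
      proof (cases "m = k")
        case False
        then obtain v where "ev f (m # xs) (J_op {Suc v})" using less \<open>m \<le> k\<close> by fastforce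
        then have "ev f (m # xs) (J_op {v. 0 < v})" by (rule ev_mono) (auto intro!: J_op_mono)
        then show ?thesis using False by simp
      qed (use k in simp)
      ultimately show "ev f (map ((!) (s # m # y # xs)) (1 # [3..<3 + n])) (J_op (if m = k then {0} else {v. 0 < v}))"
        by simp
    qed (use n in auto)
    show "ev (retp (pure (n + 4) (\<lambda>xs. if xs ! 0 = 0 then Suc (xs ! 2) else 0))) (v # s # m # y # xs) (J_op {?st (Suc m)})"
      if "v \<in> (if m = k then {0} else {v. 0 < v})" for v
      using that n \<open>m \<le> k\<close> by (intro ev_ret ev_pure rec) (auto split: if_splits)
  qed (use n in auto)
  show "ev (RPrec (retp RZero) (bindp (n + 2) (RProj 1) (ifp (n + 3) (\<lambda>xs. xs ! 0 = 0) ?search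
      (retp (RProj 0))))) (K # xs) (J_op {Suc k})"
    unfolding K
  proof (rule ev_prec[where P = "\<lambda>m. J_op {?st m}"])
    fix m y assume y: "y \<in> J_op {?st m}"
    show "ev (bindp (n + 2) (RProj 1) (ifp (n + 3) (\<lambda>xs. xs ! 0 = 0) ?search (retp (RProj 0))))
        (m # y # xs) (J_op {?st (Suc m)})"
    proof (rule ev_bind)
      show "ev (RProj 1) (m # y # xs) (J_op {?st m})" using y by (intro ev_var) auto
      fix s assume "s \<in> {?st m}"
      then have s: "s = ?st m" by simp
      show "ev (ifp (n + 3) (\<lambda>xs. xs ! 0 = 0) ?search (retp (RProj 0))) (s # m # y # xs) (J_op {?st (Suc m)})"
      proof (rule ev_if)
        show "ev ?search (s # m # y # xs) (J_op {?st (Suc m)})" if "(s # m # y # xs) ! 0 = 0"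
          using that s by (intro step) (auto split: if_splits)
        show "ev (retp (RProj 0)) (s # m # y # xs) (J_op {?st (Suc m)})" if "(s # m # y # xs) ! 0 \<noteq> 0"
          using that s by (intro ev_ret ev_var) (auto split: if_splits)
      qed (use n in \<open>auto intro!: rec\<close>)
    qed (use n in auto)
  qed (auto intro: ev_ret ev_zero)
next
  show "ev (retp (pure (Suc n) (\<lambda>xs. xs ! 0 - 1))) (a # xs) (J_op {k})" if "a \<in> {Suc k}" for a
    using that n by (intro ev_ret ev_pure rec) auto
qed


section \<open>Representable functions are closed under recursion\<close>

lemma computes_RPrec_values:
  assumes "computes orc (RPrec f g) (k # xs) y"
  obtains v where "v k = y" "computes orc f xs (v 0)" "\<And>m. m < k \<Longrightarrow> computes orc g (m # v m # xs) (v (Suc m))"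
  using assms
proof (induction k arbitrary: y thesis)
  case 0
  from 0(2) have "computes orc f xs y" by (cases rule: computes.cases) auto
  then show ?case using 0(1)[of "\<lambda>_. y"] by simp
next
  case (Suc k)
  from Suc.prems(2) obtain z where z: "computes orc (RPrec f g) (k # xs) z" "computes orc g (k # z # xs) y"
    by (cases rule: computes.cases) auto
  obtain v where v: "v k = z" "computes orc f xs (v 0)" "\<And>m. m < k \<Longrightarrow> computes orc g (m # v m # xs) (v (Suc m))"
    using Suc.IH z(1) by blast
  show ?case
    by (rule Suc.prems(1)[of "v(Suc k := y)"]) (use v z(2) in \<open>auto simp: less_Suc_eq\<close>)
qed

text \<open>Recursion relative to \<open>g\<close> is carried out inside \<open>J\<close>: an oracle call is an application of the
  representing index, composition and primitive recursion bind intermediate values, and search is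
  \<open>mup\<close>.\<close>

lemma representable_recursive_in:
  assumes g: "represents r g"
  shows "\<exists>p. \<forall>xs y. length xs = n \<longrightarrow> computes (\<lambda>x. Some (g x)) f xs y \<longrightarrow> ev p xs (J_op {y})"
proof (induction f arbitrary: n)
  case RZero
  have "ev (retp RZero) xs (J_op {y})" if "computes (\<lambda>x. Some (g x)) RZero xs y" for xs y
    using that by (cases rule: computes.cases) (auto intro!: ev_ret ev_zero)
  then show ?case by blast
next
  case RSucc
  have "ev (retp RSucc) xs (J_op {y})" if "computes (\<lambda>x. Some (g x)) RSucc xs y" for xs y
    using that by (cases rule: computes.cases) (auto simp: ev_def[of RSucc] intro!: ev_ret computes.succ)
  then show ?case by blast
next
  case (RProj i)
  have "ev (retp (RProj i)) xs (J_op {y})" if "computes (\<lambda>x. Some (g x)) (RProj i) xs y" for xs y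
    using that by (cases rule: computes.cases) (auto intro!: ev_ret ev_var)
  then show ?case by blast
next
  case ROracle
  have "ev (app (constp r) (RProj 0)) xs (J_op {y})" if "computes (\<lambda>x. Some (g x)) ROracle xs y" for xs y
    using that
  proof (cases rule: computes.cases)
    case (orc x zs)
    show ?thesis
    proof (rule ev_app)
      show "ev (constp r) xs (arrow {x} (J_op {y}))"
        using g orc by (intro ev_constp) (auto simp: represents_def arrow_def)
      show "ev (RProj 0) xs {x}" using orc by (intro ev_var) auto
    qed
  qed
  then show ?case by blast
next
  case (RComp f gs)
  obtain p where p: "\<And>xs y. length xs = length gs \<Longrightarrow> computes (\<lambda>x. Some (g x)) f xs y \<Longrightarrow> ev p xs (J_op {y})"
    using RComp.IH(1) by blast
  have "\<forall>h\<in>set gs. \<exists>p. \<forall>xs y. length xs = n \<longrightarrow> computes (\<lambda>x. Some (g x)) h xs y \<longrightarrow> ev p xs (J_op {y})"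
    by (intro ballI RComp.IH(2))
  from bchoice[OF this] obtain q where q: "\<And>h xs y. h \<in> set gs \<Longrightarrow> length xs = n \<Longrightarrow>
      computes (\<lambda>x. Some (g x)) h xs y \<Longrightarrow> ev (q h) xs (J_op {y})"
    by blast
  have "ev (bindall n (map q gs) p) xs (J_op {y})"
    if "length xs = n" "computes (\<lambda>x. Some (g x)) (RComp f gs) xs y" for xs y
    using that(2)
  proof (cases rule: computes.cases)
    case (comp ys)
    show ?thesis
    proof (rule ev_bindall[OF that(1), where As = "map (\<lambda>y. {y}) ys"])
      show "list_all2 (\<lambda>g A. ev g xs (J_op A)) (map q gs) (map (\<lambda>y. {y}) ys)"
        using q that(1) comp by (auto simp: list_all2_conv_all_nth)
      fix zs assume "list_all2 (\<in>) zs (map (\<lambda>y. {y}) ys)"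
      then have "zs = ys" by (auto simp: list_all2_conv_all_nth intro: nth_equalityI)
      then show "ev p zs (J_op {y})" using p comp by simp
    qed
  qed
  then show ?case by blast
next
  case (RPrec f h)
  show ?case
  proof (cases n)
    case 0
    then show ?thesis by (auto elim: computes.cases)
  next
    case (Suc n')
    obtain p where p: "\<And>xs y. length xs = n' \<Longrightarrow> computes (\<lambda>x. Some (g x)) f xs y \<Longrightarrow> ev p xs (J_op {y})"
      using RPrec.IH(1) by blast
    obtain q where q: "\<And>xs y. length xs = n' + 2 \<Longrightarrow> computes (\<lambda>x. Some (g x)) h xs y \<Longrightarrow> ev q xs (J_op {y})"
      using RPrec.IH(2) by blast
    let ?q = "bindp (n' + 2) (RProj 1) (rename (1 # 0 # [3..<3 + n']) q)"
    have "ev (RPrec p ?q) xs (J_op {y})"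
      if len: "length xs = n" and c: "computes (\<lambda>x. Some (g x)) (RPrec f h) xs y" for xs y
    proof -
      obtain k xs' where xs: "xs = k # xs'" "length xs' = n'" using len Suc by (cases xs) auto
      obtain v where v: "v k = y" "computes (\<lambda>x. Some (g x)) f xs' (v 0)"
          "\<And>m. m < k \<Longrightarrow> computes (\<lambda>x. Some (g x)) h (m # v m # xs') (v (Suc m))"
        using computes_RPrec_values c unfolding xs(1) by blast
      have "ev (RPrec p ?q) (k # xs') (J_op {v k})"
      proof (rule ev_prec[where P = "\<lambda>m. J_op {v m}"])
        fix m z assume m: "m < k" and z: "z \<in> J_op {v m}"
        show "ev ?q (m # z # xs') (J_op {v (Suc m)})"
        proof (rule ev_bind)
          show "ev (RProj 1) (m # z # xs') (J_op {v m})" using z by (intro ev_var) auto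
          fix a assume "a \<in> {v m}"
          then have "map ((!) (a # m # z # xs')) (1 # 0 # [3..<3 + n']) = m # v m # xs'"
            using xs map_nth_drop[of "a # m # z # xs'" 3 n'] by (simp add: eval_nat_numeral del: upt_Suc)
          then show "ev (rename (1 # 0 # [3..<3 + n']) q) (a # m # z # xs') (J_op {v (Suc m)})"
            using q[OF _ v(3)[OF m]] xs by (intro ev_rename) (auto simp del: upt_Suc)
        qed (use xs in auto)
      qed (use p v xs in auto)
      then show ?thesis using v xs by simp
    qed
    then show ?thesis by blast
  qed
next
  case (RMu f)
  obtain p where p: "\<And>xs y. length xs = Suc n \<Longrightarrow> computes (\<lambda>x. Some (g x)) f xs y \<Longrightarrow> ev p xs (J_op {y})"
    using RMu by blast
  have "ev (mup n p) xs (J_op {y})"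
    if "length xs = n" "computes (\<lambda>x. Some (g x)) (RMu f) xs y" for xs y
    using that(2)
  proof (cases rule: computes.cases)
    case mu
    show ?thesis
    proof (rule ev_mu[OF that(1)])
      show "ev p (y # xs) (J_op {0})" using p mu that(1) by simp
      show "\<exists>v. ev p (m # xs) (J_op {Suc v})" if m: "m < y" for m
      proof -
        obtain v where "computes (\<lambda>x. Some (g x)) f (m # xs) (Suc v)" using mu(2)[OF m] by blast
        then show ?thesis using p[of "m # xs" "Suc v"] \<open>length xs = n\<close> by auto
      qed
    qed
  qed
  then show ?case by blast
qed


section \<open>Arithmetical truth is representable\<close>

text \<open>Truth is evaluated by recursion on codes. Since \<open>truth\<close> has to be \<open>0\<close> on numbers that code no
  sentence, the evaluation works on arbitrary numbers and reports codes that are not well formed.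
  The entries of a list are smaller than its code, which makes the recursion terminate.\<close>

lemma le_list_encode: "x \<in> set xs \<Longrightarrow> x < list_encode xs"
proof (induction xs)
  case (Cons a xs)
  then show ?case
    using le_prod_encode_1[of a "list_encode xs"] le_prod_encode_2[of "list_encode xs" a]
    by (auto simp: list_encode.simps(2))
qed simp

lemma proj_less [termination_simp]: "i < clen c \<Longrightarrow> proj c i < c"
  using le_list_encode[of "proj c i" "list_decode c"] by (simp add: proj_def clen_def)

text \<open>The value of a term is represented by its successor, and \<open>0\<close> marks a number that codes no term
  in the variables at hand. The number \<open>k\<close> is the tag of the operation in \<open>tm_code\<close>.\<close>

definition tmop :: "nat \<Rightarrow> nat \<Rightarrow> nat \<Rightarrow> nat" where
  "tmop k u v = (if u = 0 \<or> v = 0 then 0 else if k = 3 then Suc ((u - 1) + (v - 1)) else Suc ((u - 1) * (v - 1)))"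

function tm_value :: "nat \<Rightarrow> nat list \<Rightarrow> nat" where
  "tm_value c xs =
    (if clen c = 2 \<and> proj c 0 = 0 then (if proj c 1 < length xs then Suc (xs ! proj c 1) else 0)
     else if clen c = 1 \<and> proj c 0 = 1 then 1
     else if clen c = 2 \<and> proj c 0 = 2 then (if tm_value (proj c 1) xs = 0 then 0 else Suc (tm_value (proj c 1) xs))
     else if clen c = 3 \<and> (proj c 0 = 3 \<or> proj c 0 = 4) then tmop (proj c 0) (tm_value (proj c 1) xs) (tm_value (proj c 2) xs)
     else 0)"
  by pat_completeness auto
termination by (relation "measure fst") (auto intro!: proj_less)

declare tm_value.simps [simp del]

lemma tm_value_tm_code: "tm_value (tm_code t) xs = (if tm_in (length xs) t then Suc (tm_val std_nat xs t) else 0)"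
  by (induction t) (auto simp: tm_value.simps[of "list_encode _"] list_encode_eq tmop_def std_nat_def)

lemma list_encode_proj1: "clen c = 1 \<Longrightarrow> list_encode [proj c 0] = c"
  and list_encode_proj2: "clen c = 2 \<Longrightarrow> list_encode [proj c 0, proj c 1] = c"
  and list_encode_proj3: "clen c = 3 \<Longrightarrow> list_encode [proj c 0, proj c 1, proj c 2] = c"
proof -
  have "map (proj c) [0..<clen c] = list_decode c"
    by (intro nth_equalityI) (auto simp: clen_def proj_def)
  then have "list_encode (map (proj c) [0..<clen c]) = c" by simp
  then show "clen c = 1 \<Longrightarrow> list_encode [proj c 0] = c" "clen c = 2 \<Longrightarrow> list_encode [proj c 0, proj c 1] = c"
    "clen c = 3 \<Longrightarrow> list_encode [proj c 0, proj c 1, proj c 2] = c"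
    by (simp_all add: eval_nat_numeral)
qed

lemma tm_value_nonzero: "tm_value c xs \<noteq> 0 \<Longrightarrow> \<exists>t. tm_code t = c"
proof (induction c rule: less_induct)
  case (less c)
  have IH: "\<exists>t. tm_code t = proj c i" if "i < clen c" "tm_value (proj c i) xs \<noteq> 0" for i
    using less.IH proj_less that by blast
  consider (0) "clen c = 2" "proj c 0 = 0" | (1) "clen c = 1" "proj c 0 = 1"
    | (2) "clen c = 2" "proj c 0 = 2" "tm_value (proj c 1) xs \<noteq> 0"
    | (3) "clen c = 3" "proj c 0 = 3 \<or> proj c 0 = 4" "tm_value (proj c 1) xs \<noteq> 0" "tm_value (proj c 2) xs \<noteq> 0"
    using less.prems unfolding tm_value.simps[of c] tmop_def by (auto split: if_splits)
  then show ?case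
  proof cases
    case 0
    then show ?thesis using list_encode_proj2[of c] by (auto intro: exI[of _ "TVar (proj c 1)"])
  next
    case 1
    then show ?thesis using list_encode_proj1[of c] by (auto intro: exI[of _ "TZero"])
  next
    case 2
    then obtain t where "tm_code t = proj c 1" using IH[of 1] by auto
    then show ?thesis using 2 list_encode_proj2[of c] by (auto intro: exI[of _ "TSucc t"])
  next
    case 3
    then obtain t s where "tm_code t = proj c 1" "tm_code s = proj c 2" using IH[of 1] IH[of 2] by auto
    then show ?thesis
      using 3 list_encode_proj3[of c] by (auto intro: exI[of _ "TAdd t s"] exI[of _ "TMul t s"])
  qed
qed

text \<open>Truth values are \<open>0\<close> and \<open>1\<close>, and \<open>2\<close> marks a number that codes no formula in the variables at
  hand. The number \<open>k\<close> is the tag of the connective in \<open>fm_code\<close>.\<close>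

definition fmop :: "nat \<Rightarrow> nat \<Rightarrow> nat \<Rightarrow> nat" where
  "fmop k u v = (if u = 2 \<or> v = 2 then 2 else if k = 2 then of_bool (u = 1 \<and> v = 1)
    else if k = 3 then of_bool (u = 1 \<or> v = 1) else of_bool (u = 1 \<longrightarrow> v = 1))"

definition fmeq :: "nat \<Rightarrow> nat \<Rightarrow> nat" where
  "fmeq u v = (if u = 0 \<or> v = 0 then 2 else of_bool (u = v))"

text \<open>Conjugation with \<open>flip\<close> turns the universal quantifier, which has tag \<open>6\<close>, into the existential
  one, which is a maximum. As \<open>2\<close> is fixed, it also propagates the mark of ill-formed codes.\<close>

definition flip :: "nat \<Rightarrow> nat \<Rightarrow> nat" where
  "flip k v = (if k = 6 \<and> v < 2 then 1 - v else v)"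

function fm_value :: "nat \<Rightarrow> nat list \<Rightarrow> nat" where
  "fm_value c xs =
    (if clen c = 1 \<and> proj c 0 = 0 then 0
     else if clen c = 3 \<and> proj c 0 = 1 then fmeq (tm_value (proj c 1) xs) (tm_value (proj c 2) xs)
     else if clen c = 3 \<and> 2 \<le> proj c 0 \<and> proj c 0 \<le> 4 then fmop (proj c 0) (fm_value (proj c 1) xs) (fm_value (proj c 2) xs)
     else if clen c = 2 \<and> 5 \<le> proj c 0 \<and> proj c 0 \<le> 6 then
       flip (proj c 0) (Max (range (\<lambda>x. flip (proj c 0) (fm_value (proj c 1) (x # xs)))))
     else 2)"
  by pat_completeness auto
termination by (relation "measure fst") (auto intro!: proj_less)

declare fm_value.simps [simp del]

lemma finite_bounded_range: "(\<And>x. h x \<le> (b::nat)) \<Longrightarrow> finite (range h)"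
  by (rule finite_subset[of _ "{..b}"]) auto

lemma fm_value_le: "fm_value c xs \<le> 2"
proof (induction c arbitrary: xs rule: less_induct)
  case (less c)
  have "flip (proj c 0) (Max (range (\<lambda>x. flip (proj c 0) (fm_value (proj c 1) (x # xs))))) \<le> 2" if "clen c = 2"
  proof -
    have *: "flip (proj c 0) (fm_value (proj c 1) (x # xs)) \<le> 2" for x
      using less.IH[of "proj c 1" "x # xs"] proj_less[of 1 c] that by (auto simp: flip_def)
    then have "Max (range (\<lambda>x. flip (proj c 0) (fm_value (proj c 1) (x # xs)))) \<le> 2"
      by (subst Max_le_iff) (auto intro: finite_bounded_range)
    then show ?thesis by (auto simp: flip_def)
  qed
  then show ?case by (auto simp: fm_value.simps[of c] fmeq_def fmop_def)
qed

lemma fm_value_fm_code: "fm_value (fm_code \<phi>) xs = (if fm_in (length xs) \<phi> then of_bool (sat std_nat \<phi> xs) else 2)"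
proof (induction \<phi> arbitrary: xs)
  case (FEx \<phi>)
  have "Max (range (\<lambda>x. fm_value (fm_code \<phi>) (x # xs))) =
      (if fm_in (Suc (length xs)) \<phi> then of_bool (\<exists>x. sat std_nat \<phi> (x # xs)) else 2)"
    by (rule Max_eqI) (auto simp: FEx image_iff intro: finite_bounded_range[of _ 2])
  then show ?case
    by (auto simp: fm_value.simps[of "list_encode _"] list_encode_eq flip_def std_nat_def)
next
  case (FAll \<phi>)
  have "Max (range (\<lambda>x. flip 6 (fm_value (fm_code \<phi>) (x # xs)))) =
      (if fm_in (Suc (length xs)) \<phi> then of_bool (\<exists>x. \<not> sat std_nat \<phi> (x # xs)) else 2)"
    by (rule Max_eqI) (auto simp: FAll flip_def of_bool_def image_iff intro: finite_bounded_range[of _ 2])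
  then show ?case
    by (auto simp: fm_value.simps[of "list_encode _"] list_encode_eq flip_def[of _ "if _ then _ else _"] std_nat_def)
qed (auto simp: fm_value.simps[of "list_encode _"] list_encode_eq fmeq_def fmop_def tm_value_tm_code)

lemma fm_value_valid: "fm_value c xs \<noteq> 2 \<Longrightarrow> \<exists>\<phi>. fm_code \<phi> = c"
proof (induction c arbitrary: xs rule: less_induct)
  case (less c)
  have IH: "\<exists>t. fm_code t = proj c i" if "i < clen c" "fm_value (proj c i) xs \<noteq> 2" for i xs
    using less.IH proj_less that by blast
  consider (0) "clen c = 1" "proj c 0 = 0"
    | (1) "clen c = 3" "proj c 0 = 1" "tm_value (proj c 1) xs \<noteq> 0" "tm_value (proj c 2) xs \<noteq> 0"
    | (2) "clen c = 3" "2 \<le> proj c 0" "proj c 0 \<le> 4" "fm_value (proj c 1) xs \<noteq> 2" "fm_value (proj c 2) xs \<noteq> 2"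
    | (3) "clen c = 2" "5 \<le> proj c 0" "proj c 0 \<le> 6"
      "flip (proj c 0) (Max (range (\<lambda>x. flip (proj c 0) (fm_value (proj c 1) (x # xs))))) \<noteq> 2"
    using less.prems unfolding fm_value.simps[of c] by (auto simp: fmeq_def fmop_def split: if_splits)
  then show ?case
  proof cases
    case 0
    then show ?thesis using list_encode_proj1[of c] by (auto intro: exI[of _ FBot])
  next
    case 1
    then obtain t s where "tm_code t = proj c 1" "tm_code s = proj c 2" using tm_value_nonzero by blast
    then show ?thesis using 1 list_encode_proj3[of c] by (auto intro: exI[of _ "FEq t s"])
  next
    case 2
    then obtain t where "fm_code t = proj c 1" using IH[of 1 xs] by auto
    moreover from 2 obtain s where "fm_code s = proj c 2" using IH[of 2 xs] by auto
    moreover have "proj c 0 = 2 \<or> proj c 0 = 3 \<or> proj c 0 = 4" using 2 by linarith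
    ultimately show ?thesis
      using 2(1) list_encode_proj3[of c] by (auto intro: exI[of _ "FAnd t s"] exI[of _ "FOr t s"] exI[of _ "FImp t s"])
  next
    case 3
    have "\<exists>x. fm_value (proj c 1) (x # xs) \<noteq> 2"
    proof (rule ccontr)
      assume "\<not> (\<exists>x. fm_value (proj c 1) (x # xs) \<noteq> 2)"
      then have "range (\<lambda>x. flip (proj c 0) (fm_value (proj c 1) (x # xs))) = {2}" by (auto simp: flip_def)
      then show False using 3(4) by (simp add: flip_def)
    qed
    then obtain t where "fm_code t = proj c 1" using IH[of 1] 3 by auto
    moreover have "proj c 0 = 5 \<or> proj c 0 = 6" using 3 by linarith
    ultimately show ?thesis using 3(1) list_encode_proj2[of c] by (auto intro: exI[of _ "FEx t"] exI[of _ "FAll t"])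
  qed
qed

lemma truth_eq_fm_value: "truth c = of_bool (fm_value c [] = 1)"
proof (cases "fm_value c [] = 2")
  case True
  then show ?thesis using fm_value_fm_code[of _ "[]"] by (auto simp: truth_def)
next
  case False
  then obtain \<phi> where c: "c = fm_code \<phi>" using fm_value_valid by metis
  have "fm_value c [] = of_bool (\<exists>\<phi>. fm_in 0 \<phi> \<and> fm_code \<phi> = c \<and> sat std_nat \<phi> [])"
    using False fm_value_fm_code[of _ "[]"] by (auto simp: c split: if_splits) (metis list.size(3) of_bool_eq(1,2) zero_neq_one)
  then show ?thesis by (auto simp: truth_def)
qed

subsection \<open>The evaluating programs\<close>

lemma recfun_tmop [rec]: "recfun n g \<Longrightarrow> recfun n h \<Longrightarrow> recfun n k \<Longrightarrow> recfun n (\<lambda>xs. tmop (g xs) (h xs) (k xs))"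
  unfolding tmop_def by (intro rec)

lemma recfun_fmop [rec]: "recfun n g \<Longrightarrow> recfun n h \<Longrightarrow> recfun n k \<Longrightarrow> recfun n (\<lambda>xs. fmop (g xs) (h xs) (k xs))"
  unfolding fmop_def by (intro rec)

lemma recfun_fmeq [rec]: "recfun n g \<Longrightarrow> recfun n h \<Longrightarrow> recfun n (\<lambda>xs. fmeq (g xs) (h xs))"
  unfolding fmeq_def by (intro rec)

lemma recfun_flip [rec]: "recfun n g \<Longrightarrow> recfun n h \<Longrightarrow> recfun n (\<lambda>xs. flip (g xs) (h xs))"
  unfolding flip_def by (intro rec)

text \<open>The evaluating programs work in an environment \<open>[x, q]\<close>, where the input \<open>x\<close> codes the pair of a
  code \<open>c\<close> and a list of values for the variables, and \<open>q\<close> is the index of the program itself.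
  Then \<open>sub x i\<close> is the component \<open>i\<close> of \<open>c\<close>, and \<open>recall i\<close> the recursive call on it.\<close>

abbreviation sub :: "nat \<Rightarrow> nat \<Rightarrow> nat" where
  "sub x i \<equiv> proj (proj x 0) i"

definition recall :: "nat \<Rightarrow> recf" where
  "recall i = app (RProj 1) (pure 2 (\<lambda>xs. list_encode [sub (xs ! 0) i, proj (xs ! 0) 1]))"

lemma ev_recall:
  assumes "q \<in> arrow {list_encode [proj c i, L]} B"
  shows "ev (recall i) [list_encode [c, L], q] B"
  unfolding recall_def
proof (rule ev_app)
  show "ev (RProj 1) [list_encode [c, L], q] (arrow {list_encode [proj c i, L]} B)"
    using assms by (intro ev_var) auto
qed (auto intro!: ev_pure rec)

definition tmbody :: recf where
  "tmbody =
    ifp 2 (\<lambda>xs. clen (proj (xs ! 0) 0) = 2 \<and> sub (xs ! 0) 0 = 0)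
      (pure 2 (\<lambda>xs. if sub (xs ! 0) 1 < clen (proj (xs ! 0) 1) then Suc (proj (proj (xs ! 0) 1) (sub (xs ! 0) 1)) else 0))
   (ifp 2 (\<lambda>xs. clen (proj (xs ! 0) 0) = 1 \<and> sub (xs ! 0) 0 = 1) (pure 2 (\<lambda>_. 1))
   (ifp 2 (\<lambda>xs. clen (proj (xs ! 0) 0) = 2 \<and> sub (xs ! 0) 0 = 2)
      (letp 2 (recall 1) (pure 3 (\<lambda>xs. if xs ! 0 = 0 then 0 else Suc (xs ! 0))))
   (ifp 2 (\<lambda>xs. clen (proj (xs ! 0) 0) = 3 \<and> (sub (xs ! 0) 0 = 3 \<or> sub (xs ! 0) 0 = 4))
      (letp 2 (recall 1) (letp 3 (weaken 2 (recall 2)) (pure 4 (\<lambda>xs. tmop (sub (xs ! 2) 0) (xs ! 1) (xs ! 0)))))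
    RZero)))"

lemma tm_program: "fixcode tmbody \<in> arrow {list_encode [c, list_encode xs]} {tm_value c xs}"
proof (induction c rule: less_induct)
  case (less c)
  let ?x = "list_encode [c, list_encode xs]"
  define q where "q = fixcode tmbody"
  note IH = less.IH[folded q_def]
  have rec_IH: "ev (recall i) [?x, q] {tm_value (proj c i) xs}" if "i < clen c" for i
    using IH[OF proj_less[OF that]] by (rule ev_recall)
  have "ev tmbody [?x, q] {tm_value c xs}"
    unfolding tmbody_def
  proof (intro ev_if, goal_cases)
    case 3
    then show ?case by (intro ev_pure rec) (simp_all add: tm_value.simps[of c])
  next
    case 6
    then show ?case by (intro ev_pure rec) (simp_all add: tm_value.simps[of c])
  next
    case 9
    then show ?case
      by (intro ev_let[OF _ rec_IH] ev_pure rec) (simp_all add: tm_value.simps[of c])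
  next
    case 12
    then show ?case
      by (intro ev_let[OF _ rec_IH] ev_let[OF _ ev_weaken[OF _ rec_IH]] ev_pure rec) (simp_all add: tm_value.simps[of c])
  next
    case 13
    then show ?case by (intro ev_zero) (auto simp: tm_value.simps[of c])
  qed ((intro rec)?; simp)+
  then show ?case unfolding q_def by (intro fixcode) auto
qed


text \<open>The program for the maximum over the instances \<open>0, \<dots>, k\<close> of a quantified formula, where \<open>k\<close> is
  put in front of the environment.\<close>

definition quantp :: recf where
  "quantp = RPrec
    (bindp 2 (app (RProj 1) (pure 2 (\<lambda>xs. list_encode [sub (xs ! 0) 1, ccons 0 (proj (xs ! 0) 1)])))
      (retp (pure 3 (\<lambda>xs. flip (sub (xs ! 1) 0) (xs ! 0)))))
    (bindp 4 (RProj 1)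
      (bindp 5 (app (RProj 4)
          (pure 5 (\<lambda>xs. list_encode [sub (xs ! 3) 1, ccons (Suc (xs ! 1)) (proj (xs ! 3) 1)])))
        (retp (pure 6 (\<lambda>xs. max (xs ! 1) (flip (sub (xs ! 4) 0) (xs ! 0)))))))"

lemma recfun_max [rec]: "recfun n g \<Longrightarrow> recfun n h \<Longrightarrow> recfun n (\<lambda>xs. max (g xs) (h xs))"
  unfolding max_def by (intro rec)

lemma ev_quant:
  assumes "\<And>y. q \<in> arrow {list_encode [proj c 1, list_encode (y # xs)]} (J_op {h y})"
  shows "ev quantp [k, list_encode [c, list_encode xs], q]
    (J_op {Max ((\<lambda>y. flip (proj c 0) (h y)) ` {..k})})"
  unfolding quantp_def
proof (rule ev_prec[where P = "\<lambda>k. J_op {Max ((\<lambda>y. flip (proj c 0) (h y)) ` {..k})}"])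
  let ?x = "list_encode [c, list_encode xs]"
  show "ev (bindp 2 (app (RProj 1) (pure 2 (\<lambda>xs. list_encode [sub (xs ! 0) 1, ccons 0 (proj (xs ! 0) 1)])))
      (retp (pure 3 (\<lambda>xs. flip (sub (xs ! 1) 0) (xs ! 0))))) [?x, q]
      (J_op {Max ((\<lambda>y. flip (proj c 0) (h y)) ` {..0})})"
  proof (rule ev_bind, simp, rule ev_app)
    show "ev (RProj 1) [?x, q] (arrow {list_encode [proj c 1, list_encode (0 # xs)]} (J_op {h 0}))"
      using assms[of 0] by (intro ev_var) auto
  qed (intro ev_ret ev_pure rec; simp)+
  fix m r assume r: "r \<in> J_op {Max ((\<lambda>y. flip (proj c 0) (h y)) ` {..m})}"
  show "ev (bindp 4 (RProj 1)
      (bindp 5 (app (RProj 4)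
          (pure 5 (\<lambda>xs. list_encode [sub (xs ! 3) 1, ccons (Suc (xs ! 1)) (proj (xs ! 3) 1)])))
        (retp (pure 6 (\<lambda>xs. max (xs ! 1) (flip (sub (xs ! 4) 0) (xs ! 0))))))) [m, r, ?x, q]
      (J_op {Max ((\<lambda>y. flip (proj c 0) (h y)) ` {..Suc m})})"
  proof (rule ev_bind)
    show "ev (RProj 1) [m, r, ?x, q] (J_op {Max ((\<lambda>y. flip (proj c 0) (h y)) ` {..m})})"
      using r by (intro ev_var) auto
    fix s assume s: "s \<in> {Max ((\<lambda>y. flip (proj c 0) (h y)) ` {..m})}"
    show "ev (bindp 5 (app (RProj 4)
          (pure 5 (\<lambda>xs. list_encode [sub (xs ! 3) 1, ccons (Suc (xs ! 1)) (proj (xs ! 3) 1)])))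
        (retp (pure 6 (\<lambda>xs. max (xs ! 1) (flip (sub (xs ! 4) 0) (xs ! 0)))))) [s, m, r, ?x, q]
        (J_op {Max ((\<lambda>y. flip (proj c 0) (h y)) ` {..Suc m})})"
    proof (rule ev_bind, simp, rule ev_app)
      show "ev (RProj 4) [s, m, r, ?x, q]
          (arrow {list_encode [proj c 1, list_encode (Suc m # xs)]} (J_op {h (Suc m)}))"
        using assms[of "Suc m"] by (intro ev_var) auto
      show "ev (retp (pure 6 (\<lambda>xs. max (xs ! 1) (flip (sub (xs ! 4) 0) (xs ! 0))))) [v, s, m, r, ?x, q]
          (J_op {Max ((\<lambda>y. flip (proj c 0) (h y)) ` {..Suc m})})" if "v \<in> {h (Suc m)}" for v
        using s that by (intro ev_ret ev_pure rec) (auto simp: atMost_Suc max.commute)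
    qed (intro ev_pure rec; simp)
  qed simp
qed

lemma eventually_Max_range:
  fixes h :: "nat \<Rightarrow> nat"
  assumes "\<And>x. h x \<le> b"
  shows "\<exists>N. \<forall>k\<ge>N. Max (h ` {..k}) = Max (range h)"
proof -
  have fin: "finite (range h)" using assms by (rule finite_bounded_range)
  then have "Max (range h) \<in> range h" by (intro Max_in) auto
  then obtain N where N: "h N = Max (range h)" by auto
  have "Max (h ` {..k}) = Max (range h)" if "N \<le> k" for k
    by (rule Max_eqI) (use that N fin in \<open>auto intro: rev_image_eqI\<close>)
  then show ?thesis by blast
qed

definition evalterm :: "nat \<Rightarrow> recf" where
  "evalterm i = app (constp (fixcode tmbody)) (pure 2 (\<lambda>xs. list_encode [sub (xs ! 0) i, proj (xs ! 0) 1]))"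

lemma ev_evalterm: "ev (evalterm i) [list_encode [c, list_encode xs], q] {tm_value (proj c i) xs}"
  unfolding evalterm_def
proof (rule ev_app)
  show "ev (constp (fixcode tmbody)) [list_encode [c, list_encode xs], q]
      (arrow {list_encode [proj c i, list_encode xs]} {tm_value (proj c i) xs})"
    by (rule ev_constp[OF tm_program])
qed (auto intro!: ev_pure rec)

definition fmbody :: recf where
  "fmbody =
    ifp 2 (\<lambda>xs. clen (proj (xs ! 0) 0) = 1 \<and> sub (xs ! 0) 0 = 0) (retp RZero)
   (ifp 2 (\<lambda>xs. clen (proj (xs ! 0) 0) = 3 \<and> sub (xs ! 0) 0 = 1)
      (letp 2 (evalterm 1) (letp 3 (weaken 2 (evalterm 2)) (retp (pure 4 (\<lambda>xs. fmeq (xs ! 1) (xs ! 0))))))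
   (ifp 2 (\<lambda>xs. clen (proj (xs ! 0) 0) = 3 \<and> 2 \<le> sub (xs ! 0) 0 \<and> sub (xs ! 0) 0 \<le> 4)
      (bindp 2 (recall 1) (bindp 3 (weaken 2 (recall 2))
        (retp (pure 4 (\<lambda>xs. fmop (sub (xs ! 2) 0) (xs ! 1) (xs ! 0))))))
   (ifp 2 (\<lambda>xs. clen (proj (xs ! 0) 0) = 2 \<and> 5 \<le> sub (xs ! 0) 0 \<and> sub (xs ! 0) 0 \<le> 6)
      (bindp 2 (limp 2 quantp) (retp (pure 3 (\<lambda>xs. flip (sub (xs ! 1) 0) (xs ! 0)))))
    (retp (constp 2)))))"

text \<open>The maxima over initial segments are increasing and bounded by \<open>2\<close>, hence eventually equal to
  the value of the quantified formula, which is thus obtained as a limit.\<close>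

lemma fm_program: "fixcode fmbody \<in> arrow {list_encode [c, list_encode xs]} (J_op {fm_value c xs})"
proof (induction c arbitrary: xs rule: less_induct)
  case (less c)
  let ?x = "list_encode [c, list_encode xs]"
  define q where "q = fixcode fmbody"
  note IH = less.IH[folded q_def]
  have rec_IH: "ev (recall i) [?x, q] (J_op {fm_value (proj c i) xs})" if "i < clen c" for i
    using IH[OF proj_less[OF that]] by (rule ev_recall)
  have "ev fmbody [?x, q] (J_op {fm_value c xs})"
    unfolding fmbody_def
  proof (intro ev_if, goal_cases)
    case 3
    then show ?case by (intro ev_ret ev_zero) (simp_all add: fm_value.simps[of c])
  next
    case 6
    then show ?case
      by (intro ev_let[OF _ ev_evalterm] ev_let[OF _ ev_weaken[OF _ ev_evalterm]] ev_ret ev_pure rec)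
         (simp_all add: fm_value.simps[of c])
  next
    case 9
    then show ?case
      by (intro ev_bind[OF _ rec_IH] ev_bind[OF _ ev_weaken[OF _ rec_IH]] ev_ret ev_pure rec)
         (simp_all add: fm_value.simps[of c])
  next
    case 12
    then have c: "clen c = 2" by simp
    let ?h = "\<lambda>y. flip (proj c 0) (fm_value (proj c 1) (y # xs))"
    have "?h y \<le> 2" for y using fm_value_le[of "proj c 1" "y # xs"] by (auto simp: flip_def)
    then obtain N where N: "\<And>k. k \<ge> N \<Longrightarrow> Max (?h ` {..k}) = Max (range ?h)"
      using eventually_Max_range[of ?h 2] by blast
    have "q \<in> arrow {list_encode [proj c 1, list_encode (y # xs)]} (J_op {fm_value (proj c 1) (y # xs)})" for y
      by (rule IH) (use c in \<open>auto intro: proj_less\<close>)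
    then have *: "ev quantp [k, ?x, q] (J_op {Max (?h ` {..k})})" for k by (rule ev_quant)
    have "ev (limp 2 quantp) [?x, q] (J_op {Max (range ?h)})"
    proof (rule ev_lim)
      fix k assume "N \<le> k"
      then show "ev quantp [k, ?x, q] (J_op {Max (range ?h)})" using *[of k] N[of k] by simp
    qed simp
    then show ?case
    proof (rule ev_bind[rotated])
      fix a assume "a \<in> {Max (range ?h)}"
      then show "ev (retp (pure 3 (\<lambda>xs. flip (sub (xs ! 1) 0) (xs ! 0)))) [a, ?x, q] (J_op {fm_value c xs})"
        using 12 by (intro ev_ret ev_pure rec) (simp_all add: fm_value.simps[of c])
    qed simp
  next
    case 13
    then show ?case by (intro ev_ret ev_constp) (auto simp: fm_value.simps[of c])
  qed ((intro rec)?; simp)+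
  then show ?case unfolding q_def by (intro fixcode) auto
qed

definition satp :: "nat \<Rightarrow> fm \<Rightarrow> recf" where
  "satp n \<phi> = app (constp (fixcode fmbody))
    (pure n (\<lambda>xs. list_encode [fm_code \<phi>, list_encode xs]))"

lemma ev_sat:
  assumes "fm_in n \<phi>" "length xs = n"
  shows "ev (satp n \<phi>) xs (J_op {of_bool (sat std_nat \<phi> xs)})"
  unfolding satp_def
proof (rule ev_app)
  show "ev (constp (fixcode fmbody)) xs
      (arrow {list_encode [fm_code \<phi>, list_encode xs]} (J_op {of_bool (sat std_nat \<phi> xs)}))"
    using fm_program[of "fm_code \<phi>" xs] assms by (intro ev_constp) (simp add: fm_value_fm_code)
  show "ev (pure n (\<lambda>xs. list_encode [fm_code \<phi>, list_encode xs]))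
      xs {list_encode [fm_code \<phi>, list_encode xs]}"
    using assms(2) by (intro ev_pure recfun_list_encode2 recfun_encode_env recfun_const) auto
qed

lemma representsI: "(\<And>n. ev f [n] (J_op {g n})) \<Longrightarrow> represents (closure f []) g"
  using closure_arrow[of "{n}" f "[]" "J_op {g n}" for n] by (auto simp: represents_def arrow_def)

lemma truth_representable: "\<exists>r. represents r truth"
proof
  let ?f = "bindp 1 (app (constp (fixcode fmbody)) (pure 1 (\<lambda>xs. list_encode [xs ! 0, list_encode []])))
    (retp (pure 2 (\<lambda>xs. of_bool (xs ! 0 = 1))))"
  show "represents (closure ?f []) truth"
  proof (rule representsI, rule ev_bind, simp, rule ev_app)
    fix c
    show "ev (constp (fixcode fmbody)) [c] (arrow {list_encode [c, list_encode []]} (J_op {fm_value c []}))"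
      by (rule ev_constp[OF fm_program])
    show "ev (pure 1 (\<lambda>xs. list_encode [xs ! 0, list_encode []])) [c] {list_encode [c, list_encode []]}"
      by (intro ev_pure rec) auto
    show "ev (retp (pure 2 (\<lambda>xs. of_bool (xs ! 0 = 1)))) [v, c] (J_op {truth c})" if "v \<in> {fm_value c []}" for v
      using that by (intro ev_ret ev_pure rec) (auto simp: truth_eq_fm_value)
  qed
qed

lemma recursive_in_truth_representable:
  assumes "recursive_in truth 1 (\<lambda>xs. h (xs ! 0))"
  shows "\<exists>r. represents r h"
proof -
  obtain f where f: "\<And>xs. length xs = 1 \<Longrightarrow> computes (\<lambda>x. Some (truth x)) f xs (h (xs ! 0))"
    using assms unfolding recursive_in_def by blast
  obtain r where "represents r truth" using truth_representable by blast
  from representable_recursive_in[OF this, of 1 f] obtain p where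
    p: "\<And>xs y. length xs = 1 \<Longrightarrow> computes (\<lambda>x. Some (truth x)) f xs y \<Longrightarrow> ev p xs (J_op {y})"
    by blast
  have "represents (closure p []) h"
    by (rule representsI) (use p f[of "[_]"] in simp)
  then show ?thesis by blast
qed


section \<open>Definable relations\<close>

primrec rename_tm :: "(nat \<Rightarrow> nat) \<Rightarrow> tm \<Rightarrow> tm" where
  "rename_tm r (TVar i) = TVar (r i)"
| "rename_tm r TZero = TZero"
| "rename_tm r (TSucc t) = TSucc (rename_tm r t)"
| "rename_tm r (TAdd t s) = TAdd (rename_tm r t) (rename_tm r s)"
| "rename_tm r (TMul t s) = TMul (rename_tm r t) (rename_tm r s)"

definition lift :: "(nat \<Rightarrow> nat) \<Rightarrow> nat \<Rightarrow> nat" where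
  "lift r i = (case i of 0 \<Rightarrow> 0 | Suc j \<Rightarrow> Suc (r j))"

primrec rename_fm :: "(nat \<Rightarrow> nat) \<Rightarrow> fm \<Rightarrow> fm" where
  "rename_fm r FBot = FBot"
| "rename_fm r (FEq t s) = FEq (rename_tm r t) (rename_tm r s)"
| "rename_fm r (FAnd \<phi> \<chi>) = FAnd (rename_fm r \<phi>) (rename_fm r \<chi>)"
| "rename_fm r (FOr \<phi> \<chi>) = FOr (rename_fm r \<phi>) (rename_fm r \<chi>)"
| "rename_fm r (FImp \<phi> \<chi>) = FImp (rename_fm r \<phi>) (rename_fm r \<chi>)"
| "rename_fm r (FEx \<phi>) = FEx (rename_fm (lift r) \<phi>)"
| "rename_fm r (FAll \<phi>) = FAll (rename_fm (lift r) \<phi>)"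

definition renames :: "(nat \<Rightarrow> nat) \<Rightarrow> 'a list \<Rightarrow> 'a list \<Rightarrow> bool" where
  "renames r xs ys \<longleftrightarrow> (\<forall>i < length xs. r i < length ys \<and> ys ! r i = xs ! i)"

lemma rename_tm: "renames r xs ys \<Longrightarrow> tm_in (length xs) t \<Longrightarrow>
    tm_in (length ys) (rename_tm r t) \<and> tm_val M ys (rename_tm r t) = tm_val M xs t"
  by (induction t) (auto simp: renames_def)

lemma renames_lift: "renames r xs ys \<Longrightarrow> renames (lift r) (a # xs) (a # ys)"
  by (auto simp: renames_def lift_def split: nat.split)

lemma rename_fm: "renames r xs ys \<Longrightarrow> fm_in (length xs) \<phi> \<Longrightarrow>
    fm_in (length ys) (rename_fm r \<phi>) \<and> sat M (rename_fm r \<phi>) ys = sat M \<phi> xs"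
proof (induction \<phi> arbitrary: r xs ys)
  case (FEq t s)
  then show ?case using rename_tm[of r xs ys t M] rename_tm[of r xs ys s M] by auto
next
  case (FEx \<phi>)
  have "fm_in (length (a # ys)) (rename_fm (lift r) \<phi>) \<and>
      sat M (rename_fm (lift r) \<phi>) (a # ys) = sat M \<phi> (a # xs)" for a
    using FEx.IH[OF renames_lift[OF FEx.prems(1), of a]] FEx.prems(2) by simp
  then show ?case by simp
next
  case (FAll \<phi>)
  have "fm_in (length (a # ys)) (rename_fm (lift r) \<phi>) \<and>
      sat M (rename_fm (lift r) \<phi>) (a # ys) = sat M \<phi> (a # xs)" for a
    using FAll.IH[OF renames_lift[OF FAll.prems(1), of a]] FAll.prems(2) by simp
  then show ?case by simp
next
  case (FAnd \<phi> \<chi>)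
  then show ?case using FAnd.IH(1)[of r xs ys] FAnd.IH(2)[of r xs ys] by simp
next
  case (FOr \<phi> \<chi>)
  then show ?case using FOr.IH(1)[of r xs ys] FOr.IH(2)[of r xs ys] by simp
next
  case (FImp \<phi> \<chi>)
  then show ?case using FImp.IH(1)[of r xs ys] FImp.IH(2)[of r xs ys] by simp
qed simp

definition definable :: "nat \<Rightarrow> (nat list \<Rightarrow> bool) \<Rightarrow> bool" where
  "definable n P \<longleftrightarrow> (\<exists>\<phi>. fm_in n \<phi> \<and> (\<forall>xs. length xs = n \<longrightarrow> P xs = sat std_nat \<phi> xs))"

lemma definable_sat: "fm_in n \<phi> \<Longrightarrow> definable n (sat std_nat \<phi>)"
  unfolding definable_def by blast

lemma definable_cong: "definable n P \<Longrightarrow> (\<And>xs. length xs = n \<Longrightarrow> P xs = Q xs) \<Longrightarrow> definable n Q"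
  unfolding definable_def by metis

lemma definable_eq: "tm_in n t \<Longrightarrow> tm_in n s \<Longrightarrow> definable n (\<lambda>xs. tm_val std_nat xs t = tm_val std_nat xs s)"
  unfolding definable_def by (intro exI[of _ "FEq t s"]) auto

lemma definable_conj: "definable n P \<Longrightarrow> definable n Q \<Longrightarrow> definable n (\<lambda>xs. P xs \<and> Q xs)"
  unfolding definable_def by (metis fm_in.simps(3) sat.simps(3))

lemma definable_disj: "definable n P \<Longrightarrow> definable n Q \<Longrightarrow> definable n (\<lambda>xs. P xs \<or> Q xs)"
  unfolding definable_def by (metis fm_in.simps(4) sat.simps(4))

lemma definable_not: "definable n P \<Longrightarrow> definable n (\<lambda>xs. \<not> P xs)"
  unfolding definable_def by (metis fm_in.simps(1,5) sat.simps(1,5))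

lemma definable_ex:
  assumes "definable (Suc n) P" shows "definable n (\<lambda>xs. \<exists>a. P (a # xs))"
proof -
  obtain \<phi> where "fm_in (Suc n) \<phi>" "\<And>xs. length xs = Suc n \<Longrightarrow> P xs = sat std_nat \<phi> xs"
    using assms unfolding definable_def by blast
  then show ?thesis unfolding definable_def by (intro exI[of _ "FEx \<phi>"]) (auto simp: std_nat_def)
qed

lemma definable_rename:
  assumes "definable (length js) P" "\<And>j. j \<in> set js \<Longrightarrow> j < n"
  shows "definable n (\<lambda>xs. P (map ((!) xs) js))"
proof -
  obtain \<phi> where \<phi>: "fm_in (length js) \<phi>" "\<And>xs. length xs = length js \<Longrightarrow> P xs = sat std_nat \<phi> xs"
    using assms(1) unfolding definable_def by blast
  have *: "renames ((!) js) (map ((!) xs) js) xs" if "length xs = n" for xs :: "nat list"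
    using that assms(2) by (simp add: renames_def)
  show ?thesis
    unfolding definable_def
  proof (intro exI[of _ "rename_fm ((!) js) \<phi>"] conjI allI impI)
    show "fm_in n (rename_fm ((!) js) \<phi>)"
      using rename_fm[OF *[of "replicate n 0"], of \<phi> std_nat] \<phi>(1) by simp
    show "P (map ((!) xs) js) = sat std_nat (rename_fm ((!) js) \<phi>) xs" if "length xs = n" for xs
      using rename_fm[OF *[OF that], of \<phi> std_nat] \<phi> by simp
  qed
qed

lemma arithmetical_iff: "arithmetical f \<longleftrightarrow> definable 2 (\<lambda>xs. f (xs ! 0) = xs ! 1)"
proof -
  have len2: "length xs = 2 \<longleftrightarrow> (\<exists>x y. xs = [x, y])" for xs :: "nat list"
    by (auto simp: numeral_2_eq_2 length_Suc_conv)
  have "(\<forall>xs. length xs = 2 \<longrightarrow> Q xs) \<longleftrightarrow> (\<forall>x y. Q [x, y])" for Q :: "nat list \<Rightarrow> bool"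
    unfolding len2 by blast
  then show ?thesis unfolding arithmetical_def definable_def by simp
qed

lemma definable_subst1:
  assumes "definable (Suc n) P" "arithmetical f" "i < n"
  shows "definable n (\<lambda>xs. P (f (xs ! i) # xs))"
proof -
  have "definable (Suc n) (\<lambda>ys. f (map ((!) ys) [Suc i, 0] ! 0) = map ((!) ys) [Suc i, 0] ! 1)"
    by (rule definable_rename[where P = "\<lambda>xs. f (xs ! 0) = xs ! 1"])
       (use assms(2,3) in \<open>auto simp: arithmetical_iff numeral_2_eq_2\<close>)
  from definable_ex[OF definable_conj[OF this assms(1)]] show ?thesis by simp
qed

abbreviation at :: "(nat \<Rightarrow> nat) list \<Rightarrow> nat \<Rightarrow> nat list" where
  "at \<alpha>s k \<equiv> map (\<lambda>\<alpha>. \<alpha> k) \<alpha>s"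

lemma definable_subst:
  assumes "definable (length \<alpha>s + n) P" "\<forall>\<alpha>\<in>set \<alpha>s. arithmetical \<alpha>" "i < n"
  shows "definable n (\<lambda>xs. P (at \<alpha>s (xs ! i) @ xs))"
  using assms(1,2)
proof (induction \<alpha>s arbitrary: P)
  case (Cons \<alpha> \<alpha>s)
  have "definable (length \<alpha>s + n) (\<lambda>ys. P (\<alpha> (ys ! (length \<alpha>s + i)) # ys))"
    using Cons.prems assms(3) by (intro definable_subst1) auto
  from Cons.IH[OF this] Cons.prems(2) show ?case by (simp add: nth_append)
qed simp

text \<open>With \<open>m = 0\<close> this gives the properties along given arithmetical functions, with \<open>m = 1\<close> the
  relations whose least solutions serve as witnesses.\<close>

lemma definable_at:
  assumes "definable (m + length \<alpha>s) P" "\<forall>\<alpha>\<in>set \<alpha>s. arithmetical \<alpha>"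
  shows "definable (Suc m) (\<lambda>xs. P (take m xs @ at \<alpha>s (xs ! m)))"
proof -
  let ?n = "length \<alpha>s"
  let ?js = "[?n..<?n + m] @ [0..<?n]"
  have "definable (?n + Suc m) (\<lambda>ys. P (map ((!) ys) ?js))"
    by (rule definable_rename) (use assms(1) in \<open>auto simp: add.commute\<close>)
  from definable_subst[OF this assms(2), of m]
  have "definable (Suc m) (\<lambda>xs. P (map ((!) (at \<alpha>s (xs ! m) @ xs)) ?js))" by simp
  then show ?thesis
  proof (rule definable_cong)
    fix xs :: "nat list" assume "length xs = Suc m"
    then have "map ((!) (at \<alpha>s (xs ! m) @ xs)) ?js = take m xs @ at \<alpha>s (xs ! m)"
      by (intro nth_equalityI) (auto simp: nth_append)
    then show "P (map ((!) (at \<alpha>s (xs ! m) @ xs)) ?js) = P (take m xs @ at \<alpha>s (xs ! m))" by simp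
  qed
qed

lemma definable_at0:
  assumes "definable (length \<alpha>s) P" "\<forall>\<alpha>\<in>set \<alpha>s. arithmetical \<alpha>"
  shows "definable 1 (\<lambda>xs. P (at \<alpha>s (xs ! 0)))"
  using definable_at[of 0 \<alpha>s P] assms by simp

lemma definable_less: "i < n \<Longrightarrow> j < n \<Longrightarrow> definable n (\<lambda>xs. xs ! i < xs ! j)"
  using definable_ex[OF definable_eq[of "Suc n" "TAdd (TVar (Suc i)) (TSucc (TVar 0))" "TVar (Suc j)"]]
  by (simp add: std_nat_def less_iff_Suc_add eq_commute)

lemma definable_rename1:
  "definable 1 (\<lambda>xs. P (xs ! 0)) \<Longrightarrow> i < n \<Longrightarrow> definable n (\<lambda>xs. P (xs ! i))"
  using definable_rename[of "[i]" "\<lambda>xs. P (xs ! 0)" n] by simp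

lemma definable_rename2:
  "definable 2 (\<lambda>xs. P (xs ! 0) (xs ! 1)) \<Longrightarrow> i < n \<Longrightarrow> j < n \<Longrightarrow> definable n (\<lambda>xs. P (xs ! i) (xs ! j))"
  using definable_rename[of "[i, j]" "\<lambda>xs. P (xs ! 0) (xs ! 1)" n] by (auto simp: numeral_2_eq_2)

lemma definable_zero: "i < n \<Longrightarrow> definable n (\<lambda>xs. xs ! i = 0)"
  using definable_eq[of n "TVar i" TZero] by (simp add: std_nat_def)

lemma arithmetical_of_bool:
  assumes "definable 1 (\<lambda>xs. P (xs ! 0))" shows "arithmetical (\<lambda>k. of_bool (P k))"
proof -
  have "definable 2 (\<lambda>xs. (P (xs ! 0) \<and> xs ! 1 = 1) \<or> (\<not> P (xs ! 0) \<and> xs ! 1 = 0))"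
    using definable_rename1[OF assms, of 0 2] definable_eq[of 2 "TVar 1" "TSucc TZero"] definable_zero[of 1 2]
    by (intro definable_disj definable_conj definable_not) (simp_all add: std_nat_def)
  then show ?thesis
    unfolding arithmetical_iff by (rule definable_cong) auto
qed

text \<open>The default value makes the function that returns the least witness total.\<close>

definition least :: "(nat \<Rightarrow> bool) \<Rightarrow> nat" where
  "least P = (if \<exists>a. P a then LEAST a. P a else 0)"

lemma least: "P a \<Longrightarrow> P (least P)"
  unfolding least_def by (auto intro: LeastI)

lemma arithmetical_least:
  assumes "definable 2 (\<lambda>xs. R (xs ! 0) (xs ! 1))" shows "arithmetical (\<lambda>k. least (\<lambda>a. R a k))"
proof -
  \<comment> \<open>The environment \<open>xs\<close> is \<open>[k, y]\<close>, and \<open>y\<close> is to be the least solution.\<close>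
  have below: "definable 2 (\<lambda>xs. \<exists>z. (z # xs) ! 0 < (z # xs) ! 2 \<and> R ((z # xs) ! 0) ((z # xs) ! 1))"
    by (intro definable_ex definable_conj definable_less definable_rename2[OF assms]) auto
  have "definable 2 (\<lambda>xs. \<exists>z. R ((z # xs) ! 0) ((z # xs) ! 1))"
    by (intro definable_ex definable_rename2[OF assms]) auto
  then have "definable 2 (\<lambda>xs. (R (xs ! 1) (xs ! 0) \<and>
      \<not> (\<exists>z. (z # xs) ! 0 < (z # xs) ! 2 \<and> R ((z # xs) ! 0) ((z # xs) ! 1))) \<or>
      (\<not> (\<exists>z. R ((z # xs) ! 0) ((z # xs) ! 1)) \<and> xs ! 1 = 0))"
    using below by (intro definable_disj definable_conj definable_not definable_rename2[OF assms] definable_zero) auto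
  then show ?thesis
    unfolding arithmetical_iff
  proof (rule definable_cong)
    fix xs :: "nat list" assume "length xs = 2"
    then obtain k y where xs: "xs = [k, y]" by (auto simp: numeral_2_eq_2 length_Suc_conv)
    have "least (\<lambda>a. R a k) = y \<longleftrightarrow> R y k \<and> \<not> (\<exists>z<y. R z k) \<or> \<not> (\<exists>z. R z k) \<and> y = 0"
    proof (cases "\<exists>z. R z k")
      case True
      then have "R (least (\<lambda>a. R a k)) k" by (metis least)
      moreover have "\<not> R z k" if "z < least (\<lambda>a. R a k)" for z
        using that True by (auto simp: least_def dest: not_less_Least)
      ultimately show ?thesis using True by (metis nat_neq_iff)
    qed (auto simp: least_def)
    then show "((R (xs ! 1) (xs ! 0) \<and>
        \<not> (\<exists>z. (z # xs) ! 0 < (z # xs) ! 2 \<and> R ((z # xs) ! 0) ((z # xs) ! 1))) \<or>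
        (\<not> (\<exists>z. R ((z # xs) ! 0) ((z # xs) ! 1)) \<and> xs ! 1 = 0)) =
        (least (\<lambda>a. R a (xs ! 0)) = xs ! 1)"
      by (auto simp: xs)
  qed
qed

lemma tm_in_mono: "tm_in n t \<Longrightarrow> n \<le> m \<Longrightarrow> tm_in m t"
  by (induction t) auto

lemma tm_val_append: "tm_in (length xs) t \<Longrightarrow> tm_val M (xs @ ys) t = tm_val M xs t"
  by (induction t) (auto simp: nth_append)

lemma arithmetical_tm:
  assumes "tm_in (length \<alpha>s) t" "\<forall>\<alpha>\<in>set \<alpha>s. arithmetical \<alpha>"
  shows "arithmetical (\<lambda>k. tm_val std_nat (at \<alpha>s k) t)"
proof -
  let ?n = "length \<alpha>s"
  have "definable (?n + 2) (\<lambda>xs. tm_val std_nat xs t = tm_val std_nat xs (TVar (Suc ?n)))"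
    using assms(1) by (intro definable_eq) (auto intro: tm_in_mono)
  from definable_subst[OF this assms(2), of 0]
  have "definable 2 (\<lambda>xs. tm_val std_nat (at \<alpha>s (xs ! 0) @ xs) t = xs ! 1)"
    by (auto simp: nth_append elim: definable_cong)
  then show ?thesis
    unfolding arithmetical_iff using assms(1) by (simp add: tm_val_append)
qed

lemma arithmetical_const: "arithmetical (\<lambda>_. c)"
proof -
  have "tm_val std_nat [] ((TSucc ^^ c) TZero) = c \<and> tm_in 0 ((TSucc ^^ c) TZero)"
    by (induction c) (auto simp: std_nat_def)
  then show ?thesis using arithmetical_tm[of "[]" "(TSucc ^^ c) TZero"] by simp
qed

lemma arithmetical_Suc: "arithmetical f \<Longrightarrow> arithmetical (\<lambda>k. Suc (f k))"
  using arithmetical_tm[of "[f]" "TSucc (TVar 0)"] by (simp add: std_nat_def)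

lemma arithmetical_add: "arithmetical f \<Longrightarrow> arithmetical g \<Longrightarrow> arithmetical (\<lambda>k. f k + g k)"
  using arithmetical_tm[of "[f, g]" "TAdd (TVar 0) (TVar 1)"] by (simp add: std_nat_def)

lemma arithmetical_mult: "arithmetical f \<Longrightarrow> arithmetical g \<Longrightarrow> arithmetical (\<lambda>k. f k * g k)"
  using arithmetical_tm[of "[f, g]" "TMul (TVar 0) (TVar 1)"] by (simp add: std_nat_def)


section \<open>The sequence decides arithmetical properties\<close>

definition comparable_on :: "nat set \<Rightarrow> (nat \<Rightarrow> nat) \<Rightarrow> (nat \<Rightarrow> nat) \<Rightarrow> bool" where
  "comparable_on A f g \<longleftrightarrow> (\<forall>x\<in>A. f x < g x) \<or> (\<forall>x\<in>A. f x = g x) \<or> (\<forall>x\<in>A. g x < f x)"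

lemma comparable_on_subset: "comparable_on A f g \<Longrightarrow> B \<subseteq> A \<Longrightarrow> comparable_on B f g"
  unfolding comparable_on_def by blast

lemma comparable_on_sym: "comparable_on A f g \<Longrightarrow> comparable_on A g f"
  unfolding comparable_on_def by metis

text \<open>Comparable functions are ordered on \<open>A\<close> as their values at a single point \<open>a\<close> are, so sorting
  these values yields the one list that satisfies the description.\<close>

lemma ordered_restrictions:
  assumes a: "a \<in> A" and cmp: "\<And>i j. i \<le> k \<Longrightarrow> j \<le> k \<Longrightarrow> comparable_on A (\<alpha> i) (\<alpha> j)"
  defines "\<beta>s \<equiv> ordered_restrictions \<alpha> k A"
  shows "sorted_wrt (\<lambda>f g. \<forall>x\<in>A. f x < g x) \<beta>s" "set \<beta>s = (\<lambda>i. restrict (\<alpha> i) A) ` {..k}"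
proof -
  define S where "S = (\<lambda>i. restrict (\<alpha> i) A) ` {..k}"
  have less: "\<forall>x\<in>A. f x < g x" if "f \<in> S" "g \<in> S" "f a < g a" for f g
    using that a cmp unfolding S_def comparable_on_def by fastforce
  have inj: "inj_on (\<lambda>f. f a) S"
  proof (rule inj_onI)
    fix f g assume fg: "f \<in> S" "g \<in> S" "f a = g a"
    then obtain i j where ij: "i \<le> k" "j \<le> k" "f = restrict (\<alpha> i) A" "g = restrict (\<alpha> j) A"
      unfolding S_def by blast
    then have "\<forall>x\<in>A. \<alpha> i x = \<alpha> j x"
      using cmp[of i j] fg(3) a unfolding comparable_on_def by fastforce
    then show "f = g" using ij by (auto simp: restrict_def)
  qed
  let ?P = "\<lambda>\<beta>s. sorted_wrt (\<lambda>f g. \<forall>x\<in>A. f x < g x) \<beta>s \<and> set \<beta>s = S"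
  let ?v = "sorted_list_of_set ((\<lambda>f. f a) ` S)"
  have fin: "finite S" unfolding S_def by simp
  have "\<exists>!\<beta>s. ?P \<beta>s"
  proof
    let ?inv = "inv_into S (\<lambda>f. f a)"
    have inv: "?inv y \<in> S" "?inv y a = y" if "y \<in> (\<lambda>f. f a) ` S" for y
      using inv_into_into[OF that] f_inv_into_f[OF that] by auto
    have "sorted_wrt (<) ?v" by (rule strict_sorted_list_of_set)
    then have "sorted_wrt (\<lambda>f g. \<forall>x\<in>A. f x < g x) (map ?inv ?v)"
      unfolding sorted_wrt_map
      by (rule sorted_wrt_mono_rel[rotated]) (use fin inv less in auto)
    moreover have "set (map ?inv ?v) = S"
      using fin inv_into_f_f[OF inj] by (simp add: image_image)
    ultimately show "?P (map ?inv ?v)" by blast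
    fix \<beta>s assume P: "?P \<beta>s"
    have "map (\<lambda>f. f a) \<beta>s = ?v"
    proof (rule sorted_distinct_set_unique)
      have "sorted_wrt (<) (map (\<lambda>f. f a) \<beta>s)"
        unfolding sorted_wrt_map using P a by (auto elim: sorted_wrt_mono_rel[rotated])
      then show "sorted (map (\<lambda>f. f a) \<beta>s)" "distinct (map (\<lambda>f. f a) \<beta>s)"
        by (simp_all add: strict_sorted_iff)
    qed (use P fin in auto)
    then show "\<beta>s = map ?inv ?v"
      using P inj by (metis (no_types, lifting) inv_into_f_f list.map_comp comp_apply map_idI)
  qed
  then have "?P (THE \<beta>s. ?P \<beta>s)" by (rule theI')
  then show "sorted_wrt (\<lambda>f g. \<forall>x\<in>A. f x < g x) \<beta>s" "set \<beta>s = (\<lambda>i. restrict (\<alpha> i) A) ` {..k}"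
    unfolding \<beta>s_def ordered_restrictions_def S_def by blast+
qed

lemma Union_cells: "\<Union>(set (cells A \<gamma> \<beta>s)) = A"
proof (induction \<beta>s arbitrary: A)
  case (Cons \<beta> \<beta>s)
  show ?case by (auto simp: Cons)
qed simp

text \<open>On a cell, \<open>\<gamma>\<close> is at most equal to some \<open>\<beta>\<^sub>i\<close> and thereby below all later ones, or it exceeds
  them all; it exceeds the earlier ones in any case.\<close>

lemma comparable_on_cells:
  assumes "sorted_wrt (\<lambda>f g. \<forall>x\<in>A. f x < g x) \<beta>s" "B \<in> set (cells A \<gamma> \<beta>s)" "\<beta> \<in> set \<beta>s"
  shows "comparable_on B \<gamma> \<beta>"
  using assms
proof (induction \<beta>s arbitrary: A)
  case (Cons \<delta> \<beta>s)
  show ?case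
  proof (cases "B \<in> set (cells {x \<in> A. \<delta> x < \<gamma> x} \<gamma> \<beta>s)")
    case True
    then have B: "B \<subseteq> {x \<in> A. \<delta> x < \<gamma> x}"
      using Union_upper Union_cells[of "{x \<in> A. \<delta> x < \<gamma> x}" \<gamma> \<beta>s] by metis
    show ?thesis
    proof (cases "\<beta> = \<delta>")
      case False
      moreover have "sorted_wrt (\<lambda>f g. \<forall>x\<in>{x \<in> A. \<delta> x < \<gamma> x}. f x < g x) \<beta>s"
        using Cons.prems(1) by (auto elim: sorted_wrt_mono_rel[rotated])
      ultimately show ?thesis using Cons.IH[OF _ True] Cons.prems(3) by simp
    qed (use B in \<open>auto simp: comparable_on_def\<close>)
  next
    case False
    then have "B = {x \<in> A. \<gamma> x < \<delta> x} \<or> B = {x \<in> A. \<gamma> x = \<delta> x}" using Cons.prems(2) by auto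
    moreover have "\<beta> = \<delta> \<or> (\<forall>x\<in>A. \<delta> x < \<beta> x)" using Cons.prems(1,3) by auto
    ultimately show ?thesis unfolding comparable_on_def by fastforce
  qed
qed simp

text \<open>Finitely many cells cover an infinite set, so one of them is infinite.\<close>

lemma A_seq_invariant:
  "infinite (A_seq \<alpha> k) \<and> (\<forall>i\<le>k. \<forall>j\<le>k. comparable_on (A_seq \<alpha> k) (\<alpha> i) (\<alpha> j))"
  "A_seq \<alpha> (Suc k) \<subseteq> A_seq \<alpha> k"
proof -
  have step: "infinite (A_seq \<alpha> (Suc k)) \<and> A_seq \<alpha> (Suc k) \<subseteq> A_seq \<alpha> k \<and>
      (\<forall>i\<le>Suc k. \<forall>j\<le>Suc k. comparable_on (A_seq \<alpha> (Suc k)) (\<alpha> i) (\<alpha> j))"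
    if IH: "infinite (A_seq \<alpha> k)" "\<And>i j. i \<le> k \<Longrightarrow> j \<le> k \<Longrightarrow> comparable_on (A_seq \<alpha> k) (\<alpha> i) (\<alpha> j)" for k
  proof -
    let ?A = "A_seq \<alpha> k" and ?B = "A_seq \<alpha> (Suc k)" and ?\<beta>s = "ordered_restrictions \<alpha> k (A_seq \<alpha> k)"
    let ?cells = "cells ?A (\<alpha> (Suc k)) ?\<beta>s"
    obtain a where a: "a \<in> ?A" using IH(1) by (metis finite.emptyI ex_in_conv)
    note \<beta>s = ordered_restrictions[OF a IH(2)]
    have "\<not> (\<forall>C\<in>set ?cells. finite C)"
      using IH(1) Union_cells[of ?A "\<alpha> (Suc k)" ?\<beta>s] by (metis finite_Union finite_set)
    then have "find infinite ?cells \<noteq> None" by (auto simp: find_None_iff)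
    then obtain C where C: "find infinite ?cells = Some C" by blast
    then have B: "?B = C" by simp
    have "infinite ?B" "?B \<in> set ?cells"
      using C unfolding B by (auto simp: find_Some_iff)
    then have sub: "?B \<subseteq> ?A" using Union_upper[of ?B "set ?cells"] unfolding Union_cells by blast
    have new: "comparable_on ?B (\<alpha> (Suc k)) (\<alpha> i)" if "i \<le> k" for i
    proof -
      have "comparable_on ?B (\<alpha> (Suc k)) (restrict (\<alpha> i) ?A)"
        by (rule comparable_on_cells[OF \<beta>s(1) \<open>?B \<in> set ?cells\<close>]) (use \<beta>s(2) that in auto)
      moreover have "\<forall>x\<in>?B. restrict (\<alpha> i) ?A x = \<alpha> i x" using sub by auto
      ultimately show ?thesis unfolding comparable_on_def by simp
    qed
    have "comparable_on ?B (\<alpha> i) (\<alpha> j)" if ij: "i \<le> Suc k" "j \<le> Suc k" for i j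
    proof -
      consider "i \<le> k" "j \<le> k" | "i = Suc k" "j \<le> k" | "i \<le> k" "j = Suc k" | "i = Suc k" "j = Suc k"
        using ij by (auto simp: le_Suc_eq)
      then show ?thesis
      proof cases
        case 1
        then show ?thesis using IH(2) sub comparable_on_subset by blast
      next
        case 2
        then show ?thesis using new by blast
      next
        case 3
        then show ?thesis using new comparable_on_sym by blast
      qed (simp add: comparable_on_def)
    qed
    then show ?thesis using \<open>infinite ?B\<close> sub by blast
  qed
  have inv: "infinite (A_seq \<alpha> k) \<and> (\<forall>i\<le>k. \<forall>j\<le>k. comparable_on (A_seq \<alpha> k) (\<alpha> i) (\<alpha> j))" for k
  proof (induction k)
    case (Suc k)
    then show ?case using step[of k] by blast
  qed (simp add: comparable_on_def)
  show "infinite (A_seq \<alpha> k) \<and> (\<forall>i\<le>k. \<forall>j\<le>k. comparable_on (A_seq \<alpha> k) (\<alpha> i) (\<alpha> j))"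
    by (rule inv)
  show "A_seq \<alpha> (Suc k) \<subseteq> A_seq \<alpha> k"
    using step[of k] inv[of k] by blast
qed

lemma psi_in_A_seq: "k \<le> j \<Longrightarrow> psi \<alpha> j \<in> A_seq \<alpha> k"
proof -
  assume "k \<le> j"
  have "psi \<alpha> j \<in> A_seq \<alpha> j"
  proof (cases j)
    case (Suc i)
    have "\<exists>x. x \<in> A_seq \<alpha> (Suc i) \<and> psi \<alpha> i < x"
      using A_seq_invariant(1)[of \<alpha> "Suc i"] by (metis finite_nat_set_iff_bounded_le not_le_imp_less)
    then show ?thesis unfolding Suc psi.simps by (rule LeastI2_ex) simp
  qed simp
  moreover have "A_seq \<alpha> j \<subseteq> A_seq \<alpha> k"
    using \<open>k \<le> j\<close> A_seq_invariant(2) by (rule lift_Suc_antimono_le[rotated])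
  ultimately show ?thesis by blast
qed

text \<open>The arithmetical sets that contain almost all \<open>\<psi>(k)\<close> form an ultrafilter among the
  arithmetical sets.\<close>

definition decisive :: "(nat \<Rightarrow> nat) \<Rightarrow> bool" where
  "decisive \<psi> \<longleftrightarrow> (\<forall>f. arithmetical f \<longrightarrow>
    (\<forall>\<^sub>F k in sequentially. f (\<psi> k) = 0) \<or> (\<forall>\<^sub>F k in sequentially. f (\<psi> k) \<noteq> 0))"

text \<open>Both \<open>f\<close> and the constant function \<open>0\<close> are enumerated, and they are comparable from the stage
  on at which both have been treated.\<close>

lemma decisive_psi:
  assumes "range \<alpha> = {f. arithmetical f}" shows "decisive (psi \<alpha>)"
  unfolding decisive_def
proof (intro allI impI)
  fix f assume "arithmetical f"
  then obtain i where i: "\<alpha> i = f" using assms by (metis mem_Collect_eq rangeE)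
  obtain j where j: "\<alpha> j = (\<lambda>_. 0)" using assms arithmetical_const by (metis mem_Collect_eq rangeE)
  let ?K = "max i j"
  have "comparable_on (A_seq \<alpha> ?K) f (\<lambda>_. 0)" 
    using A_seq_invariant(1)[of \<alpha> ?K] i j by (metis max.cobounded1 max.cobounded2)
  then have "(\<forall>x \<in> A_seq \<alpha> ?K. f x = 0) \<or> (\<forall>x \<in> A_seq \<alpha> ?K. f x \<noteq> 0)"
    unfolding comparable_on_def by auto
  then show "(\<forall>\<^sub>F k in sequentially. f (psi \<alpha> k) = 0) \<or> (\<forall>\<^sub>F k in sequentially. f (psi \<alpha> k) \<noteq> 0)"
    using psi_in_A_seq[of ?K] unfolding eventually_sequentially by blast
qed


section \<open>The theorem of Los\<close>

lemma decisive_at: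
  assumes "decisive \<psi>" "definable (length \<alpha>s) P" "\<forall>\<alpha>\<in>set \<alpha>s. arithmetical \<alpha>"
  shows "(\<forall>\<^sub>F k in sequentially. P (at \<alpha>s (\<psi> k))) \<or> (\<forall>\<^sub>F k in sequentially. \<not> P (at \<alpha>s (\<psi> k)))"
proof -
  have "arithmetical (\<lambda>k. of_bool (P (at \<alpha>s k)))"
    using assms(2,3) by (intro arithmetical_of_bool definable_at0)
  then show ?thesis using assms(1) unfolding decisive_def by fastforce
qed

lemma cls_self: "arithmetical \<alpha> \<Longrightarrow> \<alpha> \<in> cls \<psi> \<alpha>"
  by (simp add: cls_def)

lemma cls_eq_iff:
  assumes "arithmetical \<alpha>" "arithmetical \<beta>"
  shows "cls \<psi> \<alpha> = cls \<psi> \<beta> \<longleftrightarrow> (\<forall>\<^sub>F k in sequentially. \<alpha> (\<psi> k) = \<beta> (\<psi> k))"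
proof
  assume "cls \<psi> \<alpha> = cls \<psi> \<beta>"
  then have "\<beta> \<in> cls \<psi> \<alpha>" using cls_self[OF assms(2)] by simp
  then show "\<forall>\<^sub>F k in sequentially. \<alpha> (\<psi> k) = \<beta> (\<psi> k)" by (simp add: cls_def)
next
  assume *: "\<forall>\<^sub>F k in sequentially. \<alpha> (\<psi> k) = \<beta> (\<psi> k)"
  have "(\<forall>\<^sub>F k in sequentially. \<alpha> (\<psi> k) = \<gamma> (\<psi> k)) \<longleftrightarrow> (\<forall>\<^sub>F k in sequentially. \<beta> (\<psi> k) = \<gamma> (\<psi> k))" for \<gamma>
    by (rule eventually_cong[OF *]) simp
  then show "cls \<psi> \<alpha> = cls \<psi> \<beta>" by (simp add: cls_def)
qed

lemma eventually_at:
  assumes "list_all2 (\<lambda>\<beta> \<alpha>. \<beta> \<in> cls \<psi> \<alpha>) \<beta>s \<alpha>s"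
  shows "\<forall>\<^sub>F k in sequentially. at \<beta>s (\<psi> k) = at \<alpha>s (\<psi> k)"
  using assms
proof (induction rule: list_all2_induct)
  case (Cons \<beta> \<beta>s \<alpha> \<alpha>s)
  from Cons.hyps(1) have "\<forall>\<^sub>F k in sequentially. \<alpha> (\<psi> k) = \<beta> (\<psi> k)" by (simp add: cls_def)
  with Cons.IH show ?case by eventually_elim simp
qed simp

text \<open>The operations do not depend on representatives, so the union that defines them has one member.\<close>

lemma cls_op_cls:
  assumes t: "tm_in (length \<alpha>s) t" and \<alpha>s: "\<forall>\<alpha>\<in>set \<alpha>s. arithmetical \<alpha>"
  shows "cls_op \<psi> (\<lambda>xs. tm_val std_nat xs t) (map (cls \<psi>) \<alpha>s) = cls \<psi> (\<lambda>n. tm_val std_nat (at \<alpha>s n) t)"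
proof -
  let ?F = "\<lambda>xs. tm_val std_nat xs t"
  have "cls \<psi> (\<lambda>n. ?F (at \<beta>s n)) = cls \<psi> (\<lambda>n. ?F (at \<alpha>s n))" if "list_all2 (\<in>) \<beta>s (map (cls \<psi>) \<alpha>s)" for \<beta>s
  proof -
    have \<beta>s: "list_all2 (\<lambda>\<beta> \<alpha>. \<beta> \<in> cls \<psi> \<alpha>) \<beta>s \<alpha>s" using that by (simp add: list_all2_map2)
    then have "\<forall>\<beta>\<in>set \<beta>s. arithmetical \<beta>"
      by (auto simp: list_all2_conv_all_nth in_set_conv_nth cls_def)
    moreover have "\<forall>\<^sub>F k in sequentially. ?F (at \<beta>s (\<psi> k)) = ?F (at \<alpha>s (\<psi> k))"
      using eventually_at[OF \<beta>s] by eventually_elim simp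
    ultimately show ?thesis
      using arithmetical_tm t \<alpha>s list_all2_lengthD[OF \<beta>s] by (subst cls_eq_iff) auto
  qed
  moreover have "list_all2 (\<in>) \<alpha>s (map (cls \<psi>) \<alpha>s)"
    using \<alpha>s by (auto simp: list_all2_conv_all_nth intro: cls_self)
  ultimately have "{cls \<psi> (\<lambda>n. ?F (at \<beta>s n)) | \<beta>s. list_all2 (\<in>) \<beta>s (map (cls \<psi>) \<alpha>s)} = {cls \<psi> (\<lambda>n. ?F (at \<alpha>s n))}"
    by blast
  then show ?thesis unfolding cls_op_def by simp
qed

lemma nonstd_zer: "zer (nonstd \<psi>) = cls \<psi> (\<lambda>_. 0)"
  using cls_op_cls[of "[]" TZero \<psi>] by (simp add: nonstd_def std_nat_def)

lemma nonstd_suc: "arithmetical \<alpha> \<Longrightarrow> suc (nonstd \<psi>) (cls \<psi> \<alpha>) = cls \<psi> (\<lambda>n. Suc (\<alpha> n))"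
  using cls_op_cls[of "[\<alpha>]" "TSucc (TVar 0)" \<psi>] by (simp add: nonstd_def std_nat_def)

lemma nonstd_add: "arithmetical \<alpha> \<Longrightarrow> arithmetical \<beta> \<Longrightarrow>
    add (nonstd \<psi>) (cls \<psi> \<alpha>) (cls \<psi> \<beta>) = cls \<psi> (\<lambda>n. \<alpha> n + \<beta> n)"
  using cls_op_cls[of "[\<alpha>, \<beta>]" "TAdd (TVar 0) (TVar 1)" \<psi>] by (simp add: nonstd_def std_nat_def)

lemma nonstd_mul: "arithmetical \<alpha> \<Longrightarrow> arithmetical \<beta> \<Longrightarrow>
    mul (nonstd \<psi>) (cls \<psi> \<alpha>) (cls \<psi> \<beta>) = cls \<psi> (\<lambda>n. \<alpha> n * \<beta> n)"
  using cls_op_cls[of "[\<alpha>, \<beta>]" "TMul (TVar 0) (TVar 1)" \<psi>] by (simp add: nonstd_def std_nat_def)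

lemma nonstd_dom: "dom (nonstd \<psi>) = cls \<psi> ` {\<alpha>. arithmetical \<alpha>}"
  by (simp add: nonstd_def)

lemma nonstd_tm_val:
  assumes "tm_in (length \<alpha>s) t" "\<forall>\<alpha>\<in>set \<alpha>s. arithmetical \<alpha>"
  shows "tm_val (nonstd \<psi>) (map (cls \<psi>) \<alpha>s) t = cls \<psi> (\<lambda>k. tm_val std_nat (at \<alpha>s k) t)"
  using assms(1)
proof (induction t)
  case TZero
  then show ?case by (simp add: nonstd_zer std_nat_def)
next
  case (TSucc t)
  then show ?case using arithmetical_tm[OF _ assms(2), of t] by (simp add: nonstd_suc) (simp add: std_nat_def)
next
  case (TAdd t s)
  then show ?case
    using arithmetical_tm[OF _ assms(2), of t] arithmetical_tm[OF _ assms(2), of s]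
    by (simp add: nonstd_add) (simp add: std_nat_def)
next
  case (TMul t s)
  then show ?case
    using arithmetical_tm[OF _ assms(2), of t] arithmetical_tm[OF _ assms(2), of s]
    by (simp add: nonstd_mul) (simp add: std_nat_def)
qed simp

lemma arithmetical_witness:
  assumes "fm_in (Suc (length \<alpha>s)) \<phi>" "\<forall>\<alpha>\<in>set \<alpha>s. arithmetical \<alpha>"
  shows "arithmetical (\<lambda>k. least (\<lambda>a. sat std_nat \<phi> (a # at \<alpha>s k)))"
proof (rule arithmetical_least)
  have "definable (1 + length \<alpha>s) (sat std_nat \<phi>)" using definable_sat[OF assms(1)] by simp
  from definable_at[OF this assms(2)]
  show "definable 2 (\<lambda>xs. sat std_nat \<phi> (xs ! 0 # at \<alpha>s (xs ! 1)))"
    by (auto simp: numeral_2_eq_2 take_Suc_conv_app_nth elim!: definable_cong)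
qed

text \<open>A property decided by a filter can be moved out of the scope of the filter, through disjunction
  and through implication.\<close>

lemma eventually_disj_decisive:
  assumes "eventually P F \<or> (\<forall>\<^sub>F k in F. \<not> P k)"
  shows "(\<forall>\<^sub>F k in F. P k \<or> Q k) \<longleftrightarrow> eventually P F \<or> eventually Q F"
proof -
  have "eventually Q F" if "\<forall>\<^sub>F k in F. \<not> P k" "\<forall>\<^sub>F k in F. P k \<or> Q k"
    using that by eventually_elim blast
  moreover have "\<forall>\<^sub>F k in F. P k \<or> Q k" if "eventually P F"
    using that by eventually_elim blast
  moreover have "\<forall>\<^sub>F k in F. P k \<or> Q k" if "eventually Q F"
    using that by eventually_elim blast
  ultimately show ?thesis using assms by blast
qed

lemma eventually_imp_decisive:
  assumes "eventually P F \<or> (\<forall>\<^sub>F k in F. \<not> P k)" and "F \<noteq> bot"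
  shows "(\<forall>\<^sub>F k in F. P k \<longrightarrow> Q k) \<longleftrightarrow> (eventually P F \<longrightarrow> eventually Q F)"
proof -
  have "\<not> eventually P F" if "\<forall>\<^sub>F k in F. \<not> P k"
  proof
    assume "eventually P F"
    with that have "\<forall>\<^sub>F k in F. False" by eventually_elim blast
    then show False using assms(2) by (simp add: eventually_False)
  qed
  moreover have "(\<forall>\<^sub>F k in F. \<not> P k \<or> Q k) \<longleftrightarrow> (\<forall>\<^sub>F k in F. \<not> P k) \<or> eventually Q F"
    by (rule eventually_disj_decisive) (use assms(1) in \<open>simp add: disj_commute\<close>)
  ultimately show ?thesis using assms(1) unfolding imp_conv_disj by blast
qed

text \<open>As for ultrapowers. Connectives are handled by decisiveness, and an existential statement that
  holds at almost all \<open>\<psi>(k)\<close> has the class of the function of least witnesses as a witness. For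
  the universal quantifier, the class of the function of least counterexamples is tested.\<close>

theorem Los:
  assumes \<psi>: "decisive \<psi>" and "fm_in (length \<alpha>s) \<phi>" "\<forall>\<alpha>\<in>set \<alpha>s. arithmetical \<alpha>"
  shows "sat (nonstd \<psi>) \<phi> (map (cls \<psi>) \<alpha>s) \<longleftrightarrow> (\<forall>\<^sub>F k in sequentially. sat std_nat \<phi> (at \<alpha>s (\<psi> k)))"
  using assms(2,3)
proof (induction \<phi> arbitrary: \<alpha>s)
  case FBot
  then show ?case by simp
next
  case (FEq t s)
  then show ?case
    using arithmetical_tm[of \<alpha>s t] arithmetical_tm[of \<alpha>s s] by (simp add: nonstd_tm_val cls_eq_iff)
next
  case (FAnd \<phi> \<chi>)
  then show ?case by (simp add: eventually_conj_iff)
next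
  case (FOr \<phi> \<chi>)
  then show ?case
    using decisive_at[OF \<psi> definable_sat, of \<alpha>s \<phi>] by (simp add: eventually_disj_decisive)
next
  case (FImp \<phi> \<chi>)
  then show ?case
    using decisive_at[OF \<psi> definable_sat, of \<alpha>s \<phi>] by (simp add: eventually_imp_decisive)
next
  case (FEx \<phi>)
  have IH: "sat (nonstd \<psi>) \<phi> (cls \<psi> \<gamma> # map (cls \<psi>) \<alpha>s) \<longleftrightarrow>
      (\<forall>\<^sub>F k in sequentially. sat std_nat \<phi> (\<gamma> (\<psi> k) # at \<alpha>s (\<psi> k)))" if "arithmetical \<gamma>" for \<gamma>
    using FEx.IH[of "\<gamma> # \<alpha>s"] FEx.prems that by simp
  let ?\<gamma> = "\<lambda>k. least (\<lambda>a. sat std_nat \<phi> (a # at \<alpha>s k))"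
  show ?case
  proof
    assume "sat (nonstd \<psi>) (FEx \<phi>) (map (cls \<psi>) \<alpha>s)"
    then obtain \<gamma> where "arithmetical \<gamma>" "sat (nonstd \<psi>) \<phi> (cls \<psi> \<gamma> # map (cls \<psi>) \<alpha>s)"
      by (auto simp: nonstd_dom)
    then have "\<forall>\<^sub>F k in sequentially. sat std_nat \<phi> (\<gamma> (\<psi> k) # at \<alpha>s (\<psi> k))" using IH by simp
    then show "\<forall>\<^sub>F k in sequentially. sat std_nat (FEx \<phi>) (at \<alpha>s (\<psi> k))"
      by (rule eventually_mono) (auto simp: std_nat_def)
  next
    assume "\<forall>\<^sub>F k in sequentially. sat std_nat (FEx \<phi>) (at \<alpha>s (\<psi> k))"
    then have "\<forall>\<^sub>F k in sequentially. sat std_nat \<phi> (?\<gamma> (\<psi> k) # at \<alpha>s (\<psi> k))"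
      by eventually_elim (auto intro: least)
    then have "sat (nonstd \<psi>) \<phi> (cls \<psi> ?\<gamma> # map (cls \<psi>) \<alpha>s)"
      using IH[of ?\<gamma>] arithmetical_witness FEx.prems by simp
    then show "sat (nonstd \<psi>) (FEx \<phi>) (map (cls \<psi>) \<alpha>s)"
      using arithmetical_witness[of \<alpha>s \<phi>] FEx.prems by (auto simp: nonstd_dom)
  qed
next
  case (FAll \<phi>)
  have IH: "sat (nonstd \<psi>) \<phi> (cls \<psi> \<gamma> # map (cls \<psi>) \<alpha>s) \<longleftrightarrow>
      (\<forall>\<^sub>F k in sequentially. sat std_nat \<phi> (\<gamma> (\<psi> k) # at \<alpha>s (\<psi> k)))" if "arithmetical \<gamma>" for \<gamma>
    using FAll.IH[of "\<gamma> # \<alpha>s"] FAll.prems that by simp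
  let ?\<gamma> = "\<lambda>k. least (\<lambda>a. sat std_nat (FImp \<phi> FBot) (a # at \<alpha>s k))"
  have \<gamma>: "arithmetical ?\<gamma>" using FAll.prems by (intro arithmetical_witness) auto
  show ?case
  proof
    assume *: "\<forall>\<^sub>F k in sequentially. sat std_nat (FAll \<phi>) (at \<alpha>s (\<psi> k))"
    have "\<forall>\<^sub>F k in sequentially. sat std_nat \<phi> (\<gamma> (\<psi> k) # at \<alpha>s (\<psi> k))" for \<gamma>
      using * by (rule eventually_mono) (simp add: std_nat_def)
    then show "sat (nonstd \<psi>) (FAll \<phi>) (map (cls \<psi>) \<alpha>s)" using IH by (auto simp: nonstd_dom)
  next
    assume "sat (nonstd \<psi>) (FAll \<phi>) (map (cls \<psi>) \<alpha>s)"
    then have "\<forall>\<^sub>F k in sequentially. sat std_nat \<phi> (?\<gamma> (\<psi> k) # at \<alpha>s (\<psi> k))"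
      using IH[OF \<gamma>] \<gamma> by (auto simp: nonstd_dom simp del: sat.simps(5))
    then show "\<forall>\<^sub>F k in sequentially. sat std_nat (FAll \<phi>) (at \<alpha>s (\<psi> k))"
    proof eventually_elim
      case (elim k)
      then show ?case using least[of "\<lambda>a. sat std_nat (FImp \<phi> FBot) (a # at \<alpha>s (\<psi> k))"] by auto
    qed
  qed
qed


section \<open>Realizability over a tractable structure\<close>

definition tracks :: "'a arith_assembly \<Rightarrow> nat \<Rightarrow> 'a list \<Rightarrow> nat list \<Rightarrow> bool" where
  "tracks M n xs cs \<longleftrightarrow> length xs = n \<and> set xs \<subseteq> dom M \<and> list_all2 (\<lambda>c x. c \<in> J_op (eset M x)) cs xs"

lemma tracks_length: "tracks M n xs cs \<Longrightarrow> length xs = n" "tracks M n xs cs \<Longrightarrow> length cs = n"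
  unfolding tracks_def by (auto dest: list_all2_lengthD)

lemma tracks_Cons: "tracks M n xs cs \<Longrightarrow> a \<in> dom M \<Longrightarrow> c \<in> J_op (eset M a) \<Longrightarrow> tracks M (Suc n) (a # xs) (c # cs)"
  unfolding tracks_def by simp

text \<open>The two capabilities that the realization of formulas rests on: formulas are decided, and
  witnesses of true existential statements are found, by programs that take realizers of the
  parameters. The witness is one element for all values that the programs may deliver.\<close>

definition tractable :: "'a arith_assembly \<Rightarrow> bool" where
  "tractable M \<longleftrightarrow> (\<forall>x\<in>dom M. eset M x \<noteq> {}) \<and>
    (\<forall>n \<phi>. fm_in n \<phi> \<longrightarrow> (\<exists>d. \<forall>xs cs. tracks M n xs cs \<longrightarrow> ev d cs (J_op {of_bool (sat M \<phi> xs)}))) \<and>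
    (\<forall>n \<phi>. fm_in (Suc n) \<phi> \<longrightarrow> (\<exists>d. \<forall>xs cs. tracks M n xs cs \<longrightarrow> sat M (FEx \<phi>) xs \<longrightarrow>
      (\<exists>a\<in>dom M. sat M \<phi> (a # xs) \<and> ev d cs (J_op (eset M a)))))"

lemma tractable_decider:
  assumes "tractable M" "fm_in n \<phi>"
  obtains d where "\<And>xs cs. tracks M n xs cs \<Longrightarrow> ev d cs (J_op {of_bool (sat M \<phi> xs)})"
  using assms unfolding tractable_def by blast

lemma tractable_witness:
  assumes "tractable M" "fm_in (Suc n) \<phi>"
  obtains d where "\<And>xs cs. tracks M n xs cs \<Longrightarrow> sat M (FEx \<phi>) xs \<Longrightarrow>
    \<exists>a\<in>dom M. sat M \<phi> (a # xs) \<and> ev d cs (J_op (eset M a))"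
  using assms unfolding tractable_def by blast

lemma tractable_tracks:
  assumes "tractable M" "length xs = n" "set xs \<subseteq> dom M"
  shows "\<exists>cs. tracks M n xs cs"
proof -
  have "\<forall>x\<in>dom M. \<exists>c. c \<in> J_op (eset M x)"
    using assms(1) J_op_return unfolding tractable_def by fastforce
  then obtain c where c: "\<And>x. x \<in> dom M \<Longrightarrow> c x \<in> J_op (eset M x)" by metis
  have "tracks M n xs (map c xs)"
    using assms(2,3) by (auto simp: tracks_def list_all2_conv_all_nth intro!: c subsetD[OF assms(3)])
  then show ?thesis ..
qed

subsection \<open>Contexts\<close>

lemma list_encode_in_wedges: "list_all2 (\<in>) ys As \<Longrightarrow> length As \<noteq> 1 \<Longrightarrow> list_encode ys \<in> wedges As"
  by (cases As rule: wedges.cases) auto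

text \<open>A context with one parameter is not wrapped in a list, and a context without parameters is an
  arbitrary number. Both are brought to the list form of the longer contexts.\<close>

definition as_list :: "nat \<Rightarrow> nat \<Rightarrow> nat" where
  "as_list n c = (if n = 0 then list_encode [] else if n = 1 then list_encode [c] else c)"

lemma as_list_wedges: "c \<in> wedges As \<Longrightarrow> \<exists>ys. as_list (length As) c = list_encode ys \<and> list_all2 (\<in>) ys As"
  by (cases As rule: wedges.cases) (auto simp: as_list_def)

lemma recfun_as_list: "recfun 1 (\<lambda>xs. as_list n (xs ! 0))"
  unfolding as_list_def by (cases "n = 0"; cases "n = 1") (auto intro!: rec)

definition ctxp :: "nat \<Rightarrow> recf" where
  "ctxp n = (if n = 1 then RProj 0
    else pure n list_encode)"

lemma ev_ctx: "tracks M n xs cs \<Longrightarrow> ev (ctxp n) cs (ctx M xs)"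
proof -
  assume t: "tracks M n xs cs"
  show ?thesis
  proof (cases "n = 1")
    case True
    then obtain x c where "xs = [x]" "cs = [c]" using tracks_length[OF t] by (auto simp: length_Suc_conv)
    then show ?thesis using t True by (auto simp: ctxp_def ctx_def tracks_def intro: ev_var)
  next
    case False
    have "list_encode cs \<in> ctx M xs"
      unfolding ctx_def using t False by (intro list_encode_in_wedges) (auto simp: tracks_def list_all2_map2)
    then show ?thesis
      using tracks_length(2)[OF t] False by (auto simp: ctxp_def intro!: ev_pure recfun_encode_env)
  qed
qed

subsection \<open>Resolutions of disjunctions\<close>

text \<open>A resolution of \<open>\<phi>\<close> settles the disjunctions that a realizer of \<open>\<phi>\<close> has to settle before it
  receives any argument, that is, those not below an implication or a universal quantifier.\<close>

primrec resolutions :: "fm \<Rightarrow> fm set" where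
  "resolutions FBot = {FBot}"
| "resolutions (FEq t s) = {FEq t s}"
| "resolutions (FAnd \<phi> \<chi>) = (\<lambda>(a, b). FAnd a b) ` (resolutions \<phi> \<times> resolutions \<chi>)"
| "resolutions (FOr \<phi> \<chi>) = resolutions \<phi> \<union> resolutions \<chi>"
| "resolutions (FImp \<phi> \<chi>) = {FImp \<phi> \<chi>}"
| "resolutions (FEx \<phi>) = FEx ` resolutions \<phi>"
| "resolutions (FAll \<phi>) = {FAll \<phi>}"

lemma finite_resolutions: "finite (resolutions \<phi>)"
  by (induction \<phi>) auto

lemma fm_in_resolutions: "fm_in n \<phi> \<Longrightarrow> a \<in> resolutions \<phi> \<Longrightarrow> fm_in n a"
proof (induction \<phi> arbitrary: n a)
  case (FAnd \<phi> \<chi>)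
  obtain b c where "a = FAnd b c" "b \<in> resolutions \<phi>" "c \<in> resolutions \<chi>" using FAnd.prems(2) by auto
  with FAnd.prems(1) show ?case using FAnd.IH(1)[of n b] FAnd.IH(2)[of n c] by simp
next
  case (FOr \<phi> \<chi>)
  show ?case using FOr.IH(1)[of n a] FOr.IH(2)[of n a] FOr.prems by auto
next
  case (FEx \<phi>)
  obtain b where "a = FEx b" "b \<in> resolutions \<phi>" using FEx.prems(2) by auto
  with FEx.prems(1) show ?case using FEx.IH[of "Suc n" b] by simp
next
  case (FImp \<phi> \<chi>)
  show ?case using FImp.prems by simp
next
  case (FAll \<phi>)
  show ?case using FAll.prems by simp
qed simp_all

lemma sat_resolutions: "sat M \<phi> xs \<longleftrightarrow> (\<exists>a\<in>resolutions \<phi>. sat M a xs)"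
proof (induction \<phi> arbitrary: xs)
  case (FAnd \<phi> \<chi>)
  show ?case unfolding sat.simps FAnd.IH[of xs] by (auto simp: bex_simps)
next
  case (FOr \<phi> \<chi>)
  show ?case unfolding sat.simps FOr.IH[of xs] by auto
next
  case (FEx \<phi>)
  show ?case unfolding sat.simps FEx.IH by auto
qed simp_all

subsection \<open>Truth and realizability\<close>

definition pairp :: "recf \<Rightarrow> recf \<Rightarrow> recf" where
  "pairp s t = RComp (pure 2 (\<lambda>xs. list_encode [xs ! 0, xs ! 1])) [s, t]"

lemma ev_pair:
  assumes "ev s xs A" "ev t xs B" "\<And>a b. a \<in> A \<Longrightarrow> b \<in> B \<Longrightarrow> list_encode [a, b] \<in> C"
  shows "ev (pairp s t) xs C"
  unfolding pairp_def by (rule ev_comp2[OF assms(1,2)]) (auto intro!: ev_pure rec assms(3))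

text \<open>A true resolution is realized outright, from realizers of the parameters. For \<open>\<phi>\<close> itself this
  would not be possible: which resolution is true is known only up to \<open>J\<close>.\<close>

definition realized :: "'a arith_assembly \<Rightarrow> nat \<Rightarrow> fm \<Rightarrow> bool" where
  "realized M n \<phi> \<longleftrightarrow> (\<forall>a\<in>resolutions \<phi>. \<exists>d. \<forall>xs cs. tracks M n xs cs \<longrightarrow> sat M a xs \<longrightarrow> ev d cs (rz_set M \<phi> xs))"

definition sound :: "'a arith_assembly \<Rightarrow> nat \<Rightarrow> fm \<Rightarrow> bool" where
  "sound M n \<phi> \<longleftrightarrow> (\<forall>xs. length xs = n \<longrightarrow> set xs \<subseteq> dom M \<longrightarrow> rz_set M \<phi> xs \<noteq> {} \<longrightarrow> sat M \<phi> xs)"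

lemma soundD: "sound M n \<phi> \<Longrightarrow> length xs = n \<Longrightarrow> set xs \<subseteq> dom M \<Longrightarrow> e \<in> rz_set M \<phi> xs \<Longrightarrow> sat M \<phi> xs"
  unfolding sound_def by blast

text \<open>Up to \<open>J\<close> the finitely many resolutions can be decided one after the other, until a true one is
  found.\<close>

lemma realized_J:
  assumes M: "tractable M" and \<phi>: "fm_in n \<phi>" "realized M n \<phi>"
  obtains d where "\<And>xs cs. tracks M n xs cs \<Longrightarrow> sat M \<phi> xs \<Longrightarrow> ev d cs (J_op (rz_set M \<phi> xs))"
proof -
  have "\<exists>d. \<forall>xs cs. tracks M n xs cs \<longrightarrow> (\<exists>a\<in>S. sat M a xs) \<longrightarrow> ev d cs (J_op (rz_set M \<phi> xs))"
    if "finite S" "S \<subseteq> resolutions \<phi>" for S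
    using that
  proof (induction S rule: finite_induct)
    case (insert a S)
    then obtain p where p: "\<And>xs cs. tracks M n xs cs \<Longrightarrow> \<exists>a\<in>S. sat M a xs \<Longrightarrow> ev p cs (J_op (rz_set M \<phi> xs))"
      by auto
    obtain d where d: "\<And>xs cs. tracks M n xs cs \<Longrightarrow> sat M a xs \<Longrightarrow> ev d cs (rz_set M \<phi> xs)"
      using insert.prems \<phi>(2) unfolding realized_def by blast
    have "fm_in n a" using insert.prems fm_in_resolutions[OF \<phi>(1)] by blast
    then obtain c where c: "\<And>xs cs. tracks M n xs cs \<Longrightarrow> ev c cs (J_op {of_bool (sat M a xs)})"
      using tractable_decider[OF M] by blast
    have "ev (bindp n c (ifp (Suc n) (\<lambda>zs. zs ! 0 = 1) (weaken n (retp d)) (weaken n p))) cs (J_op (rz_set M \<phi> xs))"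
      if t: "tracks M n xs cs" and ex: "\<exists>b\<in>insert a S. sat M b xs" for xs cs
    proof (rule ev_bind[OF tracks_length(2)[OF t] c[OF t]], rule ev_if)
      fix b assume "b \<in> {of_bool (sat M a xs) :: nat}"
      then have b: "b = of_bool (sat M a xs)" by simp
      show "ev (weaken n (retp d)) (b # cs) (J_op (rz_set M \<phi> xs))" if "(b # cs) ! 0 = 1"
      proof -
        have "sat M a xs" using that b by (cases "sat M a xs") auto
        then show ?thesis by (intro ev_weaken ev_ret d[OF t] tracks_length(2)[OF t])
      qed
      show "ev (weaken n p) (b # cs) (J_op (rz_set M \<phi> xs))" if "(b # cs) ! 0 \<noteq> 1"
      proof -
        have "\<not> sat M a xs" using that b by (cases "sat M a xs") auto
        then show ?thesis using ex by (intro ev_weaken p[OF t] tracks_length(2)[OF t]) auto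
      qed
    qed (use tracks_length(2)[OF t] in \<open>auto intro!: rec\<close>)
    then show ?case by blast
  qed simp
  from this[OF finite_resolutions subset_refl] show ?thesis
    using that sat_resolutions[of M \<phi>] by blast
qed

text \<open>The two claims depend on each other at an implication \<open>\<phi> \<longrightarrow> \<chi>\<close>. Its realizer ignores
  its argument and realizes \<open>\<chi>\<close> up to \<open>J\<close>, which is possible as the existence of an argument
  shows that \<open>\<phi>\<close>, and therefore \<open>\<chi>\<close>, is true. Conversely, if \<open>\<phi>\<close> is true it has a realizer, which a realizer of the
  implication turns into one of \<open>\<chi>\<close>.\<close>

lemma realized_and_sound:
  assumes M: "tractable M" and "fm_in n \<phi>"
  shows "realized M n \<phi> \<and> sound M n \<phi>"
  using assms(2)
proof (induction \<phi> arbitrary: n)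
  case FBot
  show ?case by (simp add: realized_def sound_def)
next
  case (FEq t s)
  have "ev (ctxp n) cs (rz_set M (FEq t s) xs)" if "tracks M n xs cs" "sat M (FEq t s) xs" for xs cs
    by (rule ev_mono[OF ev_ctx[OF that(1)]]) (use that(2) in auto)
  then show ?case unfolding realized_def sound_def by auto
next
  case (FAnd \<phi> \<chi>)
  then have \<phi>: "realized M n \<phi>" "sound M n \<phi>" and \<chi>: "realized M n \<chi>" "sound M n \<chi>" by auto
  have "\<exists>d. \<forall>xs cs. tracks M n xs cs \<longrightarrow> sat M (FAnd a b) xs \<longrightarrow> ev d cs (rz_set M (FAnd \<phi> \<chi>) xs)"
    if ab: "a \<in> resolutions \<phi>" "b \<in> resolutions \<chi>" for a b
  proof -
    obtain d where d: "\<And>xs cs. tracks M n xs cs \<Longrightarrow> sat M a xs \<Longrightarrow> ev d cs (rz_set M \<phi> xs)"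
      using \<phi>(1) \<chi>(1) ab unfolding realized_def by blast
    obtain d' where d': "\<And>xs cs. tracks M n xs cs \<Longrightarrow> sat M b xs \<Longrightarrow> ev d' cs (rz_set M \<chi> xs)"
      using \<phi>(1) \<chi>(1) ab unfolding realized_def by blast
    have "ev (pairp d d') cs (rz_set M (FAnd \<phi> \<chi>) xs)" if "tracks M n xs cs" "sat M (FAnd a b) xs" for xs cs
      by (rule ev_pair[OF d d', OF that(1) _ that(1)]) (use that(2) in auto)
    then show ?thesis by blast
  qed
  then have "realized M n (FAnd \<phi> \<chi>)" unfolding realized_def by auto
  moreover have "sound M n (FAnd \<phi> \<chi>)"
    using \<phi>(2) \<chi>(2) unfolding sound_def by auto
  ultimately show ?case by blast
next
  case (FOr \<phi> \<chi>)
  then have \<phi>: "realized M n \<phi>" "sound M n \<phi>" and \<chi>: "realized M n \<chi>" "sound M n \<chi>" by auto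
  have "\<exists>d. \<forall>xs cs. tracks M n xs cs \<longrightarrow> sat M a xs \<longrightarrow> ev d cs (rz_set M (FOr \<phi> \<chi>) xs)" if a: "a \<in> resolutions \<phi>" for a
  proof -
    obtain d where d: "\<And>xs cs. tracks M n xs cs \<Longrightarrow> sat M a xs \<Longrightarrow> ev d cs (rz_set M \<phi> xs)"
      using \<phi>(1) \<chi>(1) a unfolding realized_def by blast
    have "ev (pairp (constp 0) d) cs (rz_set M (FOr \<phi> \<chi>) xs)" if "tracks M n xs cs" "sat M a xs" for xs cs
      by (rule ev_pair[OF ev_constp[OF singletonI] d[OF that]]) auto
    then show ?thesis by blast
  qed
  moreover have "\<exists>d. \<forall>xs cs. tracks M n xs cs \<longrightarrow> sat M a xs \<longrightarrow> ev d cs (rz_set M (FOr \<phi> \<chi>) xs)" if a: "a \<in> resolutions \<chi>" for a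
  proof -
    obtain d where d: "\<And>xs cs. tracks M n xs cs \<Longrightarrow> sat M a xs \<Longrightarrow> ev d cs (rz_set M \<chi> xs)"
      using \<phi>(1) \<chi>(1) a unfolding realized_def by blast
    have "ev (pairp (constp 1) d) cs (rz_set M (FOr \<phi> \<chi>) xs)" if "tracks M n xs cs" "sat M a xs" for xs cs
      by (rule ev_pair[OF ev_constp[OF singletonI] d[OF that]]) auto
    then show ?thesis by blast
  qed
  ultimately have "realized M n (FOr \<phi> \<chi>)" unfolding realized_def by auto
  moreover have "sound M n (FOr \<phi> \<chi>)"
    using \<phi>(2) \<chi>(2) unfolding sound_def by auto
  ultimately show ?case by blast
next
  case (FImp \<phi> \<chi>)
  then have \<phi>: "realized M n \<phi>" "sound M n \<phi>" and \<chi>: "realized M n \<chi>" "sound M n \<chi>" by auto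
  obtain d where d: "\<And>xs cs. tracks M n xs cs \<Longrightarrow> sat M \<chi> xs \<Longrightarrow> ev d cs (J_op (rz_set M \<chi> xs))"
    using realized_J[OF M _ \<chi>(1)] FImp.prems by auto
  have "ev (pairp (ctxp n) (lam n (weaken n d))) cs (rz_set M (FImp \<phi> \<chi>) xs)"
    if t: "tracks M n xs cs" and s: "sat M (FImp \<phi> \<chi>) xs" for xs cs
  proof (rule ev_pair[OF ev_ctx[OF t]])
    show "ev (lam n (weaken n d)) cs (arrow (rz_set M \<phi> xs) (J_op (rz_set M \<chi> xs)))"
    proof (rule ev_lam[OF tracks_length(2)[OF t]])
      fix m assume "m \<in> rz_set M \<phi> xs"
      then have "sat M \<phi> xs" using \<phi>(2) t unfolding sound_def tracks_def by blast
      then show "ev (weaken n d) (m # cs) (J_op (rz_set M \<chi> xs))"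
        using d[OF t] s tracks_length(2)[OF t] by (intro ev_weaken) auto
    qed
  qed auto
  then have "realized M n (FImp \<phi> \<chi>)" unfolding realized_def by auto
  moreover have "sat M (FImp \<phi> \<chi>) xs"
    if xs: "length xs = n" "set xs \<subseteq> dom M" and e: "e \<in> rz_set M (FImp \<phi> \<chi>) xs" for xs e
  proof -
    have "sat M \<chi> xs" if s: "sat M \<phi> xs"
    proof -
      obtain cs where t: "tracks M n xs cs" using tractable_tracks[OF M xs] by blast
      obtain a where "a \<in> resolutions \<phi>" "sat M a xs" using s sat_resolutions by blast
      then obtain m where "m \<in> rz_set M \<phi> xs" using \<phi>(1) t unfolding realized_def ev_def by blast
      then obtain b where "b \<in> J_op (rz_set M \<chi> xs)" using e by (auto simp: arrow_def)
      then show ?thesis using J_op_nonempty \<chi>(2) xs unfolding sound_def by blast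
    qed
    then show ?thesis by simp
  qed
  then have "sound M n (FImp \<phi> \<chi>)" unfolding sound_def by blast
  ultimately show ?case by blast
next
  case (FEx \<phi>)
  then have \<phi>: "realized M (Suc n) \<phi>" "sound M (Suc n) \<phi>" by auto
  have "\<exists>d. \<forall>xs cs. tracks M n xs cs \<longrightarrow> sat M (FEx a) xs \<longrightarrow> ev d cs (rz_set M (FEx \<phi>) xs)" if a: "a \<in> resolutions \<phi>" for a
  proof -
    have "fm_in (Suc n) a" using fm_in_resolutions[OF _ a] FEx.prems by simp
    then obtain w where w: "\<And>xs cs. tracks M n xs cs \<Longrightarrow> sat M (FEx a) xs \<Longrightarrow>
        \<exists>y\<in>dom M. sat M a (y # xs) \<and> ev w cs (J_op (eset M y))"
      using tractable_witness[OF M] by blast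
    obtain d where d: "\<And>xs cs. tracks M (Suc n) xs cs \<Longrightarrow> sat M a xs \<Longrightarrow> ev d cs (rz_set M \<phi> xs)"
      using \<phi>(1) a unfolding realized_def by blast
    have "ev (letp n w (pairp (RProj 0) d)) cs (rz_set M (FEx \<phi>) xs)"
      if t: "tracks M n xs cs" and s: "sat M (FEx a) xs" for xs cs
    proof -
      obtain y where y: "y \<in> dom M" "sat M a (y # xs)" "ev w cs (J_op (eset M y))" using w[OF t s] by blast
      show ?thesis
      proof (rule ev_let[OF tracks_length(2)[OF t] y(3)])
        fix c assume c: "c \<in> J_op (eset M y)"
        show "ev (pairp (RProj 0) d) (c # cs) (rz_set M (FEx \<phi>) xs)"
        proof (rule ev_pair)
          show "ev (RProj 0) (c # cs) (J_op (eset M y))" using c by (intro ev_var) auto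
          show "ev d (c # cs) (rz_set M \<phi> (y # xs))" using d[OF tracks_Cons[OF t y(1) c] y(2)] .
        qed (use y in auto)
      qed
    qed
    then show ?thesis by blast
  qed
  then have "realized M n (FEx \<phi>)" unfolding realized_def by auto
  moreover have "sat M (FEx \<phi>) xs"
    if xs: "length xs = n" "set xs \<subseteq> dom M" and e: "e \<in> rz_set M (FEx \<phi>) xs" for xs e
  proof -
    obtain a where "a \<in> dom M" "proj e 1 \<in> rz_set M \<phi> (a # xs)" using e by auto
    then have "sat M \<phi> (a # xs)" using xs by (intro soundD[OF \<phi>(2)]) auto
    then show ?thesis using \<open>a \<in> dom M\<close> by auto
  qed
  then have "sound M n (FEx \<phi>)" unfolding sound_def by blast
  ultimately show ?case by blast
next
  case (FAll \<phi>)
  then have \<phi>: "realized M (Suc n) \<phi>" "sound M (Suc n) \<phi>" by auto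
  obtain d where d: "\<And>xs cs. tracks M (Suc n) xs cs \<Longrightarrow> sat M \<phi> xs \<Longrightarrow> ev d cs (J_op (rz_set M \<phi> xs))"
    using realized_J[OF M _ \<phi>(1)] FAll.prems by auto
  \<comment> \<open>The element that the quantifier ranges over is given by a realizer, and becomes a parameter
    through the unit of \<open>J\<close>.\<close>
  let ?p = "lam n (letp (Suc n) (retp (RProj 0)) (rename (0 # [2..<2 + n]) d))"
  have "ev (pairp (ctxp n) ?p) cs (rz_set M (FAll \<phi>) xs)"
    if t: "tracks M n xs cs" and s: "sat M (FAll \<phi>) xs" for xs cs
  proof -
    have len: "length cs = n" by (rule tracks_length(2)[OF t])
    have "ev ?p cs {e. \<forall>y\<in>dom M. e \<in> arrow (eset M y) (J_op (rz_set M \<phi> (y # xs)))}"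
    proof -
      have "closure (letp (Suc n) (retp (RProj 0)) (rename (0 # [2..<2 + n]) d)) cs
          \<in> arrow (eset M y) (J_op (rz_set M \<phi> (y # xs)))" if y: "y \<in> dom M" for y
      proof (rule closure_arrow, rule ev_let)
        fix k assume "k \<in> eset M y"
        then show "ev (retp (RProj 0)) (k # cs) (J_op (eset M y))" by (intro ev_ret ev_var) auto
        fix c assume "c \<in> J_op (eset M y)"
        then have "ev d (c # cs) (J_op (rz_set M \<phi> (y # xs)))"
          using d[OF tracks_Cons[OF t y]] s y by auto
        moreover have "map ((!) (c # k # cs)) (0 # [2..<2 + n]) = c # cs"
          using map_nth_drop[of "c # k # cs" 2 n] len by (simp add: numeral_2_eq_2 del: upt_Suc)
        ultimately show "ev (rename (0 # [2..<2 + n]) d) (c # k # cs) (J_op (rz_set M \<phi> (y # xs)))"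
          using len by (intro ev_rename) (auto simp del: upt_Suc)
      qed (use len in simp)
      then show ?thesis by (intro ev_lam_closure[OF len]) blast
    qed
    then show ?thesis by (rule ev_pair[OF ev_ctx[OF t]]) auto
  qed
  then have "realized M n (FAll \<phi>)" unfolding realized_def by auto
  moreover have "sat M (FAll \<phi>) xs"
    if xs: "length xs = n" "set xs \<subseteq> dom M" and e: "e \<in> rz_set M (FAll \<phi>) xs" for xs e
  proof -
    have "sat M \<phi> (y # xs)" if y: "y \<in> dom M" for y
    proof -
      obtain k where "k \<in> eset M y" using M y unfolding tractable_def by blast
      then obtain b where "b \<in> J_op (rz_set M \<phi> (y # xs))" using e y by (fastforce simp: arrow_def)
      then have "rz_set M \<phi> (y # xs) \<noteq> {}" by (rule J_op_nonempty)
      then show ?thesis using \<phi>(2) xs y unfolding sound_def by auto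
    qed
    then show ?thesis by simp
  qed
  then have "sound M n (FAll \<phi>)" unfolding sound_def by blast
  ultimately show ?case by blast
qed

theorem realizable_iff_sat:
  assumes M: "tractable M" and "fm_in n \<phi>" "length xs = n" "set xs \<subseteq> dom M"
  shows "rz_set M \<phi> xs \<noteq> {} \<longleftrightarrow> sat M \<phi> xs"
proof
  assume "rz_set M \<phi> xs \<noteq> {}"
  then show "sat M \<phi> xs" using realized_and_sound[OF assms(1,2)] assms(3,4) unfolding sound_def by blast
next
  assume "sat M \<phi> xs"
  then obtain a where "a \<in> resolutions \<phi>" "sat M a xs" using sat_resolutions by blast
  moreover obtain cs where "tracks M n xs cs" using tractable_tracks[OF M assms(3,4)] by blast
  ultimately show "rz_set M \<phi> xs \<noteq> {}"
    using realized_and_sound[OF assms(1,2)] unfolding realized_def ev_def by blast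
qed

subsection \<open>Transformation of realizers\<close>

text \<open>A realizer contains the information which resolution it realizes. To avoid codes of formulas,
  the claim is that any numbers \<open>D a\<close> attached to the resolutions \<open>a\<close> can be computed from it. For a
  conjunction, the first component determines an index of a program that computes the number
  attached to \<open>FAnd a b\<close> from the second.\<close>

lemma resolution_of_realizer:
  assumes M: "tractable M" and "fm_in n \<phi>"
  shows "\<exists>p. \<forall>xs e. length xs = n \<longrightarrow> set xs \<subseteq> dom M \<longrightarrow> e \<in> rz_set M \<phi> xs \<longrightarrow>
    (\<exists>a\<in>resolutions \<phi>. sat M a xs \<and> ev p [e] {D a})"
  using assms(2)
proof (induction \<phi> arbitrary: n D)
  case FBot
  show ?case by simp
next
  case (FEq t s)
  show ?case by (intro exI[of _ "constp (D (FEq t s))"]) (auto intro: ev_constp)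
next
  case (FAnd \<phi> \<chi>)
  have "\<forall>a. \<exists>q. \<forall>xs e. length xs = n \<longrightarrow> set xs \<subseteq> dom M \<longrightarrow> e \<in> rz_set M \<chi> xs \<longrightarrow>
      (\<exists>b\<in>resolutions \<chi>. sat M b xs \<and> ev q [e] {D (FAnd a b)})"
    using FAnd.IH(2)[of n "\<lambda>b. D (FAnd a b)" for a] FAnd.prems by auto
  then obtain q where q: "\<And>a xs e. length xs = n \<Longrightarrow> set xs \<subseteq> dom M \<Longrightarrow> e \<in> rz_set M \<chi> xs \<Longrightarrow>
      (\<exists>b\<in>resolutions \<chi>. sat M b xs \<and> ev (q a) [e] {D (FAnd a b)})"
    by metis
  obtain p where p: "\<And>xs e. length xs = n \<Longrightarrow> set xs \<subseteq> dom M \<Longrightarrow> e \<in> rz_set M \<phi> xs \<Longrightarrow>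
      (\<exists>a\<in>resolutions \<phi>. sat M a xs \<and> ev p [e] {closure (q a) []})"
    using FAnd.IH(1)[of n "\<lambda>a. closure (q a) []"] FAnd.prems by auto
  let ?at = "\<lambda>i. pure 1 (\<lambda>xs. proj (xs ! 0) i)"
  have "\<exists>c\<in>resolutions (FAnd \<phi> \<chi>). sat M c xs \<and> ev (app (RComp p [?at 0]) (?at 1)) [e] {D c}"
    if xs: "length xs = n" "set xs \<subseteq> dom M" and e: "e \<in> rz_set M (FAnd \<phi> \<chi>) xs" for xs e
  proof -
    obtain a where a: "a \<in> resolutions \<phi>" "sat M a xs" "ev p [proj e 0] {closure (q a) []}"
      using p[OF xs] e by auto
    obtain b where b: "b \<in> resolutions \<chi>" "sat M b xs" "ev (q a) [proj e 1] {D (FAnd a b)}"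
      using q[OF xs] e by auto
    have at: "ev (?at i) [e] {proj e i}" for i by (intro ev_pure rec) auto
    have "ev (app (RComp p [?at 0]) (?at 1)) [e] {D (FAnd a b)}"
    proof (rule ev_app)
      have "closure (q a) [] \<in> arrow {proj e 1} {D (FAnd a b)}"
        using b(3) by (intro closure_arrow) auto
      then show "ev (RComp p [?at 0]) [e] (arrow {proj e 1} {D (FAnd a b)})"
        by (intro ev_comp1[OF at]) (use a(3) in \<open>auto intro: ev_mono\<close>)
    qed (rule at)
    then show ?thesis using a b by (intro bexI[of _ "FAnd a b"]) auto
  qed
  then show ?case by blast
next
  case (FOr \<phi> \<chi>)
  obtain p where p: "\<And>xs e. length xs = n \<Longrightarrow> set xs \<subseteq> dom M \<Longrightarrow> e \<in> rz_set M \<phi> xs \<Longrightarrow>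
      (\<exists>a\<in>resolutions \<phi>. sat M a xs \<and> ev p [e] {D a})"
    using FOr.IH(1)[of n D] FOr.prems by auto
  obtain q where q: "\<And>xs e. length xs = n \<Longrightarrow> set xs \<subseteq> dom M \<Longrightarrow> e \<in> rz_set M \<chi> xs \<Longrightarrow>
      (\<exists>a\<in>resolutions \<chi>. sat M a xs \<and> ev q [e] {D a})"
    using FOr.IH(2)[of n D] FOr.prems by auto
  let ?at = "pure 1 (\<lambda>xs. proj (xs ! 0) 1)"
  let ?r = "ifp 1 (\<lambda>xs. proj (xs ! 0) 0 = 0) (RComp p [?at]) (RComp q [?at])"
  have "\<exists>a\<in>resolutions (FOr \<phi> \<chi>). sat M a xs \<and> ev ?r [e] {D a}"
    if xs: "length xs = n" "set xs \<subseteq> dom M" and e: "e \<in> rz_set M (FOr \<phi> \<chi>) xs" for xs e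
  proof -
    have at: "ev ?at [e] {proj e 1}" by (intro ev_pure rec) auto
    have r: "recpred 1 (\<lambda>xs. proj (xs ! 0) 0 = 0)" by (intro rec) auto
    show ?thesis
    proof (cases "proj e 0 = 0")
      case True
      then obtain a where a: "a \<in> resolutions \<phi>" "sat M a xs" "ev p [proj e 1] {D a}" using p[OF xs] e by auto
      have "ev ?r [e] {D a}"
        using a(3) True by (intro ev_if[OF r] ev_comp1[OF at]) auto
      then show ?thesis using a by auto
    next
      case False
      then obtain a where a: "a \<in> resolutions \<chi>" "sat M a xs" "ev q [proj e 1] {D a}" using q[OF xs] e by auto
      have "ev ?r [e] {D a}"
        using a(3) False by (intro ev_if[OF r] ev_comp1[OF at]) auto
      then show ?thesis using a by auto
    qed
  qed
  then show ?case by blast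
next
  case (FImp \<phi> \<chi>)
  have "sat M (FImp \<phi> \<chi>) xs" if "length xs = n" "set xs \<subseteq> dom M" "e \<in> rz_set M (FImp \<phi> \<chi>) xs" for xs e
    using realizable_iff_sat[OF M FImp.prems that(1,2)] that(3) by blast
  then show ?case by (intro exI[of _ "constp (D (FImp \<phi> \<chi>))"]) (auto intro: ev_constp)
next
  case (FEx \<phi>)
  obtain p where p: "\<And>xs e. length xs = Suc n \<Longrightarrow> set xs \<subseteq> dom M \<Longrightarrow> e \<in> rz_set M \<phi> xs \<Longrightarrow>
      (\<exists>a\<in>resolutions \<phi>. sat M a xs \<and> ev p [e] {D (FEx a)})"
    using FEx.IH[of "Suc n" "\<lambda>a. D (FEx a)"] FEx.prems unfolding fm_in.simps by blast
  let ?at = "pure 1 (\<lambda>xs. proj (xs ! 0) 1)"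
  have "\<exists>a\<in>resolutions (FEx \<phi>). sat M a xs \<and> ev (RComp p [?at]) [e] {D a}"
    if xs: "length xs = n" "set xs \<subseteq> dom M" and e: "e \<in> rz_set M (FEx \<phi>) xs" for xs e
  proof -
    have at: "ev ?at [e] {proj e 1}" by (intro ev_pure rec) auto
    obtain y where y: "y \<in> dom M" "proj e 1 \<in> rz_set M \<phi> (y # xs)" using e by auto
    then obtain a where a: "a \<in> resolutions \<phi>" "sat M a (y # xs)" "ev p [proj e 1] {D (FEx a)}"
      using p[of "y # xs" "proj e 1"] xs by auto
    have "ev (RComp p [?at]) [e] {D (FEx a)}" using a(3) by (intro ev_comp1[OF at]) auto
    then show ?thesis using a y by auto
  qed
  then show ?case by blast
next
  case (FAll \<phi>)
  have "sat M (FAll \<phi>) xs" if "length xs = n" "set xs \<subseteq> dom M" "e \<in> rz_set M (FAll \<phi>) xs" for xs e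
    using realizable_iff_sat[OF M FAll.prems that(1,2)] that(3) by blast
  then show ?case by (intro exI[of _ "constp (D (FAll \<phi>))"]) (auto intro: ev_constp)
qed

abbreviation ctxs :: "'a arith_assembly \<Rightarrow> 'a list \<Rightarrow> nat set" where
  "ctxs M xs \<equiv> {list_encode cs | cs. list_all2 (\<lambda>c x. c \<in> J_op (eset M x)) cs xs}"

lemma ctx_ctxs: "c \<in> ctx M xs \<Longrightarrow> as_list (length xs) c \<in> ctxs M xs"
  unfolding ctx_def using as_list_wedges[of c "map (\<lambda>x. J_op (eset M x)) xs"] by (auto simp: list_all2_map2)

text \<open>Every realizer contains realizers of the parameters: atomic formulas, implications and universal
  statements carry them along, and an existential statement has one parameter more in its body.\<close>

lemma context_of_realizer: "\<exists>d. \<forall>xs e. length xs = n \<longrightarrow> e \<in> rz_set M \<phi> xs \<longrightarrow> ev d [e] (ctxs M xs)"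
proof (induction \<phi> arbitrary: n)
  case FBot
  show ?case by simp
next
  case (FEq t s)
  have "ev (pure 1 (\<lambda>zs. as_list n (zs ! 0))) [e] (ctxs M xs)"
    if "length xs = n" "e \<in> rz_set M (FEq t s) xs" for xs e
    using that ctx_ctxs[of e M xs] by (intro ev_pure recfun_as_list) auto
  then show ?case by blast
next
  case (FAnd \<phi> \<chi>)
  obtain d where d: "\<And>xs e. length xs = n \<Longrightarrow> e \<in> rz_set M \<phi> xs \<Longrightarrow> ev d [e] (ctxs M xs)"
    using FAnd.IH(1) by blast
  have "ev (RComp d [pure 1 (\<lambda>zs. proj (zs ! 0) 0)]) [e] (ctxs M xs)"
    if "length xs = n" "e \<in> rz_set M (FAnd \<phi> \<chi>) xs" for xs e
    using that d by (intro ev_comp1[of _ _ "{proj e 0}"] ev_pure rec) auto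
  then show ?case by blast
next
  case (FOr \<phi> \<chi>)
  obtain d where d: "\<And>xs e. length xs = n \<Longrightarrow> e \<in> rz_set M \<phi> xs \<Longrightarrow> ev d [e] (ctxs M xs)"
    using FOr.IH(1) by blast
  obtain d' where d': "\<And>xs e. length xs = n \<Longrightarrow> e \<in> rz_set M \<chi> xs \<Longrightarrow> ev d' [e] (ctxs M xs)"
    using FOr.IH(2) by blast
  have r: "recpred 1 (\<lambda>xs. proj (xs ! 0) 0 = 0)" by (intro rec) auto
  have "ev (ifp 1 (\<lambda>xs. proj (xs ! 0) 0 = 0) (RComp d [pure 1 (\<lambda>zs. proj (zs ! 0) 1)])
      (RComp d' [pure 1 (\<lambda>zs. proj (zs ! 0) 1)])) [e] (ctxs M xs)"
    if "length xs = n" "e \<in> rz_set M (FOr \<phi> \<chi>) xs" for xs e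
    using that d d' by (intro ev_if[OF r] ev_comp1[of _ _ "{proj e 1}"] ev_pure rec) auto
  then show ?case by blast
next
  case (FImp \<phi> \<chi>)
  have "ev (pure 1 (\<lambda>zs. as_list n (proj (zs ! 0) 0))) [e] (ctxs M xs)"
    if "length xs = n" "e \<in> rz_set M (FImp \<phi> \<chi>) xs" for xs e
    using that ctx_ctxs[of "proj e 0" M xs] by (intro ev_pure recfun_comp1[OF recfun_as_list] rec) auto
  then show ?case by blast
next
  case (FEx \<phi>)
  obtain d where d: "\<And>xs e. length xs = Suc n \<Longrightarrow> e \<in> rz_set M \<phi> xs \<Longrightarrow> ev d [e] (ctxs M xs)"
    using FEx.IH by blast
  have "ev (RComp (pure 1 (\<lambda>zs. cdrop 1 (zs ! 0))) [RComp d [pure 1 (\<lambda>zs. proj (zs ! 0) 1)]]) [e] (ctxs M xs)"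
    if e: "length xs = n" "e \<in> rz_set M (FEx \<phi>) xs" for xs e
  proof -
    obtain y where "proj e 1 \<in> rz_set M \<phi> (y # xs)" using e(2) by auto
    then have "ev (RComp d [pure 1 (\<lambda>zs. proj (zs ! 0) 1)]) [e] (ctxs M (y # xs))"
      using e(1) d[of "y # xs"] by (intro ev_comp1[of _ _ "{proj e 1}"] ev_pure rec) auto
    then show ?thesis
      by (rule ev_comp1) (auto simp: list_all2_Cons2 intro!: ev_pure rec)
  qed
  then show ?case by blast
next
  case (FAll \<phi>)
  have "ev (pure 1 (\<lambda>zs. as_list n (proj (zs ! 0) 0))) [e] (ctxs M xs)"
    if "length xs = n" "e \<in> rz_set M (FAll \<phi>) xs" for xs e
    using that ctx_ctxs[of "proj e 0" M xs] by (intro ev_pure recfun_comp1[OF recfun_as_list] rec) auto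
  then show ?case by blast
qed

text \<open>Every resolution \<open>a\<close> of \<open>\<phi>\<close> has a program that realizes it in \<open>M'\<close> from parameters in \<open>M\<close>. The
  given realizer provides the parameters and the index of the program for a resolution that is true
  in \<open>M\<close>, and hence in \<open>M'\<close>.\<close>

theorem realizer_transformation:
  fixes R :: "'a \<Rightarrow> 'b \<Rightarrow> bool"
  assumes M: "tractable M" and M': "tractable M'" and \<phi>: "fm_in n \<phi>"
    and dom: "\<And>x y. R x y \<Longrightarrow> x \<in> dom M \<and> y \<in> dom M'"
    and conv: "\<And>x y c. R x y \<Longrightarrow> c \<in> J_op (eset M x) \<Longrightarrow> ev t [c] (J_op (eset M' y))"
    and sat: "\<And>\<phi> xs ys. fm_in n \<phi> \<Longrightarrow> length xs = n \<Longrightarrow> list_all2 R xs ys \<Longrightarrow> sat M \<phi> xs \<Longrightarrow> sat M' \<phi> ys"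
  shows "\<exists>d. \<forall>xs ys. length xs = n \<longrightarrow> list_all2 R xs ys \<longrightarrow> d \<in> arrow (rz_set M \<phi> xs) (rz_set M' \<phi> ys)"
proof -
  have "\<forall>a\<in>resolutions \<phi>. \<exists>d. \<forall>xs cs. tracks M' n xs cs \<longrightarrow> sat M' a xs \<longrightarrow> ev d cs (rz_set M' \<phi> xs)"
    using realized_and_sound[OF M' \<phi>] unfolding realized_def by blast
  from bchoice[OF this] obtain g where g: "\<And>a xs cs. a \<in> resolutions \<phi> \<Longrightarrow> tracks M' n xs cs \<Longrightarrow> sat M' a xs \<Longrightarrow>
      ev (g a) cs (rz_set M' \<phi> xs)" by blast
  define h where "h a = RComp (g a) (map (\<lambda>i. RComp t [pure 1 (\<lambda>zs. proj (zs ! 0) i)]) [0..<n])" for a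
  have h: "closure (h a) [] \<in> arrow (ctxs M xs) (rz_set M' \<phi> ys)"
    if a: "a \<in> resolutions \<phi>" "sat M a xs" and xs: "length xs = n" "list_all2 R xs ys" for a xs ys
  proof (rule closure_arrow)
    fix c assume "c \<in> ctxs M xs"
    then obtain cs where c: "c = list_encode cs" "list_all2 (\<lambda>c x. c \<in> J_op (eset M x)) cs xs" by blast
    have len: "length cs = n" "length ys = n" using c(2) xs by (auto dest: list_all2_lengthD)
    have "\<forall>i<n. \<exists>y. y \<in> J_op (eset M' (ys ! i)) \<and>
        computes Map.empty (RComp t [pure 1 (\<lambda>zs. proj (zs ! 0) i)]) [c] y"
    proof (intro allI impI)
      fix i assume i: "i < n"
      have "ev (RComp t [pure 1 (\<lambda>zs. proj (zs ! 0) i)]) [c] (J_op (eset M' (ys ! i)))"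
      proof (rule ev_comp1)
        show "ev (pure 1 (\<lambda>zs. proj (zs ! 0) i)) [c] {cs ! i}"
          using i len c(1) by (intro ev_pure rec) auto
        show "ev t [b] (J_op (eset M' (ys ! i)))" if "b \<in> {cs ! i}" for b
          using that i len xs c(2) by (intro conv[of "xs ! i"]) (auto simp: list_all2_conv_all_nth)
      qed
      then show "\<exists>y. y \<in> J_op (eset M' (ys ! i)) \<and>
          computes Map.empty (RComp t [pure 1 (\<lambda>zs. proj (zs ! 0) i)]) [c] y"
        unfolding ev_def by blast
    qed
    then obtain v where v: "\<And>i. i < n \<Longrightarrow> v i \<in> J_op (eset M' (ys ! i))"
        "\<And>i. i < n \<Longrightarrow> computes Map.empty (RComp t [pure 1 (\<lambda>zs. proj (zs ! 0) i)]) [c] (v i)"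
      by metis
    have "set ys \<subseteq> dom M'" using xs(2) by (induction rule: list_all2_induct) (auto dest: dom)
    then have "tracks M' n ys (map v [0..<n])"
      using v(1) len by (auto simp: tracks_def list_all2_conv_all_nth)
    moreover have "sat M' a ys" using sat[OF fm_in_resolutions[OF \<phi> a(1)] xs a(2)] .
    ultimately have "ev (g a) (map v [0..<n]) (rz_set M' \<phi> ys)" using g a(1) by blast
    then show "ev (h a) [c] (rz_set M' \<phi> ys)"
      unfolding h_def using v(2) by (elim ev_comp[rotated]) (auto simp: list_all2_conv_all_nth)
  qed
  obtain p where p: "\<And>xs e. length xs = n \<Longrightarrow> set xs \<subseteq> dom M \<Longrightarrow> e \<in> rz_set M \<phi> xs \<Longrightarrow>
      \<exists>a\<in>resolutions \<phi>. sat M a xs \<and> ev p [e] {closure (h a) []}"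
    using resolution_of_realizer[OF M \<phi>, of "\<lambda>a. closure (h a) []"] by blast
  obtain d where d: "\<And>xs e. length xs = n \<Longrightarrow> e \<in> rz_set M \<phi> xs \<Longrightarrow> ev d [e] (ctxs M xs)"
    using context_of_realizer[of n M \<phi>] by blast
  have "closure (app p d) [] \<in> arrow (rz_set M \<phi> xs) (rz_set M' \<phi> ys)"
    if xs: "length xs = n" "list_all2 R xs ys" for xs ys
  proof (rule closure_arrow)
    fix e assume e: "e \<in> rz_set M \<phi> xs"
    have "set xs \<subseteq> dom M" using xs(2) by (induction rule: list_all2_induct) (auto dest: dom)
    then obtain a where a: "a \<in> resolutions \<phi>" "sat M a xs" "ev p [e] {closure (h a) []}"
      using p[OF xs(1) _ e] by blast
    have "ev p [e] (arrow (ctxs M xs) (rz_set M' \<phi> ys))"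
      using h[OF a(1,2) xs] by (intro ev_mono[OF a(3)]) auto
    then show "ev (app p d) [e] (rz_set M' \<phi> ys)"
      using d[OF xs(1) e] by (rule ev_app)
  qed
  then show ?thesis by blast
qed


section \<open>The two structures are tractable\<close>

text \<open>Before searching, the existence of a witness is decided. The program is applied to all terms of a
  sequence of which finitely many may admit no witness, and has to be defined at these as well.\<close>

definition searchp :: "nat \<Rightarrow> fm \<Rightarrow> recf" where
  "searchp n \<phi> = bindp n (satp n (FEx \<phi>)) (ifp (Suc n) (\<lambda>zs. zs ! 0 = 1)
    (weaken n (mup n (bindp (Suc n) (satp (Suc n) \<phi>) (retp (pure (Suc (Suc n)) (\<lambda>zs. 1 - zs ! 0))))))
    (retp RZero))"

lemma ev_search:
  assumes "fm_in (Suc n) \<phi>" and n: "length xs = n"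
  shows "ev (searchp n \<phi>) xs (J_op {least (\<lambda>a. sat std_nat \<phi> (a # xs))})"
  unfolding searchp_def
proof (rule ev_bind[OF n ev_sat[OF _ n]], simp add: assms(1), rule ev_if)
  fix b assume "b \<in> {of_bool (sat std_nat (FEx \<phi>) xs) :: nat}"
  then have b: "b = of_bool (\<exists>a. sat std_nat \<phi> (a # xs))" by (simp add: std_nat_def)
  let ?test = "bindp (Suc n) (satp (Suc n) \<phi>) (retp (pure (Suc (Suc n)) (\<lambda>zs. 1 - zs ! 0)))"
  have test: "ev ?test (a # xs) (J_op {of_bool (\<not> sat std_nat \<phi> (a # xs))})" for a
  proof (rule ev_bind[OF _ ev_sat[OF assms(1)]])
    show "ev (retp (pure (Suc (Suc n)) (\<lambda>zs. 1 - zs ! 0))) (c # a # xs) (J_op {of_bool (\<not> sat std_nat \<phi> (a # xs))})"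
      if "c \<in> {of_bool (sat std_nat \<phi> (a # xs)) :: nat}" for c
      using that n by (intro ev_ret ev_pure rec) auto
  qed (use n in auto)
  show "ev (weaken n (mup n ?test)) (b # xs) (J_op {least (\<lambda>a. sat std_nat \<phi> (a # xs))})" if "(b # xs) ! 0 = 1"
  proof (rule ev_weaken[OF n ev_mu[OF n]])
    have ex: "\<exists>a. sat std_nat \<phi> (a # xs)" using that b by (cases "\<exists>a. sat std_nat \<phi> (a # xs)") auto
    then have "sat std_nat \<phi> (least (\<lambda>a. sat std_nat \<phi> (a # xs)) # xs)"
      using least[of "\<lambda>a. sat std_nat \<phi> (a # xs)"] by blast
    then show "ev ?test (least (\<lambda>a. sat std_nat \<phi> (a # xs)) # xs) (J_op {0})"
      using test[of "least (\<lambda>a. sat std_nat \<phi> (a # xs))"] by simp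
    fix m assume "m < least (\<lambda>a. sat std_nat \<phi> (a # xs))"
    then have "\<not> sat std_nat \<phi> (m # xs)" using ex by (auto simp: least_def dest: not_less_Least)
    then show "\<exists>v. ev ?test (m # xs) (J_op {Suc v})" using test[of m] by (intro exI[of _ 0]) simp
  qed
  show "ev (retp RZero) (b # xs) (J_op {least (\<lambda>a. sat std_nat \<phi> (a # xs))})" if "(b # xs) ! 0 \<noteq> 1"
    using that b by (intro ev_ret ev_zero) (cases "\<exists>a. sat std_nat \<phi> (a # xs)"; simp add: least_def)
qed (use n in \<open>auto intro!: rec\<close>)

lemma list_all2_vars_J: "list_all2 (\<lambda>c x. c \<in> J_op (E x)) cs xs \<Longrightarrow>
    list_all2 (\<lambda>g A. ev g cs (J_op A)) (map RProj [0..<length cs]) (map E xs)"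
  by (auto simp: list_all2_conv_all_nth intro!: ev_var)

lemma tractable_std_nat: "tractable std_nat"
proof -
  have eset: "eset std_nat = (\<lambda>x. {x})" by (simp add: std_nat_def)
  have read: "ev (bindall n (map RProj [0..<n]) f) cs (J_op B)"
    if t: "tracks std_nat n xs cs" and f: "ev f xs (J_op B)" for n f cs xs B
  proof (rule ev_bindall)
    show "list_all2 (\<lambda>g A. ev g cs (J_op A)) (map RProj [0..<n]) (map (\<lambda>x. {x}) xs)"
      using list_all2_vars_J[of "\<lambda>x. {x}" cs xs] t tracks_length(2)[OF t] by (simp add: tracks_def eset)
    fix ys assume "list_all2 (\<in>) ys (map (\<lambda>x. {x}) xs)"
    then have "ys = xs" by (auto simp: list_all2_conv_all_nth intro: nth_equalityI)
    then show "ev f ys (J_op B)" using f by simp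
  qed (rule tracks_length(2)[OF t])
  show ?thesis
    unfolding tractable_def
  proof (intro conjI allI impI)
    show "\<forall>x\<in>dom std_nat. eset std_nat x \<noteq> {}" by (simp add: eset)
    fix n \<phi>
    {
      assume "fm_in n \<phi>"
      then show "\<exists>d. \<forall>xs cs. tracks std_nat n xs cs \<longrightarrow> ev d cs (J_op {of_bool (sat std_nat \<phi> xs)})"
        using read ev_sat tracks_length(1) by blast
    }
    {
      assume \<phi>: "fm_in (Suc n) \<phi>"
      show "\<exists>d. \<forall>xs cs. tracks std_nat n xs cs \<longrightarrow> sat std_nat (FEx \<phi>) xs \<longrightarrow>
        (\<exists>a\<in>dom std_nat. sat std_nat \<phi> (a # xs) \<and> ev d cs (J_op (eset std_nat a)))"
      proof (intro exI allI impI)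
        fix xs cs assume t: "tracks std_nat n xs cs" and s: "sat std_nat (FEx \<phi>) xs"
        let ?a = "least (\<lambda>a. sat std_nat \<phi> (a # xs))"
        have "sat std_nat \<phi> (?a # xs)" using s least[of "\<lambda>a. sat std_nat \<phi> (a # xs)"] by auto
        moreover have "ev (bindall n (map RProj [0..<n]) (searchp n \<phi>)) cs (J_op {?a})"
          by (rule read[OF t ev_search[OF \<phi> tracks_length(1)[OF t]]])
        ultimately show "\<exists>a\<in>dom std_nat. sat std_nat \<phi> (a # xs) \<and>
            ev (bindall n (map RProj [0..<n]) (searchp n \<phi>)) cs (J_op (eset std_nat a))"
          by (intro bexI[of _ ?a]) (auto simp: eset std_nat_def)
      qed
    }
  qed
qed

lemma nonstd_eset: "eset (nonstd \<psi>) x = {e. \<exists>\<beta>\<in>x. represents e (\<beta> \<circ> \<psi>)}"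
  by (simp add: nonstd_def)

lemma cls_member: "\<beta> \<in> cls \<psi> \<alpha> \<Longrightarrow> arithmetical \<alpha> \<Longrightarrow> arithmetical \<beta> \<and> cls \<psi> \<beta> = cls \<psi> \<alpha>"
  using cls_eq_iff[of \<alpha> \<beta> \<psi>] by (auto simp: cls_def)

text \<open>The environment consists of a number \<open>k\<close> and of indices that represent functions \<open>\<beta> \<circ> \<psi>\<close>; the
  program \<open>f\<close> is evaluated at the values \<open>\<beta>(\<psi>(k))\<close>.\<close>

definition valuesp :: "nat \<Rightarrow> recf \<Rightarrow> recf" where
  "valuesp n f = bindall (Suc n) (map (\<lambda>i. app (RProj (Suc i)) (RProj 0)) [0..<n]) f"

lemma ev_values:
  assumes es: "list_all2 (\<lambda>e \<beta>. represents e (\<beta> \<circ> \<psi>)) es \<beta>s" and n: "length es = n"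
    and f: "ev f (at \<beta>s (\<psi> k)) (J_op B)"
  shows "ev (valuesp n f) (k # es) (J_op B)"
  unfolding valuesp_def
proof (rule ev_bindall)
  have "ev (app (RProj (Suc i)) (RProj 0)) (k # es) (J_op {(\<beta>s ! i) (\<psi> k)})" if i: "i < n" for i
  proof (rule ev_app)
    have "represents (es ! i) ((\<beta>s ! i) \<circ> \<psi>)" using es i n by (auto simp: list_all2_conv_all_nth)
    then have "es ! i \<in> arrow {k} (J_op {(\<beta>s ! i) (\<psi> k)})" by (auto simp: represents_def arrow_def)
    then show "ev (RProj (Suc i)) (k # es) (arrow {k} (J_op {(\<beta>s ! i) (\<psi> k)}))"
      using i n by (intro ev_var) auto
    show "ev (RProj 0) (k # es) {k}" by (rule ev_var) auto
  qed
  then show "list_all2 (\<lambda>g A. ev g (k # es) (J_op A)) (map (\<lambda>i. app (RProj (Suc i)) (RProj 0)) [0..<n])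
      (map (\<lambda>y. {y}) (at \<beta>s (\<psi> k)))"
    using n list_all2_lengthD[OF es] by (auto simp: list_all2_conv_all_nth)
  fix ys assume "list_all2 (\<in>) ys (map (\<lambda>y. {y}) (at \<beta>s (\<psi> k)))"
  then have "ys = at \<beta>s (\<psi> k)" by (auto simp: list_all2_conv_all_nth intro: nth_equalityI)
  then show "ev f ys (J_op B)" using f by simp
qed (simp add: n)

text \<open>The value of an arithmetical function is found by searching for it in the graph.\<close>

lemma representable_arithmetical:
  assumes "represents r \<psi>" "arithmetical \<alpha>"
  shows "\<exists>e. represents e (\<alpha> \<circ> \<psi>)"
proof -
  have "definable 2 (\<lambda>xs. \<alpha> (xs ! 1) = xs ! 0)"
    using definable_rename2[of "\<lambda>x y. \<alpha> x = y" 1 2 0] assms(2) by (simp add: arithmetical_iff)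
  then obtain \<phi> where \<phi>1: "fm_in 2 \<phi>" and
      "\<And>xs. length xs = 2 \<Longrightarrow> (\<alpha> (xs ! 1) = xs ! 0) = sat std_nat \<phi> xs"
    unfolding definable_def by blast
  from this(2)[of "[_, _]"] have \<phi>2: "sat std_nat \<phi> [y, x] \<longleftrightarrow> \<alpha> x = y" for x y by simp
  have "represents (closure (bindp 1 (app (constp r) (RProj 0)) (rename [0] (searchp 1 \<phi>))) []) (\<alpha> \<circ> \<psi>)"
  proof (rule representsI, rule ev_bind)
    fix k
    show "ev (app (constp r) (RProj 0)) [k] (J_op {\<psi> k})"
    proof (rule ev_app)
      show "ev (constp r) [k] (arrow {k} (J_op {\<psi> k}))"
        using assms(1) by (intro ev_constp) (auto simp: represents_def arrow_def)
      show "ev (RProj 0) [k] {k}" by (rule ev_var) auto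
    qed
    fix m assume "m \<in> {\<psi> k}"
    then have m: "m = \<psi> k" by simp
    have "(LEAST a. \<alpha> m = a) = \<alpha> m" by (rule Least_equality) auto
    then have "least (\<lambda>a. sat std_nat \<phi> [a, m]) = \<alpha> m" unfolding \<phi>2 least_def by simp
    then have "ev (searchp 1 \<phi>) [m] (J_op {\<alpha> m})"
      using ev_search[of 1 \<phi> "[m]"] \<phi>1 by (simp add: numeral_2_eq_2)
    then show "ev (rename [0] (searchp 1 \<phi>)) [m, k] (J_op {(\<alpha> \<circ> \<psi>) k})"
      by (intro ev_rename) (auto simp: m)
  qed simp
  then show ?thesis by blast
qed

text \<open>By the theorem of Los the truth value of \<open>\<phi>\<close> in \<open>\<N>\<close> is the limit of its truth values at
  \<open>\<psi>(k)\<close>. The realizers may deliver other representatives of the parameters than the ones that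
  the witness was formed from, but the least witnesses for equivalent representatives are
  equivalent.\<close>

lemma tractable_nonstd:
  assumes \<psi>: "decisive \<psi>" and r: "represents r \<psi>"
  shows "tractable (nonstd \<psi>)"
proof -
  have read: "ev (bindall n (map RProj [0..<n]) f) cs (J_op B)"
    if t: "tracks (nonstd \<psi>) n xs cs"
      and f: "\<And>es \<beta>s. list_all2 (\<lambda>e \<beta>. represents e (\<beta> \<circ> \<psi>)) es \<beta>s \<Longrightarrow> length es = n \<Longrightarrow> length \<beta>s = n \<Longrightarrow>
        \<forall>\<beta>\<in>set \<beta>s. arithmetical \<beta> \<Longrightarrow> xs = map (cls \<psi>) \<beta>s \<Longrightarrow> ev f es (J_op B)" for n f cs xs B
  proof (rule ev_bindall)
    show "list_all2 (\<lambda>g A. ev g cs (J_op A)) (map RProj [0..<n]) (map (eset (nonstd \<psi>)) xs)"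
      using list_all2_vars_J[of "eset (nonstd \<psi>)" cs xs] t tracks_length(2)[OF t] by (simp add: tracks_def)
    fix es assume es: "list_all2 (\<in>) es (map (eset (nonstd \<psi>)) xs)"
    have "\<forall>i<n. \<exists>\<beta>. represents (es ! i) (\<beta> \<circ> \<psi>) \<and> arithmetical \<beta> \<and> xs ! i = cls \<psi> \<beta>"
    proof (intro allI impI)
      fix i assume i: "i < n"
      then have "xs ! i \<in> dom (nonstd \<psi>)" using t tracks_length(1)[OF t] by (auto simp: tracks_def)
      then obtain \<alpha> where \<alpha>: "arithmetical \<alpha>" "xs ! i = cls \<psi> \<alpha>" by (auto simp: nonstd_dom)
      have "es ! i \<in> eset (nonstd \<psi>) (xs ! i)"
        using es i tracks_length(1)[OF t] by (auto simp: list_all2_conv_all_nth)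
      then obtain \<beta> where "\<beta> \<in> cls \<psi> \<alpha>" "represents (es ! i) (\<beta> \<circ> \<psi>)"
        unfolding nonstd_eset \<alpha>(2) by blast
      then show "\<exists>\<beta>. represents (es ! i) (\<beta> \<circ> \<psi>) \<and> arithmetical \<beta> \<and> xs ! i = cls \<psi> \<beta>"
        using cls_member[of \<beta> \<psi> \<alpha>] \<alpha> by metis
    qed
    then obtain \<beta> where \<beta>: "\<And>i. i < n \<Longrightarrow> represents (es ! i) (\<beta> i \<circ> \<psi>)" "\<And>i. i < n \<Longrightarrow> arithmetical (\<beta> i)"
        "\<And>i. i < n \<Longrightarrow> xs ! i = cls \<psi> (\<beta> i)" by metis
    have len: "length es = n" using es tracks_length(1)[OF t] by (auto dest: list_all2_lengthD)
    show "ev f es (J_op B)"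
      by (rule f[of es "map \<beta> [0..<n]"])
         (use \<beta> len tracks_length(1)[OF t] in \<open>auto simp: list_all2_conv_all_nth intro: nth_equalityI\<close>)
  qed (rule tracks_length(2)[OF t])
  show ?thesis
    unfolding tractable_def
  proof (intro conjI allI impI)
    show "\<forall>x\<in>dom (nonstd \<psi>). eset (nonstd \<psi>) x \<noteq> {}"
    proof
      fix x assume "x \<in> dom (nonstd \<psi>)"
      then obtain \<alpha> where \<alpha>: "arithmetical \<alpha>" "x = cls \<psi> \<alpha>" by (auto simp: nonstd_dom)
      then show "eset (nonstd \<psi>) x \<noteq> {}"
        using representable_arithmetical[OF r \<alpha>(1)] cls_self[OF \<alpha>(1), of \<psi>] by (auto simp: nonstd_eset)
    qed
    fix n \<phi>
    show "\<exists>d. \<forall>xs cs. tracks (nonstd \<psi>) n xs cs \<longrightarrow> ev d cs (J_op {of_bool (sat (nonstd \<psi>) \<phi> xs)})"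
      if \<phi>: "fm_in n \<phi>"
    proof (intro exI allI impI)
      fix xs cs assume t: "tracks (nonstd \<psi>) n xs cs"
      show "ev (bindall n (map RProj [0..<n]) (limp n (valuesp n (satp n \<phi>)))) cs (J_op {of_bool (sat (nonstd \<psi>) \<phi> xs)})"
      proof (rule read[OF t])
        fix es \<beta>s
        assume es: "list_all2 (\<lambda>e \<beta>. represents e (\<beta> \<circ> \<psi>)) es \<beta>s" and len: "length es = n" "length \<beta>s = n"
          and \<beta>s: "\<forall>\<beta>\<in>set \<beta>s. arithmetical \<beta>" "xs = map (cls \<psi>) \<beta>s"
        have "\<forall>\<^sub>F k in sequentially. sat std_nat \<phi> (at \<beta>s (\<psi> k)) \<longleftrightarrow> sat (nonstd \<psi>) \<phi> xs"
        proof (cases "sat (nonstd \<psi>) \<phi> xs")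
          case True
          then show ?thesis using Los[OF \<psi> _ \<beta>s(1), of \<phi>] \<phi> len \<beta>s(2) by simp
        next
          case False
          then show ?thesis
            using Los[OF \<psi> _ \<beta>s(1), of \<phi>] decisive_at[OF \<psi> definable_sat \<beta>s(1), of \<phi>] \<phi> len \<beta>s(2) by simp
        qed
        then obtain N where N: "\<And>k. N \<le> k \<Longrightarrow> sat std_nat \<phi> (at \<beta>s (\<psi> k)) \<longleftrightarrow> sat (nonstd \<psi>) \<phi> xs"
          unfolding eventually_sequentially by blast
        show "ev (limp n (valuesp n (satp n \<phi>))) es (J_op {of_bool (sat (nonstd \<psi>) \<phi> xs)})"
        proof (rule ev_lim[OF len(1)], rule ev_values[OF es len(1)])
          fix k assume "N \<le> k"
          then show "ev (satp n \<phi>) (at \<beta>s (\<psi> k)) (J_op {of_bool (sat (nonstd \<psi>) \<phi> xs)})"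
            using ev_sat[OF \<phi>, of "at \<beta>s (\<psi> k)"] len N by simp
        qed
      qed
    qed
    show "\<exists>d. \<forall>xs cs. tracks (nonstd \<psi>) n xs cs \<longrightarrow> sat (nonstd \<psi>) (FEx \<phi>) xs \<longrightarrow>
        (\<exists>a\<in>dom (nonstd \<psi>). sat (nonstd \<psi>) \<phi> (a # xs) \<and> ev d cs (J_op (eset (nonstd \<psi>) a)))"
      if \<phi>: "fm_in (Suc n) \<phi>"
    proof (intro exI allI impI)
      fix xs cs assume t: "tracks (nonstd \<psi>) n xs cs" and s: "sat (nonstd \<psi>) (FEx \<phi>) xs"
      let ?\<gamma> = "\<lambda>\<alpha>s k. least (\<lambda>a. sat std_nat \<phi> (a # at \<alpha>s k))"
      have "\<forall>x\<in>set xs. \<exists>\<alpha>. arithmetical \<alpha> \<and> x = cls \<psi> \<alpha>" using t unfolding tracks_def nonstd_dom by blast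
      from bchoice[OF this] obtain c where c: "\<forall>x\<in>set xs. arithmetical (c x) \<and> x = cls \<psi> (c x)" by blast
      then have "map (cls \<psi>) (map c xs) = xs" by (simp add: map_idI)
      with c obtain \<alpha>s where \<alpha>s: "xs = map (cls \<psi>) \<alpha>s" "\<forall>\<alpha>\<in>set \<alpha>s. arithmetical \<alpha>"
        by (metis (no_types, lifting) imageE list.set_map)
      then have n: "length \<alpha>s = n" using tracks_length(1)[OF t] by simp
      have \<gamma>: "arithmetical (?\<gamma> \<alpha>s)" using arithmetical_witness \<alpha>s(2) \<phi> n by simp
      have "\<forall>\<^sub>F k in sequentially. sat std_nat (FEx \<phi>) (at \<alpha>s (\<psi> k))"
        using Los[OF \<psi> _ \<alpha>s(2), of "FEx \<phi>"] \<phi> n s \<alpha>s(1) by simp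
      then have "\<forall>\<^sub>F k in sequentially. sat std_nat \<phi> (at (?\<gamma> \<alpha>s # \<alpha>s) (\<psi> k))"
        by eventually_elim (auto intro: least)
      then have "sat (nonstd \<psi>) \<phi> (cls \<psi> (?\<gamma> \<alpha>s) # xs)"
        using Los[OF \<psi>, of "?\<gamma> \<alpha>s # \<alpha>s" \<phi>] \<gamma> \<alpha>s \<phi> n by simp
      moreover have "ev (bindall n (map RProj [0..<n]) (retp (lam n (valuesp n (searchp n \<phi>))))) cs
          (J_op (eset (nonstd \<psi>) (cls \<psi> (?\<gamma> \<alpha>s))))"
      proof (rule read[OF t])
        fix es \<beta>s
        assume es: "list_all2 (\<lambda>e \<beta>. represents e (\<beta> \<circ> \<psi>)) es \<beta>s" and len: "length es = n" "length \<beta>s = n"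
          and \<beta>s: "\<forall>\<beta>\<in>set \<beta>s. arithmetical \<beta>" "xs = map (cls \<psi>) \<beta>s"
        have "closure (valuesp n (searchp n \<phi>)) es \<in> arrow {k} (J_op {?\<gamma> \<beta>s (\<psi> k)})" for k
        proof (rule closure_arrow)
          show "ev (valuesp n (searchp n \<phi>)) (j # es) (J_op {?\<gamma> \<beta>s (\<psi> k)})" if "j \<in> {k}" for j
            using that ev_values[OF es len(1) ev_search[OF \<phi>]] len(2) by simp
        qed
        then have "represents (closure (valuesp n (searchp n \<phi>)) es) (?\<gamma> \<beta>s \<circ> \<psi>)"
          by (simp add: represents_def arrow_def)
        moreover have "?\<gamma> \<beta>s \<in> cls \<psi> (?\<gamma> \<alpha>s)"
        proof -
          have "\<beta>s ! i \<in> cls \<psi> (\<alpha>s ! i)" if "i < n" for i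
          proof -
            have "cls \<psi> (\<beta>s ! i) = cls \<psi> (\<alpha>s ! i)"
              using \<alpha>s(1) \<beta>s(2) that n len(2) by (metis nth_map)
            then show ?thesis using cls_self[of "\<beta>s ! i" \<psi>] \<beta>s(1) that len(2) by simp
          qed
          then have "list_all2 (\<lambda>\<beta> \<alpha>. \<beta> \<in> cls \<psi> \<alpha>) \<beta>s \<alpha>s"
            using n len by (simp add: list_all2_conv_all_nth)
          from eventually_at[OF this]
          have "\<forall>\<^sub>F k in sequentially. ?\<gamma> \<alpha>s (\<psi> k) = ?\<gamma> \<beta>s (\<psi> k)" by eventually_elim simp
          moreover have "arithmetical (?\<gamma> \<beta>s)" using arithmetical_witness \<beta>s(1) \<phi> len by simp
          ultimately show ?thesis by (simp add: cls_def)
        qed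
        ultimately have "closure (valuesp n (searchp n \<phi>)) es \<in> eset (nonstd \<psi>) (cls \<psi> (?\<gamma> \<alpha>s))"
          by (auto simp: nonstd_eset)
        then show "ev (retp (lam n (valuesp n (searchp n \<phi>)))) es (J_op (eset (nonstd \<psi>) (cls \<psi> (?\<gamma> \<alpha>s))))"
          using len by (intro ev_ret ev_lam_closure) auto
      qed
      ultimately show "\<exists>a\<in>dom (nonstd \<psi>). sat (nonstd \<psi>) \<phi> (a # xs) \<and>
          ev (bindall n (map RProj [0..<n]) (retp (lam n (valuesp n (searchp n \<phi>))))) cs (J_op (eset (nonstd \<psi>) a))"
        using \<gamma> by (intro bexI[of _ "cls \<psi> (?\<gamma> \<alpha>s)"]) (auto simp: nonstd_dom)
    qed
  qed
qed

section \<open>Operations are morphisms\<close>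

text \<open>The value of a term \<open>t\<close> is tracked as it is the only witness of \<open>\<exists>y. y = t\<close>.\<close>

lemma tractable_tm:
  assumes M: "tractable M" and t: "tm_in n t"
    and dom: "\<And>xs. length xs = n \<Longrightarrow> set xs \<subseteq> dom M \<Longrightarrow> tm_val M xs t \<in> dom M"
  shows "\<exists>d. \<forall>xs cs. tracks M n xs cs \<longrightarrow> ev d cs (J_op (eset M (tm_val M xs t)))"
proof -
  define s where "s = rename_tm Suc t"
  have s: "tm_in (Suc n) s \<and> tm_val M (a # xs) s = tm_val M xs t" if "length xs = n" for a xs
    using rename_tm[of Suc xs "a # xs" t M] t that by (simp add: s_def renames_def)
  have "tm_in (Suc n) s" using s[of "replicate n undefined"] by simp
  then have "fm_in (Suc n) (FEq (TVar 0) s)" by simp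
  then obtain d where d: "\<And>xs cs. tracks M n xs cs \<Longrightarrow> sat M (FEx (FEq (TVar 0) s)) xs \<Longrightarrow>
      \<exists>a\<in>dom M. sat M (FEq (TVar 0) s) (a # xs) \<and> ev d cs (J_op (eset M a))"
    using tractable_witness[OF M] by blast
  have "ev d cs (J_op (eset M (tm_val M xs t)))" if tr: "tracks M n xs cs" for xs cs
  proof -
    have xs: "length xs = n" "set xs \<subseteq> dom M" using tr by (auto simp: tracks_def)
    show ?thesis using d[OF tr] s[OF xs(1)] dom[OF xs] by auto
  qed
  then show ?thesis by blast
qed

lemma tractable_assembly:
  assumes M: "tractable M" and zer: "zer M \<in> dom M" and suc: "\<And>x. x \<in> dom M \<Longrightarrow> suc M x \<in> dom M"
    and add: "\<And>x y. x \<in> dom M \<Longrightarrow> y \<in> dom M \<Longrightarrow> add M x y \<in> dom M"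
    and mul: "\<And>x y. x \<in> dom M \<Longrightarrow> y \<in> dom M \<Longrightarrow> mul M x y \<in> dom M"
  shows "is_arith_assembly M"
proof -
  have binary: "is_morphism (prod_assembly (assembly_of M) (assembly_of M)) (assembly_of M) (\<lambda>(x, y). f x y)"
    if dom: "\<And>x y. x \<in> dom M \<Longrightarrow> y \<in> dom M \<Longrightarrow> f x y \<in> dom M"
      and t: "tm_in 2 t" "\<And>x y. tm_val M [x, y] t = f x y" for f t
  proof -
    have len2: "length xs = 2 \<longleftrightarrow> (\<exists>x y. xs = [x, y])" for xs :: "'a list"
      by (auto simp: numeral_2_eq_2 length_Suc_conv)
    have "\<exists>d. \<forall>xs cs. tracks M 2 xs cs \<longrightarrow> ev d cs (J_op (eset M (tm_val M xs t)))"
      by (rule tractable_tm[OF M t(1)]) (use dom t(2) in \<open>auto simp: len2\<close>)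
    then obtain d where d: "\<And>xs cs. tracks M 2 xs cs \<Longrightarrow> ev d cs (J_op (eset M (tm_val M xs t)))"
      by blast
    let ?at = "\<lambda>i. retp (pure 1 (\<lambda>zs. proj (zs ! 0) i))"
    have "closure (RComp d [?at 0, ?at 1]) [] \<in> arrow (wedge (eset M x) (eset M y)) (J_op (eset M (f x y)))"
      if xy: "x \<in> dom M" "y \<in> dom M" for x y
    proof (rule closure_arrow)
      fix e assume "e \<in> wedge (eset M x) (eset M y)"
      then obtain a b where e: "e = list_encode [a, b]" "a \<in> eset M x" "b \<in> eset M y"
        by (auto simp: wedge_def)
      show "ev (RComp d [?at 0, ?at 1]) [e] (J_op (eset M (f x y)))"
      proof (rule ev_comp2)
        show "ev (?at 0) [e] (J_op (eset M x))" using e by (intro ev_ret ev_pure rec) auto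
        show "ev (?at 1) [e] (J_op (eset M y))" using e by (intro ev_ret ev_pure rec) auto
        show "ev d [a, b] (J_op (eset M (f x y)))" if "a \<in> J_op (eset M x)" "b \<in> J_op (eset M y)" for a b
          using d[of "[x, y]" "[a, b]"] that xy t(2) by (simp add: tracks_def)
      qed
    qed
    then show ?thesis
      using dom by (auto simp: is_morphism_def prod_assembly_def assembly_of_def)
  qed
  have "is_morphism (assembly_of M) (assembly_of M) (suc M)"
  proof -
    have "\<exists>d. \<forall>xs cs. tracks M 1 xs cs \<longrightarrow> ev d cs (J_op (eset M (tm_val M xs (TSucc (TVar 0)))))"
      by (rule tractable_tm[OF M]) (use suc in \<open>auto simp: length_Suc_conv\<close>)
    then obtain d where d: "\<And>xs cs. tracks M 1 xs cs \<Longrightarrow> ev d cs (J_op (eset M (tm_val M xs (TSucc (TVar 0)))))"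
      by blast
    have "closure (RComp d [retp (RProj 0)]) [] \<in> arrow (eset M x) (J_op (eset M (suc M x)))" if "x \<in> dom M" for x
    proof (rule closure_arrow, rule ev_comp1)
      show "ev (retp (RProj 0)) [e] (J_op (eset M x))" if "e \<in> eset M x" for e
        using that by (intro ev_ret ev_var) auto
      show "ev d [c] (J_op (eset M (suc M x)))" if "c \<in> J_op (eset M x)" for c
        using d[of "[x]" "[c]"] that \<open>x \<in> dom M\<close> by (simp add: tracks_def)
    qed
    then show ?thesis using suc by (auto simp: is_morphism_def assembly_of_def)
  qed
  moreover have "is_assembly (assembly_of M)"
    using M by (auto simp: is_assembly_def assembly_of_def tractable_def)
  ultimately show ?thesis
    unfolding is_arith_assembly_def
    using zer binary[of "add M" "TAdd (TVar 0) (TVar 1)"] add binary[of "mul M" "TMul (TVar 0) (TVar 1)"] mul by simp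
qed

lemma assembly_std_nat: "is_arith_assembly std_nat"
  by (rule tractable_assembly[OF tractable_std_nat]) (auto simp: std_nat_def)

lemma assembly_nonstd: "tractable (nonstd \<psi>) \<Longrightarrow> is_arith_assembly (nonstd \<psi>)"
  by (erule tractable_assembly)
     (auto simp: nonstd_dom nonstd_zer nonstd_suc nonstd_add nonstd_mul
       intro!: imageI arithmetical_const arithmetical_Suc arithmetical_add arithmetical_mult)

section \<open>The embedding\<close>

text \<open>A number \<open>a\<close> is turned into an index of the constant sequence \<open>a\<close>, which represents the constant
  function composed with \<open>\<psi>\<close>.\<close>

definition constant_sequence :: recf where
  "constant_sequence = bindp 1 (RProj 0) (retp (lam 2 (retp (RProj 1))))"

lemma ev_constant_sequence:
  assumes "c \<in> J_op {a}" shows "ev constant_sequence [c] (J_op (eset (nonstd \<psi>) (incl \<psi> a)))"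
  unfolding constant_sequence_def
proof (rule ev_bind)
  show "ev (RProj 0) [c] (J_op {a})" using assms by (intro ev_var) auto
  fix b assume "b \<in> {a}"
  then have "closure (retp (RProj 1)) [b, c] \<in> arrow {k} (J_op {a})" for k
    by (intro closure_arrow ev_ret ev_var) auto
  then have "represents (closure (retp (RProj 1)) [b, c]) ((\<lambda>_. a) \<circ> \<psi>)"
    by (simp add: represents_def arrow_def)
  then have "closure (retp (RProj 1)) [b, c] \<in> eset (nonstd \<psi>) (incl \<psi> a)"
    using cls_self[OF arithmetical_const, of a \<psi>] unfolding nonstd_eset incl_def by blast
  then show "ev (retp (lam 2 (retp (RProj 1)))) [b, c] (J_op (eset (nonstd \<psi>) (incl \<psi> a)))"
    by (intro ev_ret ev_lam_closure) auto
qed simp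

text \<open>A function in the class of a constant is eventually constant along \<open>\<psi>\<close>, so the sequence that
  represents it has the constant as its limit.\<close>

definition limit_value :: recf where
  "limit_value = bindp 1 (RProj 0) (limp 2 (app (RProj 1) (RProj 0)))"

lemma ev_limit_value:
  assumes "c \<in> J_op (eset (nonstd \<psi>) (incl \<psi> a))" shows "ev limit_value [c] (J_op {a})"
  unfolding limit_value_def
proof (rule ev_bind)
  show "ev (RProj 0) [c] (J_op (eset (nonstd \<psi>) (incl \<psi> a)))" using assms by (intro ev_var) auto
  fix e assume "e \<in> eset (nonstd \<psi>) (incl \<psi> a)"
  then obtain \<beta> where \<beta>: "\<beta> \<in> cls \<psi> (\<lambda>_. a)" "represents e (\<beta> \<circ> \<psi>)" by (auto simp: nonstd_eset incl_def)
  then obtain N where N: "\<And>k. N \<le> k \<Longrightarrow> \<beta> (\<psi> k) = a" by (auto simp: cls_def eventually_sequentially)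
  show "ev (limp 2 (app (RProj 1) (RProj 0))) [e, c] (J_op {a})"
  proof (rule ev_lim)
    fix k assume "N \<le> k"
    then have "e \<in> arrow {k} (J_op {a})" using \<beta>(2) N by (auto simp: represents_def arrow_def)
    then have 1: "ev (RProj 1) [k, e, c] (arrow {k} (J_op {a}))" by (intro ev_var) auto
    show "ev (app (RProj 1) (RProj 0)) [k, e, c] (J_op {a})" by (rule ev_app[OF 1]) (auto intro: ev_var)
  qed simp
qed simp

lemma morphism_incl: "is_morphism (assembly_of std_nat) (assembly_of (nonstd \<psi>)) (incl \<psi>)"
proof -
  have "closure (RComp constant_sequence [retp (RProj 0)]) [] \<in> arrow {a} (J_op (eset (nonstd \<psi>) (incl \<psi> a)))" for a
  proof (rule closure_arrow, rule ev_comp1)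
    show "ev (retp (RProj 0)) [e] (J_op {a})" if "e \<in> {a}" for e
      using that by (intro ev_ret ev_var) auto
  qed (rule ev_constant_sequence)
  then show ?thesis
    by (auto simp: is_morphism_def assembly_of_def std_nat_def nonstd_dom incl_def arithmetical_const)
qed

lemma sat_incl:
  assumes "decisive \<psi>" "fm_in (length as) \<phi>"
  shows "sat (nonstd \<psi>) \<phi> (map (incl \<psi>) as) \<longleftrightarrow> sat std_nat \<phi> as"
proof -
  have incl: "map (incl \<psi>) as = map (cls \<psi>) (map (\<lambda>a _. a) as)" by (simp add: incl_def)
  show ?thesis
    unfolding incl
    using Los[OF assms(1), of "map (\<lambda>a _. a) as" \<phi>] assms(2) by (simp add: comp_def arithmetical_const)
qed

theorem theorem3p1:
  fixes \<alpha> :: "nat \<Rightarrow> nat \<Rightarrow> nat" and \<psi> :: "nat \<Rightarrow> nat"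
  assumes enumeration: "range \<alpha> = {f. arithmetical f}"
    and effective: "construction_recursive_in truth \<alpha>"
    and psi: "\<psi> = psi \<alpha>"
  shows "is_arith_assembly std_nat \<and> is_arith_assembly (nonstd \<psi>) \<and>
    is_morphism (assembly_of std_nat) (assembly_of (nonstd \<psi>)) (incl \<psi>) \<and>
    elementary_embedding std_nat (nonstd \<psi>) (incl \<psi>) \<and>
    (\<forall>n \<phi>. fm_in n \<phi> \<longrightarrow>
      (\<forall>as. length as = n \<longrightarrow>
        (sat std_nat \<phi> as \<longleftrightarrow> rz_set std_nat \<phi> as \<noteq> {}) \<and>
        (rz_set std_nat \<phi> as \<noteq> {} \<longleftrightarrow> rz_set (nonstd \<psi>) \<phi> (map (incl \<psi>) as) \<noteq> {}) \<and>
        (rz_set (nonstd \<psi>) \<phi> (map (incl \<psi>) as) \<noteq> {} \<longleftrightarrow>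
          sat (nonstd \<psi>) \<phi> (map (incl \<psi>) as))) \<and>
      (\<exists>d. \<forall>as. length as = n \<longrightarrow>
        d \<in> arrow (rz_set std_nat \<phi> as) (rz_set (nonstd \<psi>) \<phi> (map (incl \<psi>) as))) \<and>
      (\<exists>d. \<forall>as. length as = n \<longrightarrow>
        d \<in> arrow (rz_set (nonstd \<psi>) \<phi> (map (incl \<psi>) as)) (rz_set std_nat \<phi> as)) \<and>
      (\<forall>\<alpha>s. length \<alpha>s = n \<and> (\<forall>\<beta>\<in>set \<alpha>s. arithmetical \<beta>) \<longrightarrow>
        (sat (nonstd \<psi>) \<phi> (map (cls \<psi>) \<alpha>s) \<longleftrightarrow>
          rz_set (nonstd \<psi>) \<phi> (map (cls \<psi>) \<alpha>s) \<noteq> {}) \<and>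
        (rz_set (nonstd \<psi>) \<phi> (map (cls \<psi>) \<alpha>s) \<noteq> {} \<longleftrightarrow>
          finite {k. \<not> sat std_nat \<phi> (map (\<lambda>\<beta>. \<beta> (\<psi> k)) \<alpha>s)})))"
proof -
  have dec: "decisive \<psi>" unfolding psi by (rule decisive_psi[OF enumeration])
  obtain r where "represents r \<psi>"
    using recursive_in_truth_representable[of "psi \<alpha>"] effective unfolding construction_recursive_in_def psi by blast
  note nonstd = tractable_nonstd[OF dec this]
  have dom: "incl \<psi> a \<in> dom (nonstd \<psi>)" for a by (simp add: nonstd_dom incl_def arithmetical_const)
  have std_univ: "dom std_nat = UNIV" and std_eset: "eset std_nat a = {a}" for a by (simp_all add: std_nat_def)
  have i_ii: "rz_set std_nat \<phi> ms \<noteq> {} \<longleftrightarrow> sat std_nat \<phi> ms"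
    and iii_iv: "rz_set (nonstd \<psi>) \<phi> (map (incl \<psi>) ms) \<noteq> {} \<longleftrightarrow> sat (nonstd \<psi>) \<phi> (map (incl \<psi>) ms)"
    and i_iv: "sat (nonstd \<psi>) \<phi> (map (incl \<psi>) ms) \<longleftrightarrow> sat std_nat \<phi> ms"
    if "fm_in n \<phi>" "length ms = n" for n \<phi> ms
  proof -
    show "rz_set std_nat \<phi> ms \<noteq> {} \<longleftrightarrow> sat std_nat \<phi> ms"
      by (rule realizable_iff_sat[OF tractable_std_nat that]) (simp add: std_univ)
    show "rz_set (nonstd \<psi>) \<phi> (map (incl \<psi>) ms) \<noteq> {} \<longleftrightarrow> sat (nonstd \<psi>) \<phi> (map (incl \<psi>) ms)"
      by (rule realizable_iff_sat[OF nonstd that(1)]) (use that dom in auto)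
    show "sat (nonstd \<psi>) \<phi> (map (incl \<psi>) ms) \<longleftrightarrow> sat std_nat \<phi> ms"
      by (rule sat_incl[OF dec]) (use that in simp)
  qed
  have elementary: "elementary_embedding std_nat (nonstd \<psi>) (incl \<psi>)"
    unfolding elementary_embedding_def using i_ii iii_iv i_iv by blast
  have to_nonstd: "\<exists>d. \<forall>ms. length ms = n \<longrightarrow>
      d \<in> arrow (rz_set std_nat \<phi> ms) (rz_set (nonstd \<psi>) \<phi> (map (incl \<psi>) ms))" if \<phi>: "fm_in n \<phi>" for n \<phi>
  proof -
    have "\<exists>d. \<forall>ms bs. length ms = n \<longrightarrow> list_all2 (\<lambda>a b. b = incl \<psi> a) ms bs \<longrightarrow>
        d \<in> arrow (rz_set std_nat \<phi> ms) (rz_set (nonstd \<psi>) \<phi> bs)"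
    proof (rule realizer_transformation[OF tractable_std_nat nonstd \<phi>])
      show "ev constant_sequence [c] (J_op (eset (nonstd \<psi>) b))" if "b = incl \<psi> a" "c \<in> J_op (eset std_nat a)" for a b c
        using ev_constant_sequence that by (simp add: std_eset)
      show "sat (nonstd \<psi>) \<chi> bs" if "fm_in n \<chi>" "length ms = n" "list_all2 (\<lambda>a b. b = incl \<psi> a) ms bs" "sat std_nat \<chi> ms"
        for \<chi> ms bs
      proof -
        have "bs = map (incl \<psi>) ms" using that(3) by (induction rule: list_all2_induct) auto
        then show ?thesis using i_iv that by blast
      qed
    qed (simp add: std_univ dom)
    moreover have "list_all2 (\<lambda>a b. b = incl \<psi> a) ms (map (incl \<psi>) ms)" for ms by (induction ms) auto
    ultimately show ?thesis by blast
  qed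
  have from_nonstd: "\<exists>d. \<forall>ms. length ms = n \<longrightarrow>
      d \<in> arrow (rz_set (nonstd \<psi>) \<phi> (map (incl \<psi>) ms)) (rz_set std_nat \<phi> ms)" if \<phi>: "fm_in n \<phi>" for n \<phi>
  proof -
    have "\<exists>d. \<forall>bs ms. length bs = n \<longrightarrow> list_all2 (\<lambda>b a. b = incl \<psi> a) bs ms \<longrightarrow>
        d \<in> arrow (rz_set (nonstd \<psi>) \<phi> bs) (rz_set std_nat \<phi> ms)"
    proof (rule realizer_transformation[OF nonstd tractable_std_nat \<phi>])
      show "ev limit_value [c] (J_op (eset std_nat a))" if "b = incl \<psi> a" "c \<in> J_op (eset (nonstd \<psi>) b)" for a b c
        using ev_limit_value that by (simp add: std_eset)
      show "sat std_nat \<chi> ms" if "fm_in n \<chi>" "length bs = n" "list_all2 (\<lambda>b a. b = incl \<psi> a) bs ms" "sat (nonstd \<psi>) \<chi> bs"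
        for \<chi> ms bs
      proof -
        have "bs = map (incl \<psi>) ms" using that(3) by (induction rule: list_all2_induct) auto
        then show ?thesis using i_iv[of n \<chi> ms] that by simp
      qed
    qed (simp add: std_univ dom)
    moreover have "list_all2 (\<lambda>b a. b = incl \<psi> a) (map (incl \<psi>) ms) ms" for ms by (induction ms) auto
    ultimately show ?thesis by (metis length_map)
  qed
  have i_ii': "rz_set (nonstd \<psi>) \<phi> (map (cls \<psi>) \<alpha>s) \<noteq> {} \<longleftrightarrow> sat (nonstd \<psi>) \<phi> (map (cls \<psi>) \<alpha>s)"
    and i_iii': "sat (nonstd \<psi>) \<phi> (map (cls \<psi>) \<alpha>s) \<longleftrightarrow> finite {k. \<not> sat std_nat \<phi> (at \<alpha>s (\<psi> k))}"
    if "fm_in n \<phi>" "length \<alpha>s = n \<and> (\<forall>\<beta>\<in>set \<alpha>s. arithmetical \<beta>)" for n \<phi> \<alpha>s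
  proof -
    show "rz_set (nonstd \<psi>) \<phi> (map (cls \<psi>) \<alpha>s) \<noteq> {} \<longleftrightarrow> sat (nonstd \<psi>) \<phi> (map (cls \<psi>) \<alpha>s)"
      by (rule realizable_iff_sat[OF nonstd that(1)]) (use that(2) in \<open>auto simp: nonstd_dom\<close>)
    show "sat (nonstd \<psi>) \<phi> (map (cls \<psi>) \<alpha>s) \<longleftrightarrow> finite {k. \<not> sat std_nat \<phi> (at \<alpha>s (\<psi> k))}"
      using Los[OF dec, of \<alpha>s \<phi>] that by (simp add: cofinite_eq_sequentially[symmetric] eventually_cofinite)
  qed
  show ?thesis
    using assembly_std_nat assembly_nonstd[OF nonstd] morphism_incl elementary to_nonstd from_nonstd
    by (simp add: i_ii iii_iv i_iv i_ii' i_iii')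
qed


end
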